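(* Let $a\in\operatorname{M}_\Lambda$ and $b\in\operatorname{M}_\Lambda^\times$, and let $G\subset\operatorname{GL}_2(\mathbb C)$ be the difference Galois group over $(K,\phi)$ of the equation $\phi^2(y)+a\phi(y)+by=0$. Assume that $G$ is irreducible and that $a\neq 0$. Then $G$ is imprimitive if and only if there exists $u\in\operatorname{M}_{2\Lambda}$ such that $$\left(\phi^{2}(u)+\left(\phi^{2}\left(\frac{b}{a}\right)-\phi(a)+\frac{\phi(b)}{a}\right)\right)u=-\frac{\phi(b)\,b}{a^{2}}.$$
   Context: $\Lambda=\mathbb Z+\mathbb Z\tau\subset\mathbb C$ with $\Im(\tau)>0$; $h\in\mathbb C$ is such that $h\bmod\Lambda$ is not a torsion point of $\mathbb C/\Lambda$. For a lattice $\Lambda'\subset\mathbb C$, $\operatorname{M}_{\Lambda'}$ is the field of $\Lambda'$-periodic meromorphic functions on $\mathbb C$. The base difference field is $(K,\phi)$ with $K=\bigcup_{k\ge1}\operatorname{M}_{k\Lambda}$ and $\phi(f)(z)=f(z+h)$; $K^\phi=\{f\in K:\phi(f)=f\}=\mathbb C$. Difference Galois group: for a system $\phi Y=MY$ with $M\in\operatorname{GL}_n(K)$, a Picard–Vessiot ring is a ring extension $R$ of $K$ with a ring automorphism (still denoted $\phi$) extending $\phi$ such that (1) there is $U\in\operatorname{GL}_n(R)$ with $\phi(U)=MU$; (2) $R$ is generated as a $K$-algebra by the entries of $U$ and $\det(U)^{-1}$; (3) the only ideals of $R$ stable under $\phi$ are $\{0\}$ and $R$. It exists and is unique up to isomorphism.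 The difference Galois group is the group of $K$-linear ring automorphisms of $R$ commuting with $\phi$, identified with an algebraic subgroup of $\operatorname{GL}_n(\mathbb C)$ (up to conjugation) via $\sigma\mapsto C(\sigma)$, where $\sigma(U)=UC(\sigma)$. The group of $\phi^2(y)+a\phi(y)+by=0$ is that of $\phi Y=\begin{pmatrix}0&1\\-b&-a\end{pmatrix}Y$. A subgroup of $\operatorname{GL}_2(\mathbb C)$ is irreducible if it is not conjugate to a subgroup of the group of upper-triangular matrices. It is imprimitive if it is conjugate to a subgroup of $$\left\{\begin{pmatrix}\alpha&0\\0&\beta\end{pmatrix}:\alpha,\beta\in\mathbb C^\times\right\}\cup\left\{\begin{pmatrix}0&\gamma\\\delta&0\end{pmatrix}:\gamma,\delta\in\mathbb C^\times\right\}.$$ *)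

theory Defs
  imports "HOL-Complex_Analysis.Complex_Analysis"
begin

no_notation fps_nth (infixl "$" 75)

section \<open>The field of meromorphic functions on the complex plane\<close>

text \<open>
  A meromorphic function is represented by its normal form: removable singularities are
  filled in and the value at a pole is 0. Two meromorphic functions are thus equal as soon as
  they agree off a discrete set, and the field operations are the pointwise ones followed by
  normalisation.
\<close>

typedef mero = "{f :: complex \<Rightarrow> complex. f nicely_meromorphic_on UNIV}"
  morphisms eval_mero Abs_mero
  by (rule exI[of _ "\<lambda>_. 0"]) auto

definition mero_of :: "(complex \<Rightarrow> complex) \<Rightarrow> mero" where
  "mero_of f = Abs_mero (remove_sings f)"

lemma nicely_eval_mero: "eval_mero f nicely_meromorphic_on UNIV"
  using eval_mero[of f] by simp

lemma meromorphic_eval_mero [meromorphic_intros]: "eval_mero f meromorphic_on A"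
  using nicely_eval_mero[of f] meromorphic_on_subset
  by (auto simp: nicely_meromorphic_on_def)

lemma eval_mero_of:
  assumes "f meromorphic_on UNIV"
  shows "eval_mero (mero_of f) = remove_sings f"
  using remove_sings_nicely_meromorphic[OF assms]
  by (simp add: mero_of_def Abs_mero_inverse)

lemma mero_of_eval [simp]: "mero_of (eval_mero f) = f"
proof -
  have "remove_sings (eval_mero f) z = eval_mero f z" for z
  proof -
    have "is_pole (eval_mero f) z \<and> eval_mero f z = 0 \<or> eval_mero f \<midarrow>z\<rightarrow> eval_mero f z"
      using nicely_eval_mero[of f] by (auto simp: nicely_meromorphic_on_def)
    thus ?thesis by (metis remove_sings_at_pole remove_sings_eqI)
  qed
  hence "remove_sings (eval_mero f) = eval_mero f" by (rule ext)
  thus ?thesis by (simp add: mero_of_def eval_mero_inverse)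
qed

lemma mero_of_cong:
  assumes "\<And>z. eventually (\<lambda>w. f w = g w) (at z)"
  shows "mero_of f = mero_of g"
proof -
  have "remove_sings f z = remove_sings g z" for z
    using assms by (rule remove_sings_cong) simp
  hence "remove_sings f = remove_sings g" by (rule ext)
  thus ?thesis by (simp add: mero_of_def)
qed

lemma eventually_eval_mero_of:
  assumes "f meromorphic_on UNIV"
  shows "eventually (\<lambda>w. eval_mero (mero_of f) w = f w) (at z)"
  unfolding eval_mero_of[OF assms]
  by (intro eventually_remove_sings_eq_at) 
     (use assms in \<open>auto simp: meromorphic_on_altdef\<close>)

instantiation mero :: field
begin

definition zero_mero where "zero_mero = mero_of (\<lambda>_. 0)"
definition one_mero where "one_mero = mero_of (\<lambda>_. 1)"
definition plus_mero where "f + g = mero_of (\<lambda>z. eval_mero f z + eval_mero g z)"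
definition minus_mero where "f - g = mero_of (\<lambda>z. eval_mero f z - eval_mero g z)"
definition uminus_mero where "- f = mero_of (\<lambda>z. - eval_mero f z)"
definition times_mero where "f * g = mero_of (\<lambda>z. eval_mero f z * eval_mero g z)"
definition inverse_mero where "inverse f = mero_of (\<lambda>z. inverse (eval_mero f z))"
definition divide_mero where "f div g = mero_of (\<lambda>z. eval_mero f z / eval_mero g z)"

lemma mero_ops_ev:
  "eventually (\<lambda>w. eval_mero 0 w = 0) (at z)"
  "eventually (\<lambda>w. eval_mero 1 w = 1) (at z)"
  "eventually (\<lambda>w. eval_mero (f + g) w = eval_mero f w + eval_mero g w) (at z)"
  "eventually (\<lambda>w. eval_mero (f - g) w = eval_mero f w - eval_mero g w) (at z)"
  "eventually (\<lambda>w. eval_mero (- f) w = - eval_mero f w) (at z)"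
  "eventually (\<lambda>w. eval_mero (f * g) w = eval_mero f w * eval_mero g w) (at z)"
  "eventually (\<lambda>w. eval_mero (inverse f) w = inverse (eval_mero f w)) (at z)"
  "eventually (\<lambda>w. eval_mero (f div g) w = eval_mero f w / eval_mero g w) (at z)"
  unfolding zero_mero_def one_mero_def plus_mero_def minus_mero_def uminus_mero_def
    times_mero_def inverse_mero_def divide_mero_def
  by (rule eventually_eval_mero_of; intro meromorphic_intros)+

lemma mero_eqI:
  assumes "\<And>z. eventually (\<lambda>w. eval_mero f w = eval_mero g w) (at z)"
  shows "f = g"
  using mero_of_cong[OF assms] by simp

lemma mero_nonzero_ev:
  assumes "f \<noteq> 0"
  shows "eventually (\<lambda>w. eval_mero f w \<noteq> 0) (at z)"
proof -
  have "\<not> (\<forall>w. eval_mero f w = 0)"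
  proof
    assume "\<forall>w. eval_mero f w = 0"
    hence "eval_mero f = (\<lambda>_. 0)" by auto
    hence "mero_of (eval_mero f) = mero_of (\<lambda>_. 0)" by simp
    with assms show False by (simp add: zero_mero_def)
  qed
  hence "eventually (\<lambda>w. eval_mero f w \<noteq> 0) (cosparse UNIV)"
    using nicely_meromorphic_imp_constant_or_avoid[OF nicely_eval_mero[of f], of 0] by auto
  thus ?thesis by (auto simp: eventually_cosparse_open_eq)
qed

instance
proof
  fix f g k :: mero
  show "f + g + k = f + (g + k)"
  proof (rule mero_eqI)
    show "eventually (\<lambda>w. eval_mero (f + g + k) w = eval_mero (f + (g + k)) w) (at z)" for z
      using mero_ops_ev(3)[of "f + g" k z] mero_ops_ev(3)[of f g z] 
        mero_ops_ev(3)[of f "g + k" z] mero_ops_ev(3)[of g k z]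
      by eventually_elim simp
  qed
  show "f + g = g + f" by (simp add: plus_mero_def add.commute)
  show "0 + f = f"
  proof (rule mero_eqI)
    show "eventually (\<lambda>w. eval_mero (0 + f) w = eval_mero f w) (at z)" for z
      using mero_ops_ev(3)[of 0 f z] mero_ops_ev(1)[of z] by eventually_elim simp
  qed
  show "- f + f = 0"
  proof (rule mero_eqI)
    show "eventually (\<lambda>w. eval_mero (- f + f) w = eval_mero 0 w) (at z)" for z
      using mero_ops_ev(3)[of "- f" f z] mero_ops_ev(1)[of z] mero_ops_ev(5)[of f z]
      by eventually_elim simp
  qed
  show "f - g = f + - g"
  proof (rule mero_eqI)
    show "eventually (\<lambda>w. eval_mero (f - g) w = eval_mero (f + - g) w) (at z)" for z
      using mero_ops_ev(3)[of f "- g" z] mero_ops_ev(4)[of f g z] mero_ops_ev(5)[of g z]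
      by eventually_elim simp
  qed
  show "f * g * k = f * (g * k)"
  proof (rule mero_eqI)
    show "eventually (\<lambda>w. eval_mero (f * g * k) w = eval_mero (f * (g * k)) w) (at z)" for z
      using mero_ops_ev(6)[of "f * g" k z] mero_ops_ev(6)[of f g z] 
        mero_ops_ev(6)[of f "g * k" z] mero_ops_ev(6)[of g k z]
      by eventually_elim simp
  qed
  show "f * g = g * f" by (simp add: times_mero_def mult.commute)
  show "1 * f = f"
  proof (rule mero_eqI)
    show "eventually (\<lambda>w. eval_mero (1 * f) w = eval_mero f w) (at z)" for z
      using mero_ops_ev(6)[of 1 f z] mero_ops_ev(2)[of z] by eventually_elim simp
  qed
  show "(f + g) * k = f * k + g * k"
  proof (rule mero_eqI)
    show "eventually (\<lambda>w. eval_mero ((f + g) * k) w = eval_mero (f * k + g * k) w) (at z)" for z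
      using mero_ops_ev(6)[of "f + g" k z] mero_ops_ev(3)[of f g z] 
        mero_ops_ev(3)[of "f * k" "g * k" z] mero_ops_ev(6)[of f k z] mero_ops_ev(6)[of g k z]
      by eventually_elim (simp add: algebra_simps)
  qed
  show "(0 :: mero) \<noteq> 1"
  proof
    assume "(0 :: mero) = 1"
    with mero_ops_ev(2)[of 0] have "eventually (\<lambda>w. eval_mero 0 w = 1) (at 0)" by simp
    with mero_ops_ev(1)[of 0] have "eventually (\<lambda>w :: complex. False) (at 0)"
      by eventually_elim simp
    thus False by simp
  qed
  show "inverse f * f = 1" if "f \<noteq> 0"
  proof (rule mero_eqI)
    show "eventually (\<lambda>w. eval_mero (inverse f * f) w = eval_mero 1 w) (at z)" for z
      using mero_ops_ev(6)[of "inverse f" f z] mero_ops_ev(2)[of z] mero_ops_ev(7)[of f z]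
        mero_nonzero_ev[OF that, of z] by eventually_elim simp
  qed
  show "f div g = f * inverse g"
  proof (rule mero_eqI)
    show "eventually (\<lambda>w. eval_mero (f div g) w = eval_mero (f * inverse g) w) (at z)" for z
      using mero_ops_ev(8)[of f g z] mero_ops_ev(6)[of f "inverse g" z] mero_ops_ev(7)[of g z]
      by eventually_elim (simp add: field_simps)
  qed
  show "inverse (0 :: mero) = 0"
  proof (rule mero_eqI)
    show "eventually (\<lambda>w. eval_mero (inverse 0) w = eval_mero 0 w) (at z)" for z
      using mero_ops_ev(7)[of 0 z] mero_ops_ev(1)[of z] by eventually_elim simp
  qed
qed

end

definition const_mero :: "complex \<Rightarrow> mero" where
  "const_mero c = mero_of (\<lambda>_. c)"

definition shift_mero :: "complex \<Rightarrow> mero \<Rightarrow> mero" where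
  "shift_mero h f = mero_of (\<lambda>z. eval_mero f (z + h))"

lemma eval_const_mero: "eval_mero (const_mero c) = (\<lambda>_. c)"
  by (simp add: const_mero_def eval_mero_of meromorphic_intros fun_eq_iff)

lemma eval_shift_mero: "eval_mero (shift_mero h f) z = eval_mero f (z + h)"
proof -
  have "(\<lambda>z. eval_mero f (z + h)) meromorphic_on UNIV"
    by (rule meromorphic_on_compose[OF meromorphic_eval_mero[of f UNIV]])
       (auto intro!: analytic_intros)
  moreover have "remove_sings (eval_mero f) = eval_mero f"
    by (metis eval_mero_of meromorphic_eval_mero mero_of_eval)
  moreover have "remove_sings (\<lambda>z. eval_mero f (z + h)) z = remove_sings (eval_mero f) (z + h)"
  proof -
    have "filtermap (\<lambda>z. z + h) (at z) = at (z + h)"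
      using filtermap_at_shift[of "- h" z] by simp
    from remove_sings_compose[OF this, of "eval_mero f"] show ?thesis by (simp add: o_def)
  qed
  ultimately show ?thesis by (simp add: shift_mero_def eval_mero_of)
qed


section \<open>Elliptic functions and the base field\<close>

definition period_lattice :: "complex \<Rightarrow> complex set" where
  "period_lattice \<tau> = {of_int m + of_int n * \<tau> | m n. True}"

definition scaled_lattice :: "nat \<Rightarrow> complex \<Rightarrow> complex set" where
  "scaled_lattice k \<tau> = (\<lambda>w. of_nat k * w) ` period_lattice \<tau>"

definition M_periodic :: "complex set \<Rightarrow> mero set" where
  "M_periodic L = {f. \<forall>w\<in>L. \<forall>z. eval_mero f (z + w) = eval_mero f z}"

definition K_elliptic :: "complex \<Rightarrow> mero set" where
  "K_elliptic \<tau> = (\<Union>k\<in>{1..}. M_periodic (scaled_lattice k \<tau>))"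


section \<open>Picard--Vessiot rings and difference Galois groups\<close>

definition ring_hom_on :: "'a::ring_1 set \<Rightarrow> ('a \<Rightarrow> 'b::ring_1) \<Rightarrow> bool" where
  "ring_hom_on S f \<longleftrightarrow> f 1 = 1 \<and>
     (\<forall>x\<in>S. \<forall>y\<in>S. f (x + y) = f x + f y \<and> f (x * y) = f x * f y)"

definition ring_automorphism :: "('r::ring_1 \<Rightarrow> 'r) \<Rightarrow> bool" where
  "ring_automorphism \<sigma> \<longleftrightarrow> bij \<sigma> \<and> ring_hom_on UNIV \<sigma>"

definition ring_ideal :: "'r::comm_ring_1 set \<Rightarrow> bool" where
  "ring_ideal I \<longleftrightarrow> 0 \<in> I \<and> (\<forall>x\<in>I. \<forall>y\<in>I. x + y \<in> I) \<and> (\<forall>r. \<forall>x\<in>I. r * x \<in> I)"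

inductive_set generated_subring :: "'r::ring_1 set \<Rightarrow> 'r set" for S where
  gen: "x \<in> S \<Longrightarrow> x \<in> generated_subring S"
| one: "1 \<in> generated_subring S"
| add: "x \<in> generated_subring S \<Longrightarrow> y \<in> generated_subring S \<Longrightarrow> x + y \<in> generated_subring S"
| neg: "x \<in> generated_subring S \<Longrightarrow> - x \<in> generated_subring S"
| mult: "x \<in> generated_subring S \<Longrightarrow> y \<in> generated_subring S \<Longrightarrow> x * y \<in> generated_subring S"

definition GL_over :: "'k::field set \<Rightarrow> ('k^'n^'n) set" where
  "GL_over K = {A. (\<forall>i j. A $ i $ j \<in> K) \<and> det A \<noteq> 0}"

text \<open>
  The base difference field is a subfield \<open>K\<close> of an ambient field with an automorphism \<open>\<phi>\<close>
  preserving \<open>K\<close>. The Picard--Vessiot ring is the whole type \<open>'r\<close>, with automorphism \<open>\<Phi>\<close>;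
  it extends \<open>K\<close> through the embedding \<open>\<iota>\<close>, whose values outside \<open>K\<close> are irrelevant.
  \<open>U\<close> is the chosen fundamental matrix.
\<close>

definition picard_vessiot ::
  "'k::field set \<Rightarrow> ('k \<Rightarrow> 'k) \<Rightarrow> 'k^'n^'n \<Rightarrow>
   ('k \<Rightarrow> 'r::comm_ring_1) \<Rightarrow> ('r \<Rightarrow> 'r) \<Rightarrow> 'r^'n^'n \<Rightarrow> bool" where
  "picard_vessiot K \<phi> M \<iota> \<Phi> U \<longleftrightarrow>
     M \<in> GL_over K \<and>
     ring_hom_on K \<iota> \<and> inj_on \<iota> K \<and>
     ring_automorphism \<Phi> \<and> (\<forall>f\<in>K. \<Phi> (\<iota> f) = \<iota> (\<phi> f)) \<and>
     invertible U \<and> map_matrix \<Phi> U = map_matrix \<iota> M ** U \<and>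
     generated_subring (\<iota> ` K \<union> {U $ i $ j | i j. True} \<union> {d. d * det U = 1}) = UNIV \<and>
     (\<forall>I. ring_ideal I \<and> \<Phi> ` I \<subseteq> I \<longrightarrow> I = {0} \<or> I = UNIV)"

definition difference_automorphisms ::
  "'k::field set \<Rightarrow> ('k \<Rightarrow> 'r::comm_ring_1) \<Rightarrow> ('r \<Rightarrow> 'r) \<Rightarrow> ('r \<Rightarrow> 'r) set" where
  "difference_automorphisms K \<iota> \<Phi> =
     {\<sigma>. ring_automorphism \<sigma> \<and> (\<forall>f\<in>K. \<sigma> (\<iota> f) = \<iota> f) \<and> \<sigma> \<circ> \<Phi> = \<Phi> \<circ> \<sigma>}"

text \<open>
  The matrix group \<open>{C(\<sigma>)}\<close>, where \<open>\<sigma>(U) = U C(\<sigma>)\<close>; \<open>c\<close> is the embedding of the complex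
  numbers into the base field. Another choice of \<open>U\<close> yields a conjugate group.
\<close>

definition difference_galois_group ::
  "(complex \<Rightarrow> 'k) \<Rightarrow> 'k::field set \<Rightarrow> ('k \<Rightarrow> 'r::comm_ring_1) \<Rightarrow> ('r \<Rightarrow> 'r) \<Rightarrow> 'r^'n^'n \<Rightarrow>
   (complex^'n^'n) set" where
  "difference_galois_group c K \<iota> \<Phi> U =
     {C. \<exists>\<sigma>\<in>difference_automorphisms K \<iota> \<Phi>. map_matrix \<sigma> U = U ** map_matrix (\<iota> \<circ> c) C}"

definition companion2 :: "'k::comm_ring_1 \<Rightarrow> 'k \<Rightarrow> 'k^2^2" where
  "companion2 a b = vector [vector [0, 1], vector [- b, - a]]"


section \<open>Irreducible and imprimitive subgroups of GL(2)\<close>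

definition conjugate_into :: "(complex^'n^'n) set \<Rightarrow> (complex^'n^'n) set \<Rightarrow> bool" where
  "conjugate_into G H \<longleftrightarrow>
     (\<exists>P. invertible P \<and> (\<forall>C\<in>G. P ** C ** matrix_inv P \<in> H))"

definition irreducible_GL2 :: "(complex^2^2) set \<Rightarrow> bool" where
  "irreducible_GL2 G \<longleftrightarrow>
     \<not> conjugate_into G {vector [vector [\<alpha>, \<beta>], vector [0, \<delta>]] | \<alpha> \<beta> \<delta>. \<alpha> \<noteq> 0 \<and> \<delta> \<noteq> 0}"

definition imprimitive_GL2 :: "(complex^2^2) set \<Rightarrow> bool" where
  "imprimitive_GL2 G \<longleftrightarrow>
     conjugate_into G
       ({vector [vector [\<alpha>, 0], vector [0, \<beta>]] | \<alpha> \<beta>. \<alpha> \<noteq> 0 \<and> \<beta> \<noteq> 0} \<union>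
        {vector [vector [0, \<gamma>], vector [\<delta>, 0]] | \<gamma> \<delta>. \<gamma> \<noteq> 0 \<and> \<delta> \<noteq> 0})"

end

theory Submission
  imports Defs "HOL-Library.Poly_Mapping" "HOL-Computational_Algebra.Fundamental_Theorem_Algebra"
begin

text \<open>
  A solution \<open>w \<in> K\<close> of the Riccati equation \<open>\<phi> w = - a - b / w\<close> is a factor \<open>\<phi> - w\<close> of the operator
  and makes \<open>G\<close> reducible. For \<open>u = - w\<^sub>1 - b / a\<close>, the stated equation describes orbits \<open>w\<^sub>1, w\<^sub>2\<close> of length two
  instead: \<open>\<phi> w\<^sub>1 = - a - b / w\<^sub>2\<close> and \<open>\<phi> w\<^sub>2 = - a - b / w\<^sub>1\<close>.

  If \<open>G\<close> is imprimitive, it permutes a basis \<open>y\<^sub>1, y\<^sub>2\<close> of solutions up to constants, and the coefficients of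
  the quadratic polynomial with roots \<open>\<Phi> y\<^sub>i / y\<^sub>i\<close> are invariant. Invariants of \<open>G\<close> lie in \<open>K\<close>: for \<open>x\<close> outside
  \<open>K\<close> the element \<open>1 \<otimes> x - x \<otimes> 1\<close> of the tensor square of the Picard--Vessiot ring is not nilpotent, and a
  difference ideal of the tensor square that is maximal among those avoiding the powers of a suitable
  constant is the graph of an automorphism moving \<open>x\<close>. The discriminant of the quadratic polynomial is a square in
  \<open>K\<close>, because \<open>\<phi>\<close> multiplies it by a square, so that its zeros and poles of odd order form a discrete set
  invariant under a non-discrete group of translations. Hence the roots lie in \<open>K\<close>. The orbit they form is
  the only one of length two: the cross ratio with a second one would be constant and give a fixed point.
  So the periods of \<open>a\<close> and \<open>b\<close> permute \<open>w\<^sub>1\<close> and \<open>w\<^sub>2\<close>, whose periods therefore include \<open>2\<Lambda>\<close>.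

  Conversely, a solution \<open>u\<close> gives an operator \<open>L = \<phi> - w\<close> with \<open>\<Phi>\<^sup>2 L y = g L y\<close> on solutions \<open>y\<close>, and
  \<open>G\<close> preserves the quadratic form \<open>L y \<cdot> \<Phi> (L y)\<close> up to scalars, hence permutes its two zero lines.
\<close>

subsection \<open>Linear algebra over a subfield of a commutative ring\<close>

text \<open>The obstacle is that the Picard--Vessiot ring may have zero divisors and that
  \<open>G\<close> consists of actual automorphisms: invariants are under control only once enough
  automorphisms have been produced. They come from maximal difference ideals, and this requires the
  constants modulo such an ideal to be complex numbers. The reason is one of cardinality: the rings
  have countable dimension over the base field, whereas a constant \<open>y\<close> different from
  all complex \<open>z\<close> would give uncountably many elements \<open>1 / (y - z)\<close>,
  hence a linear relation among them and an algebraic equation for \<open>y\<close>.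

  The equation for \<open>u\<close> has its shape from the second iterate of the Riccati map. That
  iterate is fractional linear in \<open>w\<close> with its pole at \<open>- b / a\<close>, and
  \<open>u = - w - b / a\<close> moves the pole to 0. The assumption \<open>a \<noteq> 0\<close>
  enters twice: in this pole, and in the proof that the product of the two permuted solutions is not
  zero. Irreducibility rules out fixed points of the Riccati map, so that the two roots obtained
  from the invariants must be exchanged.\<close>

locale ring_subfield =
  fixes \<kappa> :: "'q::comm_ring_1 set"
  assumes zero_mem [simp]: "0 \<in> \<kappa>" and one_mem [simp]: "1 \<in> \<kappa>"
    and add_mem: "x \<in> \<kappa> \<Longrightarrow> y \<in> \<kappa> \<Longrightarrow> x + y \<in> \<kappa>"
    and mult_mem: "x \<in> \<kappa> \<Longrightarrow> y \<in> \<kappa> \<Longrightarrow> x * y \<in> \<kappa>"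
    and uminus_mem: "x \<in> \<kappa> \<Longrightarrow> - x \<in> \<kappa>"
    and unit_mem: "x \<in> \<kappa> \<Longrightarrow> x \<noteq> 0 \<Longrightarrow> \<exists>y\<in>\<kappa>. x * y = 1"
begin

lemma diff_mem: "x \<in> \<kappa> \<Longrightarrow> y \<in> \<kappa> \<Longrightarrow> x - y \<in> \<kappa>"
  using add_mem[of x "- y"] uminus_mem[of y] by simp

lemma sum_mem: "(\<And>i. i \<in> A \<Longrightarrow> f i \<in> \<kappa>) \<Longrightarrow> sum f A \<in> \<kappa>"
  by (induction A rule: infinite_finite_induct) (auto intro: add_mem)

lemma prod_mem: "(\<And>i. i \<in> A \<Longrightarrow> f i \<in> \<kappa>) \<Longrightarrow> prod f A \<in> \<kappa>"
  by (induction A rule: infinite_finite_induct) (auto intro: mult_mem)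

lemma of_nat_mem: "of_nat n \<in> \<kappa>"
  by (induction n) (auto intro: add_mem)

lemma of_int_mem: "of_int n \<in> \<kappa>"
  by (cases n rule: int_cases2) (auto intro: of_nat_mem uminus_mem)

text \<open>Scalars and vectors share one type: the subfield acts by multiplication on the ambient
  ring, which may have zero divisors.\<close>

definition subspace :: "'q set \<Rightarrow> bool" where
  "subspace W \<longleftrightarrow> 0 \<in> W \<and> (\<forall>x\<in>W. \<forall>y\<in>W. x + y \<in> W) \<and> (\<forall>k\<in>\<kappa>. \<forall>x\<in>W. k * x \<in> W)"

lemma subspaceD:
  assumes "subspace W"
  shows "0 \<in> W" "x \<in> W \<Longrightarrow> y \<in> W \<Longrightarrow> x + y \<in> W" "k \<in> \<kappa> \<Longrightarrow> x \<in> W \<Longrightarrow> k * x \<in> W"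
  using assms by (auto simp: subspace_def)

lemma subspace_diff: "subspace W \<Longrightarrow> x \<in> W \<Longrightarrow> y \<in> W \<Longrightarrow> x - y \<in> W"
  using subspaceD(2)[of W x "- y"] subspaceD(3)[of W "- 1" y] uminus_mem[of 1] by simp

definition functional :: "('q \<Rightarrow> 'q) \<Rightarrow> bool" where
  "functional \<eta> \<longleftrightarrow> (\<forall>x y. \<eta> (x + y) = \<eta> x + \<eta> y) \<and> (\<forall>k\<in>\<kappa>. \<forall>x. \<eta> (k * x) = k * \<eta> x) \<and> range \<eta> \<subseteq> \<kappa>"

lemma functionalD:
  assumes "functional \<eta>"
  shows "\<eta> (x + y) = \<eta> x + \<eta> y" "k \<in> \<kappa> \<Longrightarrow> \<eta> (k * x) = k * \<eta> x" "\<eta> x \<in> \<kappa>"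
    "\<eta> 0 = 0" "\<eta> (- x) = - \<eta> x" "\<eta> (x - y) = \<eta> x - \<eta> y"
proof -
  show *: "\<eta> (x + y) = \<eta> x + \<eta> y" and **: "k \<in> \<kappa> \<Longrightarrow> \<eta> (k * x) = k * \<eta> x" for x y k
    using assms by (auto simp: functional_def)
  show "\<eta> x \<in> \<kappa>" using assms by (auto simp: functional_def)
  show "\<eta> 0 = 0" using *[of 0 0] by simp
  show m: "\<eta> (- x) = - \<eta> x" for x using **[of "- 1" x] uminus_mem[of 1] by simp
  show "\<eta> (x - y) = \<eta> x - \<eta> y" using *[of x "- y"] m[of y] by simp
qed

lemma functional_sum: "functional \<eta> \<Longrightarrow> \<eta> (sum f A) = (\<Sum>i\<in>A. \<eta> (f i))"
  by (induction A rule: infinite_finite_induct) (auto simp: functionalD)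

text \<open>A subspace that is maximal among those containing \<open>W\<close> and missing
  \<open>x\<close> has codimension one; the functional is the coefficient of \<open>x\<close> modulo
  that subspace.\<close>

lemma functional_exists:
  assumes W: "subspace W" and x: "x \<notin> W"
  obtains \<eta> where "functional \<eta>" "\<And>w. w \<in> W \<Longrightarrow> \<eta> w = 0" "\<eta> x = 1"
proof -
  define \<A> where "\<A> = {V. subspace V \<and> W \<subseteq> V \<and> x \<notin> V}"
  have "\<exists>M\<in>\<A>. \<forall>X\<in>\<A>. M \<subseteq> X \<longrightarrow> X = M"
  proof (rule subset_Zorn_nonempty)
    show "\<A> \<noteq> {}" using W x by (auto simp: \<A>_def)
  next
    fix \<C> assume ne: "\<C> \<noteq> {}" and ch: "subset.chain \<A> \<C>"
    have sub: "\<C> \<subseteq> \<A>" and tot: "\<And>X Y. X \<in> \<C> \<Longrightarrow> Y \<in> \<C> \<Longrightarrow> X \<subseteq> Y \<or> Y \<subseteq> X"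
      using ch by (auto simp: subset_chain_def)
    have sp: "subspace Z" if "Z \<in> \<C>" for Z using that sub by (auto simp: \<A>_def)
    have "subspace (\<Union>\<C>)"
      unfolding subspace_def
    proof (intro conjI ballI)
      show "0 \<in> \<Union>\<C>" using ne subspaceD(1)[OF sp] by blast
    next
      fix u v assume "u \<in> \<Union>\<C>" "v \<in> \<Union>\<C>"
      then obtain X Y where XY: "X \<in> \<C>" "Y \<in> \<C>" "u \<in> X" "v \<in> Y" by blast
      hence "\<exists>Z\<in>\<C>. u \<in> Z \<and> v \<in> Z" using tot[of X Y] by blast
      thus "u + v \<in> \<Union>\<C>" using subspaceD(2)[OF sp] by blast
    next
      fix k u assume "k \<in> \<kappa>" "u \<in> \<Union>\<C>"
      thus "k * u \<in> \<Union>\<C>" using subspaceD(3)[OF sp] by blast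
    qed
    thus "\<Union>\<C> \<in> \<A>" using ne sub by (auto simp: \<A>_def)
  qed
  then obtain M where M': "M \<in> \<A>" "\<forall>X\<in>\<A>. M \<subseteq> X \<longrightarrow> X = M" by (elim bexE)
  hence M: "subspace M" "W \<subseteq> M" "x \<notin> M" by (simp_all add: \<A>_def)
  have max: "X = M" if "subspace X" "W \<subseteq> X" "x \<notin> X" "M \<subseteq> X" for X
    using M'(2) that by (simp add: \<A>_def)
  \<comment> \<open>For \<open>y\<close> outside \<open>M\<close>, maximality puts \<open>x\<close>
    into \<open>M + \<kappa> y\<close>; the coefficient of \<open>y\<close> is then nonzero, and
    dividing by it solves for \<open>y\<close>.\<close>
  have ex: "\<exists>k\<in>\<kappa>. y - k * x \<in> M" for y
  proof (cases "y \<in> M")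
    case True thus ?thesis by (intro bexI[of _ 0]) auto
  next
    case False
    define X where "X = {m + k * y | m k. m \<in> M \<and> k \<in> \<kappa>}"
    have sX: "subspace X"
      unfolding subspace_def
    proof (intro conjI ballI)
      have "0 = 0 + 0 * y" by simp
      thus "0 \<in> X" unfolding X_def using subspaceD(1)[OF M(1)] zero_mem by blast
    next
      fix u v assume "u \<in> X" "v \<in> X"
      then obtain m k m' k' where "u = m + k * y" "v = m' + k' * y" "m \<in> M" "k \<in> \<kappa>" "m' \<in> M" "k' \<in> \<kappa>"
        by (auto simp: X_def)
      hence "u + v = (m + m') + (k + k') * y" "m + m' \<in> M" "k + k' \<in> \<kappa>"
        using subspaceD(2)[OF M(1)] add_mem by (auto simp: algebra_simps)
      thus "u + v \<in> X" unfolding X_def by blast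
    next
      fix l u assume l: "l \<in> \<kappa>" "u \<in> X"
      then obtain m k where "u = m + k * y" "m \<in> M" "k \<in> \<kappa>" by (auto simp: X_def)
      hence "l * u = l * m + (l * k) * y" "l * m \<in> M" "l * k \<in> \<kappa>"
        using subspaceD(3)[OF M(1)] l mult_mem by (auto simp: algebra_simps)
      thus "l * u \<in> X" unfolding X_def by blast
    qed
    have MX: "M \<subseteq> X"
    proof
      fix m assume "m \<in> M"
      moreover have "m = m + 0 * y" by simp
      ultimately show "m \<in> X" unfolding X_def using zero_mem by blast
    qed
    have "y = 0 + 1 * y" by simp
    hence "y \<in> X" unfolding X_def using subspaceD(1)[OF M(1)] one_mem by blast
    hence "x \<in> X" using max[OF sX _ _ MX] M(2) MX False by blast
    then obtain m k where mk: "x = m + k * y" "m \<in> M" "k \<in> \<kappa>" by (auto simp: X_def)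
    have "k \<noteq> 0" using mk M(3) by auto
    then obtain l where l: "l \<in> \<kappa>" "k * l = 1" using unit_mem mk(3) by blast
    have "l * x = l * m + (k * l) * y" by (simp add: mk(1) algebra_simps)
    hence "y - l * x = (- l) * m" by (simp add: l(2))
    thus ?thesis using subspaceD(3)[OF M(1) uminus_mem[OF l(1)] mk(2)] l(1) by metis
  qed
  have uniq: "k = l" if kl: "k \<in> \<kappa>" "l \<in> \<kappa>" "y - k * x \<in> M" "y - l * x \<in> M" for y k l
  proof (rule ccontr)
    assume "k \<noteq> l"
    hence "k - l \<noteq> 0" by simp
    then obtain i where i: "i \<in> \<kappa>" "(k - l) * i = 1" using unit_mem[OF diff_mem[OF kl(1,2)]] by blast
    have "(k - l) * x \<in> M"
      using subspace_diff[OF M(1) kl(4,3)] by (simp add: algebra_simps)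
    hence "i * ((k - l) * x) \<in> M" using subspaceD(3)[OF M(1)] i by blast
    moreover have "i * ((k - l) * x) = ((k - l) * i) * x" by (simp only: mult_ac)
    ultimately show False using M(3) i(2) by simp
  qed
  define \<eta> where "\<eta> y = (SOME k. k \<in> \<kappa> \<and> y - k * x \<in> M)" for y
  have \<eta>: "\<eta> y \<in> \<kappa>" "y - \<eta> y * x \<in> M" for y
    using ex[of y] someI_ex[of "\<lambda>k. k \<in> \<kappa> \<and> y - k * x \<in> M"] by (auto simp: \<eta>_def)
  have eq: "\<eta> y = k" if "k \<in> \<kappa>" "y - k * x \<in> M" for y k
    using uniq[OF \<eta>(1) that(1) \<eta>(2) that(2)] .
  have "functional \<eta>"
    unfolding functional_def
  proof (intro conjI allI ballI)
    fix u v
    have "u + v - (\<eta> u + \<eta> v) * x = (u - \<eta> u * x) + (v - \<eta> v * x)" by (simp add: algebra_simps)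
    also have "\<dots> \<in> M" by (intro subspaceD(2)[OF M(1)] \<eta>)
    finally show "\<eta> (u + v) = \<eta> u + \<eta> v" by (rule eq[OF add_mem[OF \<eta>(1) \<eta>(1)]])
  next
    fix k u assume k: "k \<in> \<kappa>"
    have "k * u - (k * \<eta> u) * x = k * (u - \<eta> u * x)" by (simp add: algebra_simps)
    also have "\<dots> \<in> M" by (intro subspaceD(3)[OF M(1)] \<eta> k)
    finally show "\<eta> (k * u) = k * \<eta> u" by (rule eq[OF mult_mem[OF k \<eta>(1)]])
  qed (use \<eta> in auto)
  moreover have "\<eta> w = 0" if "w \<in> W" for w using that M(2) by (intro eq) auto
  moreover have "\<eta> x = 1" by (intro eq) (use subspaceD(1)[OF M(1)] in auto)
  ultimately show ?thesis using that by blast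
qed

section \<open>Spans and linear dependence modulo a subspace\<close>

inductive_set kspan :: "'q set \<Rightarrow> 'q set" for E where
  zero: "0 \<in> kspan E"
| step: "k \<in> \<kappa> \<Longrightarrow> e \<in> E \<Longrightarrow> x \<in> kspan E \<Longrightarrow> k * e + x \<in> kspan E"

lemma subspace_kspan: "subspace (kspan E)"
  unfolding subspace_def
proof (intro conjI ballI kspan.zero)
  fix x y assume "x \<in> kspan E" and y: "y \<in> kspan E"
  thus "x + y \<in> kspan E"
    by (induction) (auto simp: add.assoc intro: kspan.intros)
next
  fix k x assume k: "k \<in> \<kappa>" and "x \<in> kspan E"
  from this(2) show "k * x \<in> kspan E"
    by induction (auto simp: distrib_left mult.assoc[symmetric] intro!: kspan.intros mult_mem k)
qed

lemma kspan_base: "e \<in> E \<Longrightarrow> e \<in> kspan E"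
  using kspan.step[of 1 e E 0] kspan.zero by simp

lemma kspan_least: "subspace W \<Longrightarrow> E \<subseteq> W \<Longrightarrow> kspan E \<subseteq> W"
proof
  fix x assume W: "subspace W" "E \<subseteq> W" and "x \<in> kspan E"
  from this(3) show "x \<in> W"
    by induction (use W in \<open>auto intro: subspaceD\<close>)
qed

lemma kspan_mono: "E \<subseteq> F \<Longrightarrow> kspan E \<subseteq> kspan F"
  by (intro kspan_least subspace_kspan) (use kspan_base in blast)

lemma kspan_insert:
  assumes "x \<in> kspan (insert e E)"
  obtains k u where "k \<in> \<kappa>" "u \<in> kspan E" "x = k * e + u"
proof -
  from assms have "\<exists>k\<in>\<kappa>. \<exists>u\<in>kspan E. x = k * e + u"
  proof induction
    case zero
    show ?case by (rule bexI[of _ 0], rule bexI[of _ 0]) (auto intro: kspan.zero)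
  next
    case (step k e' x)
    then obtain l u where l: "l \<in> \<kappa>" "u \<in> kspan E" "x = l * e + u" by blast
    show ?case
    proof (cases "e' = e")
      case True
      hence "k * e' + x = (k + l) * e + u" using l by (simp add: algebra_simps)
      thus ?thesis using l add_mem[OF step(1) l(1)] by blast
    next
      case False
      hence "e' \<in> E" using step by auto
      hence "k * e' + x = l * e + (k * e' + u)" "k * e' + u \<in> kspan E"
        using l step(1) by (auto intro: kspan.intros)
      thus ?thesis using l by blast
    qed
  qed
  thus ?thesis using that by blast
qed

text \<open>Only the generators from \<open>E\<close> are cut down to finitely many;
  \<open>J\<close>, later an ideal, is kept whole.\<close>

lemma kspan_finite_subset:
  assumes "x \<in> kspan (E \<union> J)"
  shows "\<exists>F. finite F \<and> F \<subseteq> E \<and> x \<in> kspan (F \<union> J)"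
  using assms
proof induction
  case zero
  show ?case by (intro exI[of _ "{}"]) (auto intro: kspan.zero)
next
  case (step k e x)
  then obtain F where F: "finite F" "F \<subseteq> E" "x \<in> kspan (F \<union> J)" by blast
  have "x \<in> kspan (F \<union> ({e} \<inter> E) \<union> J)"
    using F(3) kspan_mono[of "F \<union> J" "F \<union> ({e} \<inter> E) \<union> J"] by auto
  hence "k * e + x \<in> kspan (F \<union> ({e} \<inter> E) \<union> J)"
    using step(1,2) by (intro kspan.step) auto
  thus ?case using F by (intro exI[of _ "F \<union> ({e} \<inter> E)"]) auto
qed

text \<open>Gaussian elimination modulo \<open>J\<close>: each induction step removes one generator
  at the price of one pivot vector, and there are more vectors than generators.\<close>

lemma finite_dependence:
  assumes "finite E" "subspace J" "finite T" "card E < card T" "\<And>t. t \<in> T \<Longrightarrow> v t \<in> kspan (E \<union> J)"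
  shows "\<exists>d. (\<forall>t\<in>T. d t \<in> \<kappa>) \<and> (\<exists>t\<in>T. d t \<noteq> 0) \<and> (\<Sum>t\<in>T. d t * v t) \<in> J"
  using assms
proof (induction E arbitrary: T v rule: finite_induct)
  case empty
  from empty have "T \<noteq> {}" by auto
  then obtain t where t: "t \<in> T" by blast
  have "kspan J \<subseteq> J" using kspan_least[OF empty.prems(1)] by simp
  hence "v t \<in> J" using empty.prems(4)[OF t] by auto
  moreover have "(\<Sum>s\<in>T. (if s = t then 1 else 0) * v s) = v t"
    using t empty.prems(2) by (simp add: if_distrib[of "\<lambda>x. x * _"] cong: if_cong)
  ultimately show ?case using t by (intro exI[of _ "\<lambda>s. if s = t then 1 else 0"]) auto
next
  case (insert e E)
  have "\<exists>k u. k \<in> \<kappa> \<and> u \<in> kspan (E \<union> J) \<and> v t = k * e + u" if "t \<in> T" for t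
    using insert.prems(4)[OF that] kspan_insert[of "v t" e "E \<union> J"] by (metis Un_insert_left)
  then obtain k u where ku: "\<And>t. t \<in> T \<Longrightarrow> k t \<in> \<kappa> \<and> u t \<in> kspan (E \<union> J) \<and> v t = k t * e + u t"
    by metis
  show ?case
  proof (cases "\<forall>t\<in>T. k t = 0")
    case True
    have "card E < card T" using insert by auto
    moreover have "v t \<in> kspan (E \<union> J)" if "t \<in> T" for t using ku[OF that] True that by simp
    ultimately show ?thesis using insert.IH[of T v] insert.prems by blast
  next
    case False
    then obtain s where s: "s \<in> T" "k s \<noteq> 0" by blast
    then obtain l where l: "l \<in> \<kappa>" "k s * l = 1" using unit_mem ku by blast
    define v' where "v' t = v t - (k t * l) * v s" for t
    have v': "v' t \<in> kspan (E \<union> J)" if "t \<in> T - {s}" for t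
    proof -
      have "k t * l * (k s * e) = k t * (k s * l) * e" by (simp only: mult_ac)
      hence "v' t = u t - (k t * l) * u s"
        using ku[of t] ku[of s] that s l(2) by (simp add: v'_def distrib_left)
      thus ?thesis
        using ku[of t] ku[of s] that s l mult_mem
        by (auto intro!: subspace_diff[OF subspace_kspan] subspaceD(3)[OF subspace_kspan])
    qed
    have "card E < card (T - {s})" using insert s by auto
    then obtain d where d: "\<forall>t\<in>T - {s}. d t \<in> \<kappa>" "\<exists>t\<in>T - {s}. d t \<noteq> 0"
      "(\<Sum>t\<in>T - {s}. d t * v' t) \<in> J"
      using insert.IH[of "T - {s}" v'] insert.prems v' by auto
    \<comment> \<open>The coefficient of the pivot \<open>v s\<close> collects what was subtracted
      in the \<open>v' t\<close>.\<close>
    define d' where "d' t = (if t = s then - (\<Sum>t\<in>T - {s}. d t * (k t * l)) else d t)" for t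
    have "(\<Sum>t\<in>T. d' t * v t) = d' s * v s + (\<Sum>t\<in>T - {s}. d' t * v t)"
      using s insert.prems by (simp add: sum.remove)
    also have "\<dots> = (\<Sum>t\<in>T - {s}. d t * v' t)"
      by (simp add: d'_def v'_def algebra_simps sum_subtractf sum_distrib_right sum_distrib_left)
    finally have "(\<Sum>t\<in>T. d' t * v t) \<in> J" using d by simp
    moreover have "\<forall>t\<in>T. d' t \<in> \<kappa>"
      using d(1) ku l by (auto simp: d'_def intro!: uminus_mem sum_mem mult_mem)
    moreover have "\<exists>t\<in>T. d' t \<noteq> 0" using d(2) by (auto simp: d'_def)
    ultimately show ?thesis by blast
  qed
qed

text \<open>There are only countably many pairs of a finite subset \<open>F\<close> of
  \<open>E\<close> and a value of \<open>g\<close>, so one pair serves infinitely many indices, and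
  \<open>Suc (card F)\<close> of them are dependent. The label \<open>g\<close> will be an exponent,
  which is thereby the same in the whole relation.\<close>

lemma countable_dependence:
  fixes v :: "'i \<Rightarrow> 'q" and g :: "'i \<Rightarrow> nat"
  assumes "countable E" "subspace J" "uncountable \<Lambda>" "\<And>t. t \<in> \<Lambda> \<Longrightarrow> v t \<in> kspan (E \<union> J)"
  obtains T d n where "finite T" "T \<subseteq> \<Lambda>" "\<And>t. t \<in> T \<Longrightarrow> g t = n" "\<And>t. t \<in> T \<Longrightarrow> d t \<in> \<kappa>"
    "\<exists>t\<in>T. d t \<noteq> 0" "(\<Sum>t\<in>T. d t * v t) \<in> J"
proof -
  define \<F> where "\<F> = {F. finite F \<and> F \<subseteq> E}"
  have cF: "countable \<F>" unfolding \<F>_def using assms(1) by (rule countable_Collect_finite_subset)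
  define L where "L F n = {t\<in>\<Lambda>. g t = n \<and> v t \<in> kspan (F \<union> J)}" for F n
  have "\<Lambda> \<subseteq> (\<Union>(F, n)\<in>\<F> \<times> UNIV. L F n)"
    using kspan_finite_subset[OF assms(4)] by (force simp: L_def \<F>_def)
  moreover have "countable (\<F> \<times> (UNIV :: nat set))" using cF by auto
  ultimately have "\<exists>F n. F \<in> \<F> \<and> infinite (L F n)"
  proof (rule_tac ccontr)
    assume "\<Lambda> \<subseteq> (\<Union>(F, n)\<in>\<F> \<times> UNIV. L F n)" "countable (\<F> \<times> (UNIV :: nat set))"
      "\<nexists>F n. F \<in> \<F> \<and> infinite (L F n)"
    moreover from this have "countable (\<Union>(F, n)\<in>\<F> \<times> UNIV. L F n)"
      by (intro countable_UN) (auto intro!: countable_finite)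
    ultimately show False using assms(3) countable_subset by blast
  qed
  then obtain F n where F: "finite F" "F \<subseteq> E" "infinite (L F n)" by (auto simp: \<F>_def)
  obtain T where T: "T \<subseteq> L F n" "finite T" "card T = Suc (card F)"
    using infinite_arbitrarily_large[OF F(3)] by blast
  have "v t \<in> kspan (F \<union> J)" if "t \<in> T" for t using T(1) that by (auto simp: L_def)
  then obtain d where "\<forall>t\<in>T. d t \<in> \<kappa>" "\<exists>t\<in>T. d t \<noteq> 0" "(\<Sum>t\<in>T. d t * v t) \<in> J"
    using finite_dependence[OF F(1) assms(2) T(2), of v] T(3) by auto
  thus ?thesis using T by (intro that[of T n d]) (auto simp: L_def)
qed

end

subsection \<open>Ring homomorphisms, ideals and polynomials\<close>

lemma ring_hom_onD:
  assumes "ring_hom_on UNIV f"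
  shows "f 1 = 1" "f (x + y) = f x + f y" "f (x * y) = f x * f y" "f 0 = 0" "f (- x) = - f x"
    "f (x - y) = f x - f y"
proof -
  show "f 1 = 1" and *: "f (x + y) = f x + f y" and "f (x * y) = f x * f y" for x y
    using assms by (auto simp: ring_hom_on_def)
  show z: "f 0 = 0" using *[of 0 0] by simp
  show **: "f (- x) = - f x" for x using *[of x "- x"] z by (simp add: eq_neg_iff_add_eq_0 add.commute)
  show "f (x - y) = f x - f y" using *[of x "- y"] by (simp add: **)
qed

lemma ring_hom_on_sum: "ring_hom_on UNIV f \<Longrightarrow> f (sum g A) = (\<Sum>i\<in>A. f (g i))"
  by (induction A rule: infinite_finite_induct) (auto simp: ring_hom_onD)

lemma ring_hom_on_prod:
  fixes f :: "'a::comm_ring_1 \<Rightarrow> 'b::comm_ring_1"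
  shows "ring_hom_on UNIV f \<Longrightarrow> f (prod g A) = (\<Prod>i\<in>A. f (g i))"
  by (induction A rule: infinite_finite_induct) (auto simp: ring_hom_onD)

lemma ring_hom_on_power: "ring_hom_on UNIV f \<Longrightarrow> f (x ^ n) = f x ^ n"
  by (induction n) (auto simp: ring_hom_onD)

lemma ring_hom_on_inj:
  fixes f :: "'a::field \<Rightarrow> 'b::comm_ring_1"
  assumes "ring_hom_on UNIV f"
  shows "f x = f y \<longleftrightarrow> x = y"
proof
  assume eq: "f x = f y"
  show "x = y"
  proof (rule ccontr)
    assume "x \<noteq> y"
    hence "f (x - y) * f (inverse (x - y)) = 1"
      using ring_hom_onD(1,3)[OF assms] by (metis right_inverse right_minus_eq)
    thus False using eq by (simp add: ring_hom_onD(6)[OF assms])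
  qed
qed auto

lemma ring_hom_on_poly:
  fixes f :: "'a::comm_ring_1 \<Rightarrow> 'b::comm_ring_1"
  assumes "ring_hom_on UNIV f"
  shows "poly (map_poly f p) (f x) = f (poly p x)"
proof (induction p)
  case (pCons a p)
  thus ?case by (cases "p = 0"; cases "a = 0") (auto simp: map_poly_pCons ring_hom_onD[OF assms])
qed (simp add: ring_hom_onD(4)[OF assms])

lemma poly_diff_dvd: "(x - y) dvd (poly p x - poly p (y::'a::comm_ring_1))"
proof (induction p)
  case (pCons a p)
  have "poly (pCons a p) x - poly (pCons a p) y = (x - y) * poly p y + x * (poly p x - poly p y)"
    by (simp add: algebra_simps)
  thus ?case using pCons by (simp add: dvd_add)
qed simp

lemma ring_idealD:
  assumes "ring_ideal I"
  shows "0 \<in> I" "x \<in> I \<Longrightarrow> y \<in> I \<Longrightarrow> x + y \<in> I" "x \<in> I \<Longrightarrow> r * x \<in> I" "x \<in> I \<Longrightarrow> x * r \<in> I"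
    "x \<in> I \<Longrightarrow> - x \<in> I" "x \<in> I \<Longrightarrow> y \<in> I \<Longrightarrow> x - y \<in> I"
proof -
  show "0 \<in> I" and *: "x \<in> I \<Longrightarrow> y \<in> I \<Longrightarrow> x + y \<in> I" and **: "x \<in> I \<Longrightarrow> r * x \<in> I" for x y r
    using assms by (auto simp: ring_ideal_def)
  show "x \<in> I \<Longrightarrow> x * r \<in> I" using **[of x r] by (simp add: mult.commute)
  show m: "x \<in> I \<Longrightarrow> - x \<in> I" for x using **[of x "- 1"] by simp
  show "x \<in> I \<Longrightarrow> y \<in> I \<Longrightarrow> x - y \<in> I" using *[of x "- y"] m by simp
qed

lemma ring_ideal_sum: "ring_ideal I \<Longrightarrow> (\<And>i. i \<in> A \<Longrightarrow> f i \<in> I) \<Longrightarrow> sum f A \<in> I"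
  by (induction A rule: infinite_finite_induct) (auto intro: ring_idealD)

lemma ring_ideal_dvd: "ring_ideal I \<Longrightarrow> x \<in> I \<Longrightarrow> x dvd y \<Longrightarrow> y \<in> I"
  by (auto elim!: dvdE intro: ring_idealD)

lemma ring_ideal_cong_trans:
  assumes "ring_ideal I" "x - y \<in> I" "y - z \<in> I" shows "x - z \<in> I"
  using ring_idealD(2)[OF assms] by simp

lemma ring_ideal_add_multiples:
  assumes "ring_ideal I"
  shows "ring_ideal {i + y * q | i q. i \<in> I}"
  unfolding ring_ideal_def
proof (intro conjI ballI allI)
  have "0 = 0 + y * 0" by simp
  thus "0 \<in> {i + y * q | i q. i \<in> I}" using ring_idealD(1)[OF assms] by blast
next
  fix u v assume "u \<in> {i + y * q | i q. i \<in> I}" "v \<in> {i + y * q | i q. i \<in> I}"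
  then obtain i q i' q' where "u = i + y * q" "v = i' + y * q'" "i \<in> I" "i' \<in> I" by blast
  hence "u + v = (i + i') + y * (q + q')" "i + i' \<in> I"
    using ring_idealD(2)[OF assms] by (auto simp: algebra_simps)
  thus "u + v \<in> {i + y * q | i q. i \<in> I}" by blast
next
  fix r u assume "u \<in> {i + y * q | i q. i \<in> I}"
  then obtain i q where "u = i + y * q" "i \<in> I" by blast
  hence "r * u = r * i + y * (r * q)" "r * i \<in> I"
    using ring_idealD(3)[OF assms] by (auto simp: algebra_simps)
  thus "r * u \<in> {i + y * q | i q. i \<in> I}" by blast
qed

subsection \<open>Constants modulo a maximal difference ideal\<close>

text \<open>\<open>M\<close> plays the role of a maximal difference ideal of the localisation at the
  constant \<open>f\<close>, with \<open>f\<close> never inverted. With \<open>M = {0}\<close> and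
  \<open>f = 1\<close> it describes the Picard--Vessiot ring itself; the other use is the tensor
  square.\<close>

locale maximal_difference_ideal = ring_subfield \<kappa> for \<kappa> :: "'q::comm_ring_1 set" +
  fixes \<Psi> :: "'q \<Rightarrow> 'q" and c :: "complex \<Rightarrow> 'q" and E M :: "'q set" and f :: 'q
  assumes hom\<Psi>: "ring_hom_on UNIV \<Psi>" and homc: "ring_hom_on UNIV c"
    and c_mem: "c z \<in> \<kappa>" and \<Psi>_mem: "k \<in> \<kappa> \<Longrightarrow> \<Psi> k \<in> \<kappa>"
    and c_fixed: "\<Psi> (c z) = c z" and fixed: "k \<in> \<kappa> \<Longrightarrow> \<Psi> k = k \<Longrightarrow> k \<in> range c"
    and countable_E: "countable E" and span: "kspan (E \<union> M) = UNIV"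
    and idealM: "ring_ideal M" and stableM: "x \<in> M \<Longrightarrow> \<Psi> x \<in> M"
    and f_const: "\<Psi> f - f \<in> M" and f_power: "f ^ n \<notin> M"
    and maximal: "ring_ideal I \<Longrightarrow> \<Psi> ` I \<subseteq> I \<Longrightarrow> M \<subseteq> I \<Longrightarrow> I \<noteq> M \<Longrightarrow> \<exists>n. f ^ n \<in> I"
begin

lemma const_mult:
  assumes "\<Psi> x - x \<in> M" "\<Psi> y - y \<in> M" shows "\<Psi> (x * y) - x * y \<in> M"
proof -
  have "\<Psi> (x * y) - x * y = \<Psi> x * (\<Psi> y - y) + y * (\<Psi> x - x)"
    by (simp add: ring_hom_onD[OF hom\<Psi>] algebra_simps)
  thus ?thesis using ring_idealD[OF idealM] assms by simp
qed

lemma const_power: "\<Psi> x - x \<in> M \<Longrightarrow> \<Psi> (x ^ n) - x ^ n \<in> M"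
  by (induction n) (auto simp: ring_hom_onD[OF hom\<Psi>] ring_idealD[OF idealM] intro: const_mult[simplified ring_hom_onD[OF hom\<Psi>]])

text \<open>Stability of the quotient \<open>(M : x)\<close> is where \<open>x\<close> has to be a
  constant: \<open>x * \<Psi> y\<close> differs from \<open>\<Psi> (x * y)\<close> by a multiple of
  \<open>\<Psi> x - x\<close>.\<close>

lemma quotient_ideal:
  assumes x: "\<Psi> x - x \<in> M"
  defines "I \<equiv> {y. x * y \<in> M}"
  shows "ring_ideal I" "\<Psi> ` I \<subseteq> I" "M \<subseteq> I"
proof -
  show "ring_ideal I"
    unfolding ring_ideal_def I_def using ring_idealD[OF idealM]
    by (auto simp: distrib_left mult.left_commute)
  show "M \<subseteq> I" unfolding I_def using ring_idealD[OF idealM] by auto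
  show "\<Psi> ` I \<subseteq> I"
  proof
    fix z assume "z \<in> \<Psi> ` I"
    then obtain y where y: "z = \<Psi> y" "x * y \<in> M" by (auto simp: I_def)
    have "x * z = \<Psi> (x * y) - (\<Psi> x - x) * \<Psi> y"
      by (simp add: y ring_hom_onD[OF hom\<Psi>] algebra_simps)
    thus "z \<in> I" unfolding I_def using ring_idealD[OF idealM] stableM[OF y(2)] x by auto
  qed
qed

text \<open>If \<open>(M : f ^ n)\<close> were larger than \<open>M\<close>, it would contain a
  power of \<open>f\<close> by maximality, and then \<open>M\<close> would too.\<close>

lemma cancel_f:
  assumes "f ^ n * y \<in> M" shows "y \<in> M"
proof (rule ccontr)
  assume "y \<notin> M"
  with assms have "{y. f ^ n * y \<in> M} \<noteq> M" by blast
  then obtain m where "f ^ m \<in> {y. f ^ n * y \<in> M}"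
    using maximal quotient_ideal[OF const_power[OF f_const]] by metis
  hence "f ^ (n + m) \<in> M" by (simp add: power_add)
  thus False using f_power by blast
qed

text \<open>If \<open>(M : x)\<close> is larger than \<open>M\<close>, it contains a power of
  \<open>f\<close>, which can be cancelled from \<open>f ^ m * x\<close>. Only one factor has to be
  constant.\<close>

lemma const_prime:
  assumes x: "\<Psi> x - x \<in> M" and xy: "x * y \<in> M" shows "x \<in> M \<or> y \<in> M"
proof (rule ccontr)
  assume *: "\<not> (x \<in> M \<or> y \<in> M)"
  with xy have "{y. x * y \<in> M} \<noteq> M" by blast
  then obtain m where "f ^ m \<in> {y. x * y \<in> M}"
    using maximal quotient_ideal[OF x] by metis
  hence "f ^ m * x \<in> M" by (simp add: mult.commute)
  thus False using cancel_f * by blast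
qed

lemma coeff_mult_mem:
  "(\<And>i. coeff p i \<in> \<kappa>) \<Longrightarrow> (\<And>i. coeff q i \<in> \<kappa>) \<Longrightarrow> coeff (p * q) i \<in> \<kappa>"
  by (simp add: coeff_mult sum_mem mult_mem)

lemma coeff_prod_mem:
  "(\<And>i j. i \<in> A \<Longrightarrow> coeff (p i) j \<in> \<kappa>) \<Longrightarrow> coeff (prod p A) j \<in> \<kappa>"
proof (induction A arbitrary: j rule: infinite_finite_induct)
  case (insert x A)
  thus ?case by (simp add: coeff_mult_mem)
qed (auto simp: coeff_1)

lemma c_prod_nonzero:
  assumes "finite A" "\<And>i. i \<in> A \<Longrightarrow> g i \<noteq> 0" "x \<noteq> 0"
  shows "x * (\<Prod>i\<in>A. c (g i)) \<noteq> 0"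
proof
  have "(\<Prod>i\<in>A. c (g i)) * c (inverse (\<Prod>i\<in>A. g i)) = c ((\<Prod>i\<in>A. g i) * inverse (\<Prod>i\<in>A. g i))"
    by (simp add: ring_hom_onD[OF homc] ring_hom_on_prod[OF homc])
  also have "\<dots> = 1" using assms by (simp add: ring_hom_onD[OF homc])
  finally have *: "(\<Prod>i\<in>A. c (g i)) * c (inverse (\<Prod>i\<in>A. g i)) = 1" .
  assume "x * (\<Prod>i\<in>A. c (g i)) = 0"
  hence "x * ((\<Prod>i\<in>A. c (g i)) * c (inverse (\<Prod>i\<in>A. g i))) = 0"
    by (simp only: mult.assoc[symmetric]) simp
  thus False using * assms(3) by simp
qed

text \<open>If \<open>y\<close> is congruent to no complex number, every \<open>y - c z\<close>
  divides a power of \<open>f\<close> modulo \<open>M\<close>. The uncountably many cofactors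
  \<open>q z\<close> live in a space of countable dimension over \<open>\<kappa>\<close>; a linear
  relation among them becomes a polynomial equation for \<open>y\<close> once denominators are
  cleared.\<close>

lemma algebraic_const:
  assumes y: "\<Psi> y - y \<in> M" and none: "\<And>z. y - c z \<notin> M"
  obtains p where "p \<noteq> 0" "\<And>i. coeff p i \<in> \<kappa>" "poly p y \<in> M"
proof -
  \<comment> \<open>The ideal generated by \<open>M\<close> and \<open>y - c z\<close> is stable,
    since \<open>y\<close> is constant modulo \<open>M\<close>, and it is larger than
    \<open>M\<close>.\<close>
  have "\<exists>n q. f ^ n - (y - c z) * q \<in> M" for z
  proof -
    define I where "I = {i + (y - c z) * q | i q. i \<in> M}"
    have sub: "M \<subseteq> I"
    proof
      fix i assume "i \<in> M"
      moreover have "i = i + (y - c z) * 0" by simp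
      ultimately show "i \<in> I" unfolding I_def by blast
    qed
    have "y - c z = 0 + (y - c z) * 1" by simp
    hence "y - c z \<in> I" unfolding I_def using ring_idealD(1)[OF idealM] by blast
    hence ne: "I \<noteq> M" using none by blast
    have "\<Psi> ` I \<subseteq> I"
    proof
      fix x assume "x \<in> \<Psi> ` I"
      then obtain i q where x: "x = \<Psi> (i + (y - c z) * q)" and i: "i \<in> M" by (auto simp: I_def)
      have "x = (\<Psi> i + (\<Psi> y - y) * \<Psi> q) + (y - c z) * \<Psi> q"
        by (simp add: x ring_hom_onD[OF hom\<Psi>] c_fixed algebra_simps)
      moreover have "\<Psi> i + (\<Psi> y - y) * \<Psi> q \<in> M"
        using ring_idealD[OF idealM] stableM i y by simp
      ultimately show "x \<in> I" unfolding I_def by blast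
    qed
    then obtain n where "f ^ n \<in> I"
      using maximal[OF ring_ideal_add_multiples[OF idealM, of "y - c z", folded I_def] _ sub ne] by blast
    then obtain i q where iq: "f ^ n = i + (y - c z) * q" "i \<in> M" by (auto simp: I_def)
    hence "f ^ n - (y - c z) * q \<in> M" by simp
    thus ?thesis by blast
  qed
  then obtain g q where gq: "\<And>z. f ^ g z - (y - c z) * q z \<in> M" by metis
  have sM: "subspace M" using idealM by (auto simp: subspace_def ring_ideal_def)
  obtain T d n where T: "finite T" "\<And>t. t \<in> T \<Longrightarrow> g t = n" "\<And>t. t \<in> T \<Longrightarrow> d t \<in> \<kappa>"
    "\<exists>t\<in>T. d t \<noteq> 0" "(\<Sum>t\<in>T. d t * q t) \<in> M"
    by (rule countable_dependence[OF countable_E sM uncountable_UNIV_complex, of q g])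
       (use span in auto)
  \<comment> \<open>\<open>p\<close> is the numerator of the sum of all
    \<open>d t / (X - c t)\<close> over the common denominator.\<close>
  define p where "p = (\<Sum>t\<in>T. smult (d t) (\<Prod>s\<in>T - {t}. [:- c s, 1:]))"
  have coeff: "coeff p i \<in> \<kappa>" for i
    unfolding p_def coeff_sum coeff_smult
    by (intro sum_mem mult_mem coeff_prod_mem T(3))
       (auto simp: coeff_pCons split: nat.split intro: uminus_mem c_mem)
  \<comment> \<open>At \<open>c t\<close> only the summand with index \<open>t\<close> survives, so
    \<open>d t \<noteq> 0\<close> makes \<open>p\<close> nonzero.\<close>
  obtain t where t: "t \<in> T" "d t \<noteq> 0" using T(4) by blast
  have pdiff: "poly (smult (d s) (\<Prod>r\<in>T - {s}. [:- c r, 1:])) x = d s * (\<Prod>r\<in>T - {s}. (x - c r))" for s x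
    by (simp add: poly_prod)
  have "poly p (c t) = (\<Sum>s\<in>T. d s * (\<Prod>r\<in>T - {s}. (c t - c r)))"
    unfolding p_def poly_sum pdiff ..
  also have "\<dots> = d t * (\<Prod>r\<in>T - {t}. (c t - c r)) + (\<Sum>s\<in>T - {t}. d s * (\<Prod>r\<in>T - {s}. (c t - c r)))"
    using T(1) t by (simp add: sum.remove)
  also have "(\<Sum>s\<in>T - {t}. d s * (\<Prod>r\<in>T - {s}. (c t - c r))) = 0"
  proof (intro sum.neutral ballI)
    fix s assume "s \<in> T - {t}"
    hence "(\<Prod>r\<in>T - {s}. (c t - c r)) = (c t - c t) * (\<Prod>r\<in>T - {s} - {t}. (c t - c r))"
      using T(1) t by (intro prod.remove) auto
    hence "(\<Prod>r\<in>T - {s}. (c t - c r)) = 0" by simp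
    thus "d s * (\<Prod>r\<in>T - {s}. (c t - c r)) = 0" by simp
  qed
  also have "d t * (\<Prod>r\<in>T - {t}. (c t - c r)) = d t * (\<Prod>r\<in>T - {t}. c (t - r))"
    by (simp add: ring_hom_onD(6)[OF homc])
  finally have "poly p (c t) \<noteq> 0" using c_prod_nonzero[of "T - {t}" "\<lambda>r. t - r" "d t"] T(1) t by auto
  hence "p \<noteq> 0" by auto
  moreover have "poly p y \<in> M"
  proof -
    define W where "W = (\<Prod>r\<in>T. (y - c r))"
    have W: "W = (y - c s) * (\<Prod>r\<in>T - {s}. (y - c r))" if "s \<in> T" for s
      unfolding W_def using T(1) that by (rule prod.remove)
    \<comment> \<open>Modulo \<open>M\<close> each \<open>f ^ n\<close> may be replaced by
      \<open>(y - c s) * q s\<close>; the full product \<open>W\<close> then splits off and leaves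
      the relation among the \<open>q s\<close>.\<close>
    have "f ^ n * poly p y = (\<Sum>s\<in>T. f ^ n * (d s * (\<Prod>r\<in>T - {s}. (y - c r))))"
      unfolding p_def poly_sum pdiff sum_distrib_left ..
    also have "\<dots> = (\<Sum>s\<in>T. (f ^ n - (y - c s) * q s) * (d s * (\<Prod>r\<in>T - {s}. (y - c r))) + W * (d s * q s))"
      by (intro sum.cong refl) (simp add: W algebra_simps)
    also have "\<dots> = (\<Sum>s\<in>T. (f ^ n - (y - c s) * q s) * (d s * (\<Prod>r\<in>T - {s}. (y - c r)))) + W * (\<Sum>s\<in>T. d s * q s)"
      by (simp add: sum.distrib sum_distrib_left)
    also have "\<dots> \<in> M"
      using gq T(2) by (intro ring_idealD(2)[OF idealM] ring_ideal_sum[OF idealM]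
          ring_idealD(3)[OF idealM T(5)] ring_idealD(4)[OF idealM]) metis
    finally show ?thesis by (rule cancel_f)
  qed
  ultimately show ?thesis using coeff that by blast
qed

text \<open>A monic equation of minimal degree over \<open>\<kappa>\<close> has complex
  coefficients: \<open>\<Psi>\<close> applied to its coefficients gives another equation for the
  constant \<open>y\<close>, and the difference of the two has smaller degree, hence
  vanishes.\<close>

lemma complex_algebraic_const:
  assumes y: "\<Psi> y - y \<in> M" and none: "\<And>z. y - c z \<notin> M"
  obtains Q where "Q \<noteq> 0" "poly (map_poly c Q) y \<in> M"
proof -
  define A where "A = {p. p \<noteq> 0 \<and> (\<forall>i. coeff p i \<in> \<kappa>) \<and> poly p y \<in> M}"
  have "\<exists>p. p \<in> A" by (rule algebraic_const[OF assms]) (auto simp: A_def)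
  then obtain p where p: "p \<in> A" "\<And>q. q \<in> A \<Longrightarrow> degree p \<le> degree q"
    using ex_has_least_nat[of "\<lambda>p. p \<in> A" _ degree] by blast
  have "lead_coeff p \<noteq> 0" "lead_coeff p \<in> \<kappa>" using p(1) by (auto simp: A_def)
  then obtain l where l: "l \<in> \<kappa>" "lead_coeff p * l = 1" using unit_mem by blast
  define p1 where "p1 = smult l p"
  define n where "n = degree p"
  have n1: "coeff p1 n = 1" using l by (simp add: p1_def n_def mult.commute)
  have n0: "coeff p1 i = 0" if "i > n" for i using that by (simp add: p1_def n_def coeff_eq_0)
  have p1: "coeff p1 i \<in> \<kappa>" "poly p1 y \<in> M" for i
    using p(1) l ring_idealD(3)[OF idealM] by (auto simp: A_def p1_def intro: mult_mem)
  define p2 where "p2 = map_poly \<Psi> p1"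
  have cp2: "coeff p2 i = \<Psi> (coeff p1 i)" for i
    by (simp add: p2_def coeff_map_poly ring_hom_onD(4)[OF hom\<Psi>])
  have "poly p2 (\<Psi> y) \<in> M"
    unfolding p2_def ring_hom_on_poly[OF hom\<Psi>] by (intro stableM p1)
  moreover have "poly p2 (\<Psi> y) - poly p2 y \<in> M"
    by (rule ring_ideal_dvd[OF idealM y poly_diff_dvd])
  ultimately have "poly p2 y \<in> M" using ring_idealD(6)[OF idealM] by fastforce
  hence "poly (p1 - p2) y \<in> M" using ring_idealD(6)[OF idealM] p1(2) by simp
  moreover have "coeff (p1 - p2) i \<in> \<kappa>" for i
    using p1 cp2 \<Psi>_mem diff_mem by simp
  moreover have "p1 - p2 = 0 \<or> degree (p1 - p2) < n"
  proof -
    have "coeff (p1 - p2) i = 0" if "i \<ge> n" for i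
      using that n0[of i] n1 cp2[of i] by (cases "i = n") (auto simp: ring_hom_onD[OF hom\<Psi>])
    hence "p1 - p2 \<noteq> 0 \<Longrightarrow> \<not> degree (p1 - p2) \<ge> n" using leading_coeff_0_iff by blast
    thus ?thesis using not_le by blast
  qed
  ultimately have "p1 - p2 \<noteq> 0 \<Longrightarrow> degree p \<le> degree (p1 - p2) \<and> degree (p1 - p2) < degree p"
    using p(2)[of "p1 - p2"] by (simp add: A_def n_def)
  hence "p1 = p2" using not_le right_minus_eq by blast
  hence "coeff p1 i \<in> range c" for i using fixed p1(1) cp2 by metis
  hence "\<forall>i. \<exists>z. coeff p1 i = c z" by blast
  then obtain g where g: "\<And>i. coeff p1 i = c (g i)" by (auto dest: choice)
  have g0: "g i = 0" if "i > n" for i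
    using n0[OF that] g[of i] ring_hom_on_inj[OF homc, of "g i" 0] by (simp add: ring_hom_onD[OF homc])
  define Q where "Q = Abs_poly g"
  have cQ: "coeff Q = g"
    unfolding Q_def by (rule coeff_Abs_poly[of n]) (use g0 in auto)
  have "map_poly c Q = p1"
    by (intro poly_eqI) (simp add: coeff_map_poly ring_hom_onD(4)[OF homc] cQ g)
  moreover have "Q \<noteq> 0"
  proof
    assume "Q = 0"
    hence "g n = 0" unfolding cQ[symmetric] by simp
    thus False using g[of n] n1 by (simp add: ring_hom_onD(4)[OF homc])
  qed
  ultimately show ?thesis using that p1(2) by blast
qed

text \<open>A complex polynomial of minimal degree annihilating \<open>y\<close> modulo
  \<open>M\<close> has a root \<open>\<mu>\<close>. The constant \<open>y - c \<mu>\<close> is not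
  in \<open>M\<close> and can be cancelled by \<open>const_prime\<close>, against
  minimality.\<close>

lemma const_eq_complex:
  assumes y: "\<Psi> y - y \<in> M"
  shows "\<exists>z. y - c z \<in> M"
proof (rule ccontr)
  assume "\<nexists>z. y - c z \<in> M"
  hence none: "y - c z \<notin> M" for z by blast
  define A where "A = {Q. Q \<noteq> 0 \<and> poly (map_poly c Q) y \<in> M}"
  have "\<exists>Q. Q \<in> A" by (rule complex_algebraic_const[OF y none]) (auto simp: A_def)
  then obtain Q where Q: "Q \<in> A" "\<And>P. P \<in> A \<Longrightarrow> degree Q \<le> degree P"
    using ex_has_least_nat[of "\<lambda>p. p \<in> A" _ degree] by blast
  have "degree Q \<noteq> 0"
  proof
    assume "degree Q = 0"
    then obtain a where a: "Q = [:a:]" by (rule degree_eq_zeroE)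
    have "a \<noteq> 0" "c a \<in> M" using Q(1) a by (auto simp: A_def map_poly_pCons ring_hom_onD(4)[OF homc])
    hence "c (inverse a) * c a \<in> M" using ring_idealD(3)[OF idealM] by blast
    hence "c (inverse a * a) \<in> M" by (simp only: ring_hom_onD[OF homc])
    thus False using f_power[of 0] \<open>a \<noteq> 0\<close> by (simp add: ring_hom_onD[OF homc])
  qed
  then obtain \<mu> where "poly Q \<mu> = 0" using alg_closed_imp_poly_has_root by blast
  then obtain P where P: "Q = [:- \<mu>, 1:] * P" by (auto simp: poly_eq_0_iff_dvd elim: dvdE)
  have "P \<noteq> 0" using Q(1) P by (auto simp: A_def)
  have "map_poly c Q = [:- c \<mu>, 1:] * map_poly c P"
    by (rule poly_eqI)
       (simp add: P coeff_map_poly coeff_pCons ring_hom_onD[OF homc] split: nat.split)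
  hence "poly (map_poly c Q) y = (y - c \<mu>) * poly (map_poly c P) y"
    by (simp only: poly_mult) simp
  hence "(y - c \<mu>) * poly (map_poly c P) y \<in> M" using Q(1) by (simp add: A_def)
  moreover have "\<Psi> (y - c \<mu>) - (y - c \<mu>) \<in> M"
    using y by (simp add: ring_hom_onD[OF hom\<Psi>] c_fixed)
  ultimately have "poly (map_poly c P) y \<in> M" using const_prime none by blast
  hence "degree Q \<le> degree P" using Q(2) \<open>P \<noteq> 0\<close> by (simp add: A_def)
  moreover have "degree Q = Suc (degree P)"
    unfolding P using \<open>P \<noteq> 0\<close> by (subst degree_mult_eq) auto
  ultimately show False by simp
qed

end

subsection \<open>Separability over a subfield of characteristic zero\<close>

text \<open>Multiply the vanishing coefficient of index \<open>s = i + j\<close> by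
  \<open>t = coeff p i * coeff q j\<close>. Every other summand contains a product of coefficients
  with smaller index sum, which is zero by induction, so \<open>t * t = 0\<close>.\<close>

lemma coeff_products_zero:
  fixes p q :: "'q::comm_ring_1 poly"
  assumes reduced: "\<And>x::'q. x * x = 0 \<Longrightarrow> x = 0"
    and zero: "\<And>k. k < N \<Longrightarrow> coeff (p * q) k = 0"
  shows "i + j < N \<Longrightarrow> coeff p i * coeff q j = 0"
proof (induction "i + j" arbitrary: i j rule: less_induct)
  case less
  define s t where "s = i + j" and "t = coeff p i * coeff q j"
  have IH: "coeff p a * coeff q b = 0" if "a + b < s" for a b
    using less that by (simp add: s_def)
  have "0 = t * coeff (p * q) s" using zero less by (simp add: s_def)
  also have "\<dots> = (\<Sum>a\<le>s. t * (coeff p a * coeff q (s - a)))"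
    by (simp add: coeff_mult sum_distrib_left)
  also have "\<dots> = (\<Sum>a\<le>s. if a = i then t * t else 0)"
  proof (intro sum.cong refl)
    fix a assume a: "a \<in> {..s}"
    consider "a = i" | "a < i" | "a > i" by linarith
    thus "t * (coeff p a * coeff q (s - a)) = (if a = i then t * t else 0)"
    proof cases
      case 1
      thus ?thesis by (simp add: t_def s_def)
    next
      case 2
      have "t * (coeff p a * coeff q (s - a)) = (coeff p a * coeff q j) * (coeff p i * coeff q (s - a))"
        by (simp add: t_def mult_ac)
      also have "coeff p a * coeff q j = 0" using 2 by (intro IH) (simp add: s_def)
      finally show ?thesis using 2 by simp
    next
      case 3
      have "t * (coeff p a * coeff q (s - a)) = (coeff p i * coeff q (s - a)) * (coeff p a * coeff q j)"
        by (simp add: t_def mult_ac)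
      also have "coeff p i * coeff q (s - a) = 0" using 3 a by (intro IH) (simp add: s_def)
      finally show ?thesis using 3 by simp
    qed
  qed
  also have "\<dots> = t * t" by (simp add: s_def)
  finally show ?case using reduced t_def by metis
qed

text \<open>The cofactor is monic of degree \<open>N - n\<close>, and for \<open>i < n\<close> the
  product of \<open>coeff p i\<close> with its leading coefficient 1 falls under
  \<open>coeff_products_zero\<close>. So the divisor is a pure power of the variable.\<close>

lemma monic_dvd_monom:
  fixes p q :: "'q::comm_ring_1 poly"
  assumes reduced: "\<And>x::'q. x * x = 0 \<Longrightarrow> x = 0"
    and n: "coeff p n = 1" "\<And>i. i > n \<Longrightarrow> coeff p i = 0" and pq: "p * q = monom 1 N" and i: "i < n"
  shows "coeff p i = 0"
proof -
  have deg: "degree p = n" using n by (metis le_degree le_antisym linorder_not_le degree_le zero_neq_one)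
  have "q \<noteq> 0"
  proof
    assume "q = 0"
    hence "coeff (monom (1::'q) N) N = 0" by (simp flip: pq)
    thus False by simp
  qed
  have "coeff (p * q) (n + degree q) = lead_coeff q"
    using coeff_mult_degree_sum[of p q] n(1) deg by simp
  hence "N = n + degree q" "lead_coeff q = 1"
    using \<open>q \<noteq> 0\<close> unfolding pq by (auto split: if_splits)
  moreover have "coeff p i * lead_coeff q = 0"
    by (rule coeff_products_zero[OF reduced, of N]) (use pq i calculation in auto)
  ultimately show ?thesis by simp
qed

lemma monic_division:
  fixes d :: "'q::comm_ring_1 poly"
  assumes "coeff d n = 1" "\<And>i. i > n \<Longrightarrow> coeff d i = 0"
  shows "\<exists>e r. p = d * e + r \<and> (\<forall>i\<ge>n. coeff r i = 0)"
proof (induction p)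
  case 0
  show ?case by (intro exI[of _ 0]) auto
next
  case (pCons a p)
  then obtain e r where er: "p = d * e + r" "\<forall>i\<ge>n. coeff r i = 0" by blast
  define l where "l = coeff (pCons a r) n"
  have "pCons a p = d * (pCons 0 e + [:l:]) + (pCons a r - smult l d)"
    by (simp add: er(1) algebra_simps)
  moreover have "coeff (pCons a r - smult l d) i = 0" if "i \<ge> n" for i
  proof (cases "i = n")
    case False
    hence "i > n" using that by simp
    then obtain k where k: "i = Suc k" "k \<ge> n" by (cases i) auto
    thus ?thesis using er(2) assms(2)[OF \<open>i > n\<close>] by simp
  qed (simp add: l_def assms(1))
  ultimately show ?case by blast
qed

text \<open>Taylor shift by \<open>x\<close> of a monic polynomial with lower coefficients
  \<open>- k i\<close>.\<close>

lemma coeff_pcompose_shift: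
  fixes x :: "'q::comm_ring_1"
  shows "coeff (pcompose (monom 1 n - (\<Sum>i<n. monom (k i) i)) [:x, 1:]) j =
    coeff ([:x, 1:] ^ n) j - (\<Sum>i<n. k i * coeff ([:x, 1:] ^ i) j)"
proof -
  have "pcompose ([:0, 1:] ^ i) [:x, 1:] = [:x, 1:] ^ i" for i
    by (induction i) (simp_all add: pcompose_1 pcompose_mult pcompose_pCons)
  hence "pcompose (monom a i) [:x, 1:] = smult a ([:x, 1:] ^ i)" for a i
    by (simp add: monom_altdef pcompose_smult)
  thus ?thesis by (simp add: pcompose_diff pcompose_sum coeff_sum)
qed

text \<open>The map \<open>id \<otimes> \<eta>\<close> on polynomials in
  \<open>1 \<otimes> x\<close> whose coefficients lie in the first tensor factor; this needs no
  tensor product yet.\<close>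

definition poly_functional :: "('q::comm_ring_1 \<Rightarrow> 'q) \<Rightarrow> 'q \<Rightarrow> 'q poly \<Rightarrow> 'q" where
  "poly_functional \<eta> x p = (\<Sum>i\<le>degree p. coeff p i * \<eta> (x ^ i))"

lemma poly_functional_ge:
  assumes "m \<ge> degree p"
  shows "poly_functional \<eta> x p = (\<Sum>i\<le>m. coeff p i * \<eta> (x ^ i))"
  unfolding poly_functional_def
  by (rule sum.mono_neutral_left) (use assms in \<open>auto simp: coeff_eq_0\<close>)

lemma poly_functional_add:
  "poly_functional \<eta> x (p + q) = poly_functional \<eta> x p + poly_functional \<eta> x q"
  using degree_add_le_max[of p q]
  by (simp add: poly_functional_ge[of _ "max (degree p) (degree q)"] algebra_simps sum.distrib)

lemma poly_functional_smult: "poly_functional \<eta> x (smult a p) = a * poly_functional \<eta> x p"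
  using degree_smult_le[of a p]
  by (simp add: poly_functional_ge[of _ "degree p"] sum_distrib_left mult_ac)

lemma poly_functional_pCons:
  "poly_functional \<eta> x (pCons 0 p) = poly_functional (\<lambda>y. \<eta> (x * y)) x p"
proof -
  have "poly_functional \<eta> x (pCons 0 p) = (\<Sum>i\<le>Suc (degree p). coeff (pCons 0 p) i * \<eta> (x ^ i))"
    by (rule poly_functional_ge[OF degree_pCons_le])
  thus ?thesis unfolding sum.atMost_Suc_shift by (simp add: poly_functional_def)
qed

context ring_subfield
begin

lemma functional_mult: "functional \<eta> \<Longrightarrow> functional (\<lambda>y. \<eta> (x * y))"
  unfolding functional_def by (auto simp: distrib_left mult.left_commute)

text \<open>Coefficients in \<open>\<kappa>\<close> pass through \<open>\<eta>\<close>, so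
  \<open>d\<close> itself gives \<open>\<eta> (poly d x) = 0\<close>. A factor of the variable in
  \<open>e\<close> replaces \<open>\<eta>\<close> by the functional
  \<open>\<eta> (x * _)\<close>.\<close>

lemma poly_functional_root:
  assumes d: "\<And>i. coeff d i \<in> \<kappa>" "poly d x = 0" and \<eta>: "functional \<eta>"
  shows "poly_functional \<eta> x (d * e) = 0"
  using \<eta>
proof (induction e arbitrary: \<eta>)
  case 0
  thus ?case by (simp add: poly_functional_def functionalD)
next
  case (pCons a e)
  have "poly_functional \<eta> x d = (\<Sum>i\<le>degree d. \<eta> (coeff d i * x ^ i))"
    using functionalD(2)[OF pCons.prems d(1)] by (simp add: poly_functional_def)
  also have "\<dots> = \<eta> (poly d x)"
    by (simp add: poly_altdef functional_sum[OF pCons.prems])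
  finally have "poly_functional \<eta> x d = 0" using d(2) functionalD(4)[OF pCons.prems] by simp
  thus ?case
    using pCons.IH[OF functional_mult[OF pCons.prems, of x]]
    by (simp add: poly_functional_add poly_functional_smult poly_functional_pCons)
qed

lemma kspan_lessThan:
  assumes "u \<in> kspan (g ` {..<n::nat})"
  shows "\<exists>k. (\<forall>i. k i \<in> \<kappa>) \<and> u = (\<Sum>i<n. k i * g i)"
  using assms
proof (induction n arbitrary: u)
  case 0
  have "kspan {} \<subseteq> {0}" by (rule kspan_least) (auto simp: subspace_def)
  thus ?case using 0 by (intro exI[of _ "\<lambda>_. 0"]) auto
next
  case (Suc n)
  hence "u \<in> kspan (insert (g n) (g ` {..<n}))" by (simp add: lessThan_Suc)
  then obtain l v where l: "l \<in> \<kappa>" "v \<in> kspan (g ` {..<n})" "u = l * g n + v"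
    by (rule kspan_insert)
  then obtain k where k: "\<forall>i. k i \<in> \<kappa>" "v = (\<Sum>i<n. k i * g i)" using Suc.IH by blast
  have "u = (\<Sum>i<Suc n. (k(n := l)) i * g i)" using l k by simp
  moreover have "\<forall>i. (k(n := l)) i \<in> \<kappa>" using l k by auto
  ultimately show ?case by blast
qed

text \<open>
  The hypothesis says that \<open>1 \<otimes> x - x \<otimes> 1\<close> is nilpotent in the tensor square of the ring
  over \<open>\<kappa>\<close>.
\<close>

lemma nilpotent_difference_mem:
  assumes reduced: "\<And>y::'q. y * y = 0 \<Longrightarrow> y = 0"
    and char0: "\<And>n. n > 0 \<Longrightarrow> of_nat n \<noteq> (0::'q)"
    and nil: "\<And>\<eta>. functional \<eta> \<Longrightarrow> poly_functional \<eta> x ([:- x, 1:] ^ N) = 0"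
  shows "x \<in> \<kappa>"
proof -
  define W where "W n = kspan ((\<lambda>i. x ^ i) ` {..<n})" for n :: nat
  \<comment> \<open>By \<open>lin\<close> below, such an \<open>\<eta>\<close> reads off the
    coefficient of index \<open>n\<close> of a polynomial of degree at most
    \<open>n\<close>.\<close>
  have sepW: "\<exists>\<eta>. functional \<eta> \<and> (\<forall>i<n. \<eta> (x ^ i) = 0) \<and> \<eta> (x ^ n) = 1" if nW: "x ^ n \<notin> W n" for n
  proof -
    obtain \<eta> where "functional \<eta>" "\<And>w. w \<in> W n \<Longrightarrow> \<eta> w = 0" "\<eta> (x ^ n) = 1"
      by (rule functional_exists[OF _ nW]) (auto simp: W_def subspace_kspan)
    moreover have "x ^ i \<in> W n" if "i < n" for i unfolding W_def using that by (intro kspan_base) auto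
    ultimately show ?thesis by blast
  qed
  have lin: "poly_functional \<eta> x p = 1 * coeff p n"
    if "\<forall>i<n. \<eta> (x ^ i) = 0" "\<eta> (x ^ n) = 1" "\<forall>i>n. coeff p i = 0" for \<eta> p n
  proof -
    have "degree p \<le> n" using that(3) by (simp add: degree_le)
    hence "poly_functional \<eta> x p = (\<Sum>i\<le>n. coeff p i * \<eta> (x ^ i))" by (rule poly_functional_ge)
    also have "\<dots> = (\<Sum>i\<le>n. if i = n then coeff p n else 0)"
      by (intro sum.cong refl) (use that in auto)
    finally show ?thesis by simp
  qed
  have lcoeff: "coeff ([:y, 1:] ^ n) i = 0" if "i > n" for y :: 'q and n i
    using that degree_power_le[of "[:y, 1:]" n] by (intro coeff_eq_0) simp
  \<comment> \<open>Otherwise a functional would read off the leading coefficient 1 of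
    \<open>[:- x, 1:] ^ N\<close>.\<close>
  have "x ^ N \<in> W N"
  proof (rule ccontr)
    assume "x ^ N \<notin> W N"
    then obtain \<eta> where "functional \<eta>" "\<forall>i<N. \<eta> (x ^ i) = 0" "\<eta> (x ^ N) = 1" using sepW by blast
    thus False using nil lin[of N \<eta> "[:- x, 1:] ^ N"] lcoeff by (simp add: coeff_linear_power)
  qed
  \<comment> \<open>The first power dependent on lower ones gives a monic equation \<open>d\<close>
    for \<open>x\<close> over \<open>\<kappa>\<close>. Below degree \<open>n\<close> the powers are
    independent, which forces the remainder \<open>r\<close> of the division by \<open>d\<close> to
    vanish.\<close>
  define n where "n = (LEAST n. x ^ n \<in> W n)"
  have n: "x ^ n \<in> W n" and least: "\<And>m. m < n \<Longrightarrow> x ^ m \<notin> W m"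
    unfolding n_def using LeastI[of "\<lambda>n. x ^ n \<in> W n", OF \<open>x ^ N \<in> W N\<close>] not_less_Least by auto
  obtain k where k: "\<And>i. k i \<in> \<kappa>" "x ^ n = (\<Sum>i<n. k i * x ^ i)"
    using kspan_lessThan n unfolding W_def by blast
  have "n \<noteq> 0"
    using k(2) by (intro notI) simp
  define d where "d = monom 1 n - (\<Sum>i<n. monom (k i) i)"
  have cd: "coeff d i = (if i = n then 1 else if i < n then - k i else 0)" for i
    by (simp add: d_def coeff_sum)
  have d\<kappa>: "coeff d i \<in> \<kappa>" for i using k(1) by (simp add: cd uminus_mem)
  have root: "poly d x = 0" by (simp add: d_def poly_monom poly_sum k(2))
  obtain e r where er: "[:- x, 1:] ^ N = d * e + r" "\<forall>i\<ge>n. coeff r i = 0"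
    using monic_division[of d n "[:- x, 1:] ^ N"] cd by auto
  have "r = 0"
  proof (rule ccontr)
    assume "r \<noteq> 0"
    hence "coeff r (degree r) \<noteq> 0" by simp
    hence "degree r < n" using er(2) not_le by blast
    then obtain \<eta> where \<eta>: "functional \<eta>" "\<forall>i<degree r. \<eta> (x ^ i) = 0" "\<eta> (x ^ degree r) = 1"
      using sepW[OF least[OF \<open>degree r < n\<close>]] by blast
    have "0 = poly_functional \<eta> x (d * e) + poly_functional \<eta> x r"
      using nil[OF \<eta>(1)] er(1) poly_functional_add by metis
    also have "poly_functional \<eta> x (d * e) = 0" by (rule poly_functional_root[OF d\<kappa> root \<eta>(1)])
    also have "poly_functional \<eta> x r = coeff r (degree r)"
      using lin[OF \<eta>(2,3)] by (simp add: coeff_eq_0)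
    finally show False using \<open>r \<noteq> 0\<close> by simp
  qed
  \<comment> \<open>After the shift by \<open>x\<close>, the polynomial
    \<open>[:- x, 1:] ^ N\<close> becomes a pure power of the variable and \<open>d'\<close> a monic
    divisor of it; comparing the coefficients of index \<open>n - 1\<close> yields
    \<open>of_nat n * x \<in> \<kappa>\<close>.\<close>
  define d' where "d' = pcompose d [:x, 1:]"
  have cd': "coeff d' j = coeff ([:x, 1:] ^ n) j - (\<Sum>i<n. k i * coeff ([:x, 1:] ^ i) j)" for j
    unfolding d'_def d_def by (rule coeff_pcompose_shift)
  have "pcompose ([:- x, 1:] ^ m) [:x, 1:] = [:0, 1:] ^ m" for m
    by (induction m) (simp_all add: pcompose_1 pcompose_mult pcompose_pCons del: mult_pCons_left)
  hence "d' * pcompose e [:x, 1:] = monom 1 N"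
    using er(1) \<open>r = 0\<close> unfolding d'_def by (metis add.right_neutral pcompose_mult monom_altdef smult_1_left)
  moreover have "coeff d' n = 1"
    unfolding cd' by (simp add: coeff_linear_power lcoeff)
  moreover have "coeff d' i = 0" if "i > n" for i
    unfolding cd' using that by (simp add: lcoeff)
  ultimately have "coeff d' (n - 1) = 0"
    using monic_dvd_monom[OF reduced, of d' n] \<open>n \<noteq> 0\<close> by auto
  moreover have "coeff d' (n - 1) = of_nat n * x - k (n - 1)"
  proof -
    have "(\<Sum>i<n. k i * coeff ([:x, 1:] ^ i) (n - 1)) = (\<Sum>i<n. if i = n - 1 then k i else 0)"
      by (intro sum.cong refl) (auto simp: coeff_linear_power lcoeff)
    also have "\<dots> = k (n - 1)" using \<open>n \<noteq> 0\<close> by simp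
    finally show ?thesis
      unfolding cd' using \<open>n \<noteq> 0\<close> by (cases n) (simp_all add: coeff_linear_poly_power del: power_Suc)
  qed
  ultimately have nx: "of_nat n * x = k (n - 1)" by simp
  obtain l where l: "l \<in> \<kappa>" "of_nat n * l = 1" using unit_mem[OF of_nat_mem char0] \<open>n \<noteq> 0\<close> by blast
  have "x = l * (of_nat n * x)" using l(2) by (simp add: mult.assoc[symmetric] mult.commute[of l])
  thus ?thesis using mult_mem[OF l(1) k(1)] nx by metis
qed

end

subsection \<open>The tensor square of a Picard--Vessiot ring\<close>

lemma ring_ideal_nilradical:
  assumes J: "ring_ideal J"
  shows "ring_ideal {x. \<exists>n. x ^ n \<in> J}"
  unfolding ring_ideal_def
proof (intro conjI ballI allI)
  show "0 \<in> {x. \<exists>n. x ^ n \<in> J}" using ring_idealD(1)[OF J] by (auto intro: exI[of _ 1])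
next
  fix x y assume "x \<in> {x. \<exists>n. x ^ n \<in> J}" "y \<in> {x. \<exists>n. x ^ n \<in> J}"
  then obtain m n where mn: "x ^ m \<in> J" "y ^ n \<in> J" by blast
  have "(x + y) ^ (m + n) = (\<Sum>k\<le>m + n. of_nat (m + n choose k) * x ^ k * y ^ (m + n - k))"
    by (rule binomial_ring)
  also have "\<dots> \<in> J"
  proof (rule ring_ideal_sum[OF J])
    fix k assume "k \<in> {..m + n}"
    show "of_nat (m + n choose k) * x ^ k * y ^ (m + n - k) \<in> J"
    proof (cases "k \<ge> m")
      case True
      hence "x ^ m dvd of_nat (m + n choose k) * x ^ k * y ^ (m + n - k)"
        by (intro dvd_mult2 dvd_mult le_imp_power_dvd)
      thus ?thesis by (rule ring_ideal_dvd[OF J mn(1)])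
    next
      case False
      hence "y ^ n dvd of_nat (m + n choose k) * x ^ k * y ^ (m + n - k)"
        by (intro dvd_mult le_imp_power_dvd) auto
      thus ?thesis by (rule ring_ideal_dvd[OF J mn(2)])
    qed
  qed
  finally show "x + y \<in> {x. \<exists>n. x ^ n \<in> J}" by blast
next
  fix r x assume "x \<in> {x. \<exists>n. x ^ n \<in> J}"
  then obtain n where "x ^ n \<in> J" by blast
  hence "(r * x) ^ n \<in> J" using ring_idealD(3)[OF J] by (simp add: power_mult_distrib)
  thus "r * x \<in> {x. \<exists>n. x ^ n \<in> J}" by blast
qed

text \<open>
  The tensor square is realised as a quotient of the monoid algebra of the multiplicative monoid
  of the ring over the ring itself; the type below is that monoid, written additively because
  monoid algebras are indexed by additive monoids.
\<close>

typedef 'a mult = "UNIV :: 'a set" morphisms of_mult Mult ..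

lemma of_mult_Mult [simp]: "of_mult (Mult x) = x"
  by (simp add: Mult_inverse)

lemma Mult_of_mult [simp]: "Mult (of_mult x) = x"
  by (rule of_mult_inverse)

instantiation mult :: (comm_monoid_mult) comm_monoid_add
begin

definition zero_mult where "0 = Mult 1"
definition plus_mult where "x + y = Mult (of_mult x * of_mult y)"

instance by standard (simp_all add: zero_mult_def plus_mult_def mult_ac)

end

lemma of_mult_add [simp]: "of_mult (x + y) = of_mult x * of_mult y" and of_mult_0 [simp]: "of_mult 0 = 1"
  by (simp_all add: zero_mult_def plus_mult_def)

lemma poly_mapping_induct_single:
  fixes F :: "'k \<Rightarrow>\<^sub>0 'b::comm_monoid_add"
  assumes single: "\<And>k r. P (Poly_Mapping.single k r)" and add: "\<And>F G. P F \<Longrightarrow> P G \<Longrightarrow> P (F + G)"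
  shows "P F"
proof -
  have 0: "P 0" using single[of undefined 0] by simp
  have "P (\<Sum>k\<in>A. Poly_Mapping.single k (Poly_Mapping.lookup F k))" for A
    by (induction A rule: infinite_finite_induct) (use assms 0 in auto)
  moreover have "F = (\<Sum>k\<in>Poly_Mapping.keys F. Poly_Mapping.single k (Poly_Mapping.lookup F k))"
    by (rule poly_mapping_eqI)
       (simp add: lookup_sum lookup_single when_def in_keys_iff)
  ultimately show ?thesis by (metis (no_types, lifting))
qed

definition extend_singles :: "('k \<Rightarrow> 'b::comm_monoid_add \<Rightarrow> 'c::comm_monoid_add) \<Rightarrow> ('k \<Rightarrow>\<^sub>0 'b) \<Rightarrow> 'c" where
  "extend_singles g F = (\<Sum>k\<in>Poly_Mapping.keys F. g k (Poly_Mapping.lookup F k))"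

lemma
  assumes "\<And>k. g k 0 = 0" "\<And>k x y. g k (x + y) = g k x + g k y"
  shows extend_singles_add: "extend_singles g (F + G) = extend_singles g F + extend_singles g G"
    and extend_singles_single: "extend_singles g (Poly_Mapping.single k r) = g k r"
  using assms by (auto simp: extend_singles_def intro: setsum_keys_plus_distrib)

definition tensor_left :: "'r::comm_ring_1 \<Rightarrow> ('r mult \<Rightarrow>\<^sub>0 'r)" where
  "tensor_left r = Poly_Mapping.single 0 r"

text \<open>Already multiplicative in the monoid algebra; it becomes additive only modulo
  \<open>tensor_ideal\<close>. In contrast, \<open>tensor_left\<close> is a ring homomorphism from
  the start.\<close>

definition tensor_right :: "'r::comm_ring_1 \<Rightarrow> ('r mult \<Rightarrow>\<^sub>0 'r)" where
  "tensor_right s = Poly_Mapping.single (Mult s) 1"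

definition tensor_functional :: "('r::comm_ring_1 \<Rightarrow> 'r) \<Rightarrow> ('r mult \<Rightarrow>\<^sub>0 'r) \<Rightarrow> 'r" where
  "tensor_functional \<eta> = extend_singles (\<lambda>k r. r * \<eta> (of_mult k))"

definition tensor_map :: "('r::comm_ring_1 \<Rightarrow> 'r) \<Rightarrow> ('r mult \<Rightarrow>\<^sub>0 'r) \<Rightarrow> ('r mult \<Rightarrow>\<^sub>0 'r)" where
  "tensor_map \<Phi> = extend_singles (\<lambda>k r. Poly_Mapping.single (Mult (\<Phi> (of_mult k))) (\<Phi> r))"

lemma single_eq_tensor: "Poly_Mapping.single k r = tensor_left r * tensor_right (of_mult k)"
  by (simp add: tensor_left_def tensor_right_def mult_single)

lemma ring_hom_on_tensor_left: "ring_hom_on UNIV tensor_left"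
  by (simp add: ring_hom_on_def tensor_left_def single_add mult_single)

lemma tensor_right_mult: "tensor_right (s * t) = tensor_right s * tensor_right t"
  by (simp add: tensor_right_def mult_single plus_mult_def)

lemma tensor_right_1: "tensor_right 1 = 1"
  by (simp add: tensor_right_def flip: zero_mult_def)

lemma tensor_functional_add:
  "tensor_functional \<eta> (F + G) = tensor_functional \<eta> F + tensor_functional \<eta> G"
  unfolding tensor_functional_def by (rule extend_singles_add) (auto simp: algebra_simps)

lemma tensor_functional_single:
  "tensor_functional \<eta> (Poly_Mapping.single k r) = r * \<eta> (of_mult k)"
  unfolding tensor_functional_def by (rule extend_singles_single) (auto simp: algebra_simps)

lemma tensor_functional_single_mult:
  "tensor_functional \<eta> (Poly_Mapping.single k r * F) = r * tensor_functional (\<lambda>y. \<eta> (of_mult k * y)) F"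
  by (induction F rule: poly_mapping_induct_single)
     (auto simp: mult_single tensor_functional_single tensor_functional_add distrib_left mult.assoc)

lemma tensor_functional_tensor:
  "tensor_functional \<eta> (tensor_left r * tensor_right s) = r * \<eta> s"
  using tensor_functional_single[of \<eta> "Mult s" r] by (simp add: single_eq_tensor)

lemma tensor_map_hom:
  assumes "ring_hom_on UNIV \<Phi>"
  shows "ring_hom_on UNIV (tensor_map \<Phi>)"
    and "tensor_map \<Phi> (tensor_left r) = tensor_left (\<Phi> r)"
    and "tensor_map \<Phi> (tensor_right s) = tensor_right (\<Phi> s)"
proof -
  note hom = ring_hom_onD[OF assms]
  have add: "tensor_map \<Phi> (F + G) = tensor_map \<Phi> F + tensor_map \<Phi> G" for F G
    unfolding tensor_map_def by (rule extend_singles_add) (auto simp: hom single_add)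
  have single: "tensor_map \<Phi> (Poly_Mapping.single k r) = Poly_Mapping.single (Mult (\<Phi> (of_mult k))) (\<Phi> r)" for k r
    unfolding tensor_map_def by (rule extend_singles_single) (auto simp: hom single_add)
  have "tensor_map \<Phi> (Poly_Mapping.single k r * G) =
      tensor_map \<Phi> (Poly_Mapping.single k r) * tensor_map \<Phi> G" for k r G
    by (induction G rule: poly_mapping_induct_single)
       (auto simp: single mult_single add distrib_left hom plus_mult_def)
  hence "tensor_map \<Phi> (F * G) = tensor_map \<Phi> F * tensor_map \<Phi> G" for F G
    by (induction F rule: poly_mapping_induct_single) (auto simp: add distrib_right)
  moreover have "tensor_map \<Phi> 1 = 1"
    using single[of 0 1] by (simp add: hom flip: zero_mult_def)
  ultimately show "ring_hom_on UNIV (tensor_map \<Phi>)" by (simp add: ring_hom_on_def add)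
  show "tensor_map \<Phi> (tensor_left r) = tensor_left (\<Phi> r)"
    by (simp add: tensor_left_def single hom flip: zero_mult_def)
  show "tensor_map \<Phi> (tensor_right s) = tensor_right (\<Phi> s)"
    by (simp add: tensor_right_def single hom)
qed

context ring_subfield
begin

text \<open>The relations of the tensor product over \<open>\<kappa>\<close>, given as the common
  kernel of all \<open>id \<otimes> \<eta>\<close> instead of by generators: functionals separate
  vectors over a field, so membership can be tested without a basis.\<close>

definition tensor_ideal :: "('q mult \<Rightarrow>\<^sub>0 'q) set" where
  "tensor_ideal = {F. \<forall>\<eta>. functional \<eta> \<longrightarrow> tensor_functional \<eta> F = 0}"

lemma ring_ideal_tensor_ideal: "ring_ideal tensor_ideal"
  unfolding ring_ideal_def
proof (intro conjI ballI allI)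
  have "tensor_functional \<eta> 0 = 0" for \<eta> :: "'q \<Rightarrow> 'q"
    using tensor_functional_single[of \<eta> 0 0] by simp
  thus "0 \<in> tensor_ideal" by (simp add: tensor_ideal_def)
next
  fix F G assume "F \<in> tensor_ideal" "G \<in> tensor_ideal"
  thus "F + G \<in> tensor_ideal" by (simp add: tensor_ideal_def tensor_functional_add)
next
  fix G F assume F: "F \<in> tensor_ideal"
  show "G * F \<in> tensor_ideal"
  proof (induction G rule: poly_mapping_induct_single)
    case (1 k r)
    show ?case using F functional_mult
      by (auto simp: tensor_ideal_def tensor_functional_single_mult)
  next
    case (2 G H)
    thus ?case by (simp add: tensor_ideal_def distrib_right tensor_functional_add)
  qed
qed

lemma tensor_ideal_right_add: "tensor_right (s + t) - (tensor_right s + tensor_right t) \<in> tensor_ideal"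
proof -
  have "tensor_right (s + t) - (tensor_right s + tensor_right t) =
    Poly_Mapping.single (Mult (s + t)) 1 + (Poly_Mapping.single (Mult s) (- 1) + Poly_Mapping.single (Mult t) (- 1))"
    by (simp add: tensor_right_def single_uminus)
  thus ?thesis
    by (simp add: tensor_ideal_def tensor_functional_add tensor_functional_single functionalD)
qed

lemma tensor_ideal_right_scale:
  assumes "k \<in> \<kappa>"
  shows "tensor_right (k * s) - tensor_left k * tensor_right s \<in> tensor_ideal"
proof -
  have "tensor_right (k * s) - tensor_left k * tensor_right s =
    Poly_Mapping.single (Mult (k * s)) 1 + Poly_Mapping.single (Mult s) (- k)"
    by (simp add: tensor_right_def tensor_left_def mult_single single_uminus)
  thus ?thesis using assms
    by (simp add: tensor_ideal_def tensor_functional_add tensor_functional_single functionalD)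
qed

text \<open>\<open>\<Phi>\<close> is only semilinear over \<open>\<kappa>\<close>, so functionals
  are pulled back as \<open>\<Psi> \<circ> \<eta> \<circ> \<Phi>\<close>; for this
  \<open>\<kappa>\<close> must be preserved in both directions.\<close>

lemma tensor_ideal_map:
  assumes \<Phi>: "ring_hom_on UNIV \<Phi>" and inv: "\<And>x. \<Phi> (\<Psi> x) = x" "\<And>x. \<Psi> (\<Phi> x) = x"
    and mem: "\<And>k. \<Phi> k \<in> \<kappa> \<longleftrightarrow> k \<in> \<kappa>" and F: "F \<in> tensor_ideal"
  shows "tensor_map \<Phi> F \<in> tensor_ideal"
proof -
  note hom = ring_hom_onD[OF \<Phi>] and hom' = ring_hom_onD[OF tensor_map_hom(1)[OF \<Phi>]]
  have "tensor_functional \<eta> (tensor_map \<Phi> G) = \<Phi> (tensor_functional (\<lambda>y. \<Psi> (\<eta> (\<Phi> y))) G)" for \<eta> G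
    by (induction G rule: poly_mapping_induct_single)
       (simp_all add: single_eq_tensor hom' tensor_map_hom(2,3)[OF \<Phi>] tensor_functional_tensor
         tensor_functional_add hom inv)
  moreover have "functional (\<lambda>y. \<Psi> (\<eta> (\<Phi> y)))" if \<eta>: "functional \<eta>" for \<eta>
    unfolding functional_def
  proof (intro conjI allI ballI)
    have \<Psi>: "\<Psi> (x + y) = \<Psi> x + \<Psi> y" "\<Psi> (x * y) = \<Psi> x * \<Psi> y" for x y
      using inv hom(2)[of "\<Psi> x" "\<Psi> y"] hom(3)[of "\<Psi> x" "\<Psi> y"] by metis+
    show "\<Psi> (\<eta> (\<Phi> (x + y))) = \<Psi> (\<eta> (\<Phi> x)) + \<Psi> (\<eta> (\<Phi> y))" for x y
      by (simp add: hom functionalD[OF \<eta>] \<Psi>)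
    show "\<Psi> (\<eta> (\<Phi> (k * x))) = k * \<Psi> (\<eta> (\<Phi> x))" if "k \<in> \<kappa>" for k x
      using that mem[of k] by (simp add: hom functionalD[OF \<eta>] \<Psi> inv)
    show "range (\<lambda>y. \<Psi> (\<eta> (\<Phi> y))) \<subseteq> \<kappa>"
      using functionalD(3)[OF \<eta>] mem inv(1) by (metis image_subsetI)
  qed
  ultimately show ?thesis using F hom(4) by (simp add: tensor_ideal_def)
qed

text \<open>The power is the value at \<open>tensor_right x\<close> of \<open>[:- x, 1:] ^ N\<close>
  with its coefficients in the first factor, and there \<open>tensor_functional\<close> agrees with
  \<open>poly_functional\<close>.\<close>

lemma nilpotent_tensor_difference_mem:
  assumes reduced: "\<And>y::'q. y * y = 0 \<Longrightarrow> y = 0"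
    and char0: "\<And>n. n > 0 \<Longrightarrow> of_nat n \<noteq> (0::'q)"
    and nil: "(tensor_right x - tensor_left x) ^ N \<in> tensor_ideal"
  shows "x \<in> \<kappa>"
proof (rule nilpotent_difference_mem[OF reduced char0])
  note hom = ring_hom_onD[OF ring_hom_on_tensor_left]
  have ev: "tensor_functional \<eta> (poly (map_poly tensor_left p) (tensor_right x)) = poly_functional \<eta> x p" for \<eta> and p :: "'q poly"
  proof -
    have sum: "tensor_functional \<eta> (\<Sum>i\<in>A. tensor_left (f i) * tensor_right (g i)) = (\<Sum>i\<in>A. f i * \<eta> (g i))"
      for A :: "nat set" and f g
      using tensor_functional_single[of \<eta> 0 0]
      by (induction A rule: infinite_finite_induct)
         (simp_all add: tensor_functional_add tensor_functional_tensor hom)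
    have pow: "tensor_right x ^ i = tensor_right (x ^ i)" for i
      by (induction i) (simp_all add: tensor_right_1 tensor_right_mult)
    have "degree (map_poly tensor_left p) \<le> degree p" by (rule degree_le) (simp add: coeff_map_poly hom coeff_eq_0)
    hence "poly (map_poly tensor_left p) (tensor_right x) =
        (\<Sum>i\<le>degree p. coeff (map_poly tensor_left p) i * tensor_right x ^ i)"
      unfolding poly_altdef by (intro sum.mono_neutral_left) (auto simp: coeff_eq_0)
    hence "poly (map_poly tensor_left p) (tensor_right x) =
        (\<Sum>i\<le>degree p. tensor_left (coeff p i) * tensor_right (x ^ i))"
      by (simp add: coeff_map_poly hom pow)
    thus ?thesis by (simp add: sum poly_functional_def)
  qed
  have pw: "poly (map_poly tensor_left ([:- x, 1:] ^ N)) (tensor_right x) = (tensor_right x - tensor_left x) ^ N"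
  proof (induction N)
    case (Suc N)
    have *: "map_poly tensor_left ([:- x, 1:] * p) = [:- tensor_left x, 1:] * map_poly tensor_left p" for p
      by (rule poly_eqI) (simp add: coeff_map_poly coeff_pCons hom split: nat.split)
    show ?case unfolding power_Suc * poly_mult Suc by simp
  qed (simp add: map_poly_1 hom)
  show "poly_functional \<eta> x ([:- x, 1:] ^ N) = 0" if "functional \<eta>" for \<eta>
    using nil that unfolding tensor_ideal_def ev[symmetric] pw by simp
qed

end

subsection \<open>Invariants of the difference Galois group\<close>

lemma det_map_matrix:
  fixes f :: "'a::comm_ring_1 \<Rightarrow> 'b::comm_ring_1"
  assumes f: "ring_hom_on UNIV f"
  shows "det (map_matrix f A) = f (det A)"
proof -
  note hom = ring_hom_onD[OF f]
  have int: "f (of_int (sign p)) = of_int (sign p)" for p :: "'n::finite \<Rightarrow> 'n"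
    by (cases p rule: sign_cases) (auto simp: hom)
  show ?thesis
    by (simp add: det_def map_matrix_def ring_hom_on_sum[OF f] ring_hom_on_prod[OF f] hom int)
qed

lemma map_matrix_mult:
  fixes f :: "'a::comm_ring_1 \<Rightarrow> 'b::comm_ring_1"
  assumes f: "ring_hom_on UNIV f"
  shows "map_matrix f (A ** B) = map_matrix f A ** map_matrix f B"
  by (simp add: map_matrix_def matrix_matrix_mult_def vec_eq_iff ring_hom_on_sum[OF f] ring_hom_onD[OF f])

lemma map_matrix_mat_1:
  fixes f :: "'a::comm_ring_1 \<Rightarrow> 'b::comm_ring_1"
  assumes f: "ring_hom_on UNIV f"
  shows "map_matrix f (mat 1) = mat 1"
  by (simp add: map_matrix_def mat_def vec_eq_iff ring_hom_onD[OF f])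

context ring_subfield
begin

lemma kspan_mult:
  assumes E: "\<And>e f. e \<in> E \<Longrightarrow> f \<in> E \<Longrightarrow> e * f \<in> E" and xy: "x \<in> kspan E" "y \<in> kspan E"
  shows "x * y \<in> kspan E"
proof -
  note sp = subspaceD[OF subspace_kspan[of E]]
  have left: "e * y \<in> kspan E" if e: "e \<in> E" for e
    using xy(2)
  proof induction
    case zero thus ?case by (simp add: kspan.zero)
  next
    case (step k f z)
    have "e * (k * f + z) = k * (e * f) + e * z" by (simp add: algebra_simps)
    thus ?case using step E[OF e] by (auto intro: kspan.step)
  qed
  show ?thesis
    using xy(1)
  proof induction
    case zero thus ?case by (simp add: kspan.zero)
  next
    case (step k e z)
    have "(k * e + z) * y = k * (e * y) + z * y" by (simp add: algebra_simps)
    thus ?case using step left sp by auto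
  qed
qed

end

text \<open>The base field is the subset \<open>\<kappa>\<close> of the ring, so its embedding
  disappears from the statements. \<open>V\<close> and \<open>d\<close> are the inverse matrix and
  the inverse determinant of \<open>U\<close>.\<close>

locale pv_ring = ring_subfield \<kappa> for \<kappa> :: "'r::comm_ring_1 set" +
  fixes \<Phi> :: "'r \<Rightarrow> 'r" and c :: "complex \<Rightarrow> 'r" and A U V :: "'r^'n^'n" and d :: 'r
  assumes hom\<Phi>: "ring_hom_on UNIV \<Phi>" and bij\<Phi>: "bij \<Phi>" and homc: "ring_hom_on UNIV c"
    and c_mem: "c z \<in> \<kappa>" and c_fixed: "\<Phi> (c z) = c z"
    and fixed_mem: "k \<in> \<kappa> \<Longrightarrow> \<Phi> k = k \<Longrightarrow> k \<in> range c"
    and \<Phi>_mem: "\<Phi> k \<in> \<kappa> \<longleftrightarrow> k \<in> \<kappa>"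
    and A_mem: "A $ i $ j \<in> \<kappa>" and \<Phi>U: "map_matrix \<Phi> U = A ** U"
    and VU: "V ** U = mat 1" and UV: "U ** V = mat 1" and d_det: "d * det U = 1"
    and generated: "generated_subring (\<kappa> \<union> {U $ i $ j | i j. True} \<union> {d}) = UNIV"
    and simple: "ring_ideal I \<Longrightarrow> \<Phi> ` I \<subseteq> I \<Longrightarrow> I = {0} \<or> I = UNIV"
begin

section \<open>Dimension, nilpotents and constants of the Picard--Vessiot ring\<close>

definition monomials :: "'r set" where
  "monomials = prod_list ` lists ({U $ i $ j | i j. True} \<union> {d})"

lemma countable_monomials: "countable monomials"
proof -
  have "{U $ i $ j | i j. True} = (\<lambda>(i, j). U $ i $ j) ` UNIV" by auto
  hence "finite {U $ i $ j | i j. True}" by simp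
  hence "countable ({U $ i $ j | i j. True} \<union> {d})" by (intro countable_finite) auto
  thus ?thesis unfolding monomials_def by (intro countable_image countable_lists)
qed

text \<open>The words in finitely many generators are closed under products, so the ring has
  countable dimension over \<open>\<kappa>\<close>.\<close>

lemma kspan_monomials: "kspan monomials = UNIV"
proof -
  have m1: "1 \<in> monomials" unfolding monomials_def by (rule image_eqI[of _ _ "[]"]) auto
  have mm: "e * f \<in> monomials" if ef: "e \<in> monomials" "f \<in> monomials" for e f
  proof -
    obtain k l where "e = prod_list k" "f = prod_list l"
      "k \<in> lists ({U $ i $ j | i j. True} \<union> {d})" "l \<in> lists ({U $ i $ j | i j. True} \<union> {d})"
      using ef unfolding monomials_def by blast
    thus ?thesis unfolding monomials_def by (intro image_eqI[of _ _ "k @ l"]) auto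
  qed
  note sp = subspaceD[OF subspace_kspan[of monomials]]
  have "x \<in> kspan monomials" if "x \<in> generated_subring (\<kappa> \<union> {U $ i $ j | i j. True} \<union> {d})" for x
    using that
  proof induction
    case (gen x)
    show ?case
    proof (cases "x \<in> \<kappa>")
      case True
      thus ?thesis using sp(3)[OF True kspan_base[OF m1]] by simp
    next
      case False
      with gen have "prod_list [x] \<in> monomials" unfolding monomials_def by (intro imageI) auto
      thus ?thesis by (auto intro: kspan_base)
    qed
  next
    case (neg x)
    thus ?case using sp(3)[OF uminus_mem[OF one_mem]] by fastforce
  qed (auto intro: kspan_base m1 sp kspan_mult mm)
  thus ?thesis using generated by auto
qed

text \<open>The nilradical is a \<open>\<Phi>\<close>-stable ideal without 1, hence zero by
  simplicity.\<close>

lemma reduced: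
  assumes "x * x = (0::'r)" shows "x = 0"
proof -
  have id0: "ring_ideal {0::'r}" by (auto simp: ring_ideal_def)
  define N where "N = {x::'r. \<exists>n. x ^ n \<in> {0}}"
  have "ring_ideal N" unfolding N_def by (rule ring_ideal_nilradical[OF id0])
  moreover have "\<Phi> ` N \<subseteq> N"
  proof
    fix y assume "y \<in> \<Phi> ` N"
    then obtain z n where "y = \<Phi> z" "z ^ n = 0" by (auto simp: N_def)
    hence "y ^ n = 0" using ring_hom_on_power[OF hom\<Phi>, of z n] ring_hom_onD(4)[OF hom\<Phi>] by simp
    thus "y \<in> N" by (auto simp: N_def)
  qed
  moreover have "1 \<notin> N" by (simp add: N_def)
  ultimately have "N = {0}" using simple by blast
  moreover have "x \<in> N" using assms by (auto simp: N_def intro!: exI[of _ 2] simp: power2_eq_square)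
  ultimately show ?thesis by blast
qed

lemma char0: "n > 0 \<Longrightarrow> of_nat n \<noteq> (0::'r)"
proof -
  have "c (of_nat n) = of_nat n" for n
    by (induction n) (simp_all add: ring_hom_onD[OF homc])
  thus "n > 0 \<Longrightarrow> of_nat n \<noteq> (0::'r)"
    using ring_hom_on_inj[OF homc, of "of_nat n" 0] ring_hom_onD(4)[OF homc] by auto
qed

lemma fixed_complex:
  assumes "\<Phi> x = x" shows "x \<in> range c"
proof -
  interpret maximal_difference_ideal \<kappa> \<Phi> c monomials "{0}" 1
  proof
    show "kspan (monomials \<union> {0}) = UNIV"
      using kspan_mono[of monomials "monomials \<union> {0}"] kspan_monomials by auto
    show "\<exists>n. 1 ^ n \<in> I" if "ring_ideal I" "\<Phi> ` I \<subseteq> I" "{0} \<subseteq> I" "I \<noteq> {0}" for I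
      using simple[OF that(1,2)] that(4) by auto
  qed (auto simp: hom\<Phi> homc c_mem \<Phi>_mem c_fixed fixed_mem countable_monomials ring_ideal_def ring_hom_onD[OF hom\<Phi>])
  have "\<exists>z. x - c z \<in> {0}" by (rule const_eq_complex) (simp add: assms)
  thus ?thesis by auto
qed

lemma \<Phi>_det: "\<Phi> (det U) = det A * det U"
  using det_map_matrix[OF hom\<Phi>, of U] by (simp add: \<Phi>U det_mul)

lemma det_A_mem: "det A \<in> \<kappa>"
  unfolding det_def by (intro sum_mem mult_mem prod_mem of_int_mem A_mem)

lemma \<Phi>_d: "d = det A * \<Phi> d"
proof -
  have "\<Phi> d * (det A * det U) = 1"
    using d_det ring_hom_onD(1,3)[OF hom\<Phi>] \<Phi>_det by metis
  hence "d = d * (\<Phi> d * (det A * det U))" by simp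
  also have "\<dots> = (d * det U) * (det A * \<Phi> d)" by (simp only: mult_ac)
  finally show ?thesis by (simp add: d_det)
qed

lemma \<Phi>_V: "map_matrix \<Phi> V ** A = V"
proof -
  have "(map_matrix \<Phi> V ** A) ** U = mat 1"
    using map_matrix_mult[OF hom\<Phi>, of V U]
    by (simp add: VU map_matrix_mat_1[OF hom\<Phi>] \<Phi>U matrix_mul_assoc)
  hence "((map_matrix \<Phi> V ** A) ** U) ** V = V" by simp
  thus ?thesis by (simp add: matrix_mul_assoc[symmetric] UV)
qed

abbreviation "J \<equiv> tensor_ideal"
abbreviation "\<Psi> \<equiv> tensor_map \<Phi>"

lemma J_stable: "F \<in> J \<Longrightarrow> \<Psi> F \<in> J"
  by (rule tensor_ideal_map[OF hom\<Phi>, of "inv \<Phi>"])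
     (use bij\<Phi> in \<open>auto simp: bij_is_surj surj_f_inv_f bij_is_inj \<Phi>_mem\<close>)

lemmas hom\<Psi> = tensor_map_hom(1)[OF hom\<Phi>]
lemmas J = ring_idealD[OF ring_ideal_tensor_ideal]
lemmas tl = ring_hom_onD[OF ring_hom_on_tensor_left]

section \<open>Constants of the tensor square\<close>

definition tensor_constants :: "('r mult \<Rightarrow>\<^sub>0 'r) set" where
  "tensor_constants = {F. \<Psi> F - F \<in> J}"

lemma tensor_constants_add: "F \<in> tensor_constants \<Longrightarrow> G \<in> tensor_constants \<Longrightarrow> F + G \<in> tensor_constants"
  using J(2)[of "\<Psi> F - F" "\<Psi> G - G"]
  by (simp add: tensor_constants_def ring_hom_onD[OF hom\<Psi>] algebra_simps)

lemma tensor_constants_mult: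
  assumes "F \<in> tensor_constants" "G \<in> tensor_constants" shows "F * G \<in> tensor_constants"
proof -
  have "\<Psi> (F * G) - F * G = \<Psi> F * (\<Psi> G - G) + G * (\<Psi> F - F)"
    by (simp add: ring_hom_onD[OF hom\<Psi>] algebra_simps)
  thus ?thesis using assms J by (simp add: tensor_constants_def)
qed

lemma tensor_constants_c: "tensor_left (c z) \<in> tensor_constants"
  by (simp add: tensor_constants_def tensor_map_hom(2)[OF hom\<Phi>] c_fixed J)

lemma tensor_constants_1: "1 \<in> tensor_constants"
  using tensor_constants_c[of 1] by (simp add: tl ring_hom_onD[OF homc])

lemma tensor_constants_diff: "F \<in> tensor_constants \<Longrightarrow> G \<in> tensor_constants \<Longrightarrow> F - G \<in> tensor_constants"
  using tensor_constants_add[of F "- G"] tensor_constants_mult[OF tensor_constants_c[of "- 1"], of G]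
  by (simp add: tl ring_hom_onD[OF homc])

lemma tensor_right_sum: "tensor_right (sum f I) - (\<Sum>i\<in>I. tensor_right (f i)) \<in> J"
proof (induction I rule: infinite_finite_induct)
  case (insert x I)
  have "tensor_right (sum f (insert x I)) - (\<Sum>i\<in>insert x I. tensor_right (f i)) =
    (tensor_right (f x + sum f I) - (tensor_right (f x) + tensor_right (sum f I))) +
    (tensor_right (sum f I) - (\<Sum>i\<in>I. tensor_right (f i)))"
    using insert by simp
  also have "\<dots> \<in> J" by (rule J(2)[OF tensor_ideal_right_add insert.IH])
  finally show ?case .
qed (use tensor_ideal_right_scale[of 0 0] in \<open>simp_all add: tl\<close>)

text \<open>The entries of \<open>(V \<otimes> 1) (1 \<otimes> U)\<close>: the coordinate functions
  of the Galois group inside the tensor square. An automorphism will send them to its matrix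
  \<open>C\<close>.\<close>

definition Z :: "'n \<Rightarrow> 'n \<Rightarrow> ('r mult \<Rightarrow>\<^sub>0 'r)" where
  "Z i j = (\<Sum>k\<in>UNIV. tensor_left (V $ i $ k) * tensor_right (U $ k $ j))"

text \<open>The entries of \<open>A\<close> lie in \<open>\<kappa>\<close> and move across the
  tensor sign; there they meet \<open>\<Phi> V\<close>, and
  \<open>\<Phi> V ** A = V\<close>.\<close>

lemma Z_const: "Z i j \<in> tensor_constants"
proof -
  have \<Phi>U': "\<Phi> (U $ k $ j) = (\<Sum>l\<in>UNIV. A $ k $ l * U $ l $ j)" for k
  proof -
    have "map_matrix \<Phi> U $ k $ j = (A ** U) $ k $ j" by (simp add: \<Phi>U)
    thus ?thesis by (simp add: map_matrix_def matrix_matrix_mult_def)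
  qed
  have V': "(\<Sum>k\<in>UNIV. \<Phi> (V $ i $ k) * A $ k $ l) = V $ i $ l" for l
  proof -
    have "(map_matrix \<Phi> V ** A) $ i $ l = V $ i $ l" by (simp add: \<Phi>_V)
    thus ?thesis by (simp add: map_matrix_def matrix_matrix_mult_def)
  qed
  define T where "T k = (\<Sum>l\<in>UNIV. tensor_left (A $ k $ l) * tensor_right (U $ l $ j))" for k
  have T: "tensor_right (\<Phi> (U $ k $ j)) - T k \<in> J" for k
  proof -
    have "(\<Sum>l\<in>UNIV. tensor_right (A $ k $ l * U $ l $ j)) - T k \<in> J"
      unfolding T_def sum_subtractf[symmetric]
      by (intro ring_ideal_sum[OF ring_ideal_tensor_ideal] tensor_ideal_right_scale A_mem)
    thus ?thesis
      unfolding \<Phi>U' by (rule ring_ideal_cong_trans[OF ring_ideal_tensor_ideal tensor_right_sum])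
  qed
  have "\<Psi> (Z i j) - (\<Sum>k\<in>UNIV. tensor_left (\<Phi> (V $ i $ k)) * T k) =
    (\<Sum>k\<in>UNIV. tensor_left (\<Phi> (V $ i $ k)) * (tensor_right (\<Phi> (U $ k $ j)) - T k))"
    by (simp add: Z_def ring_hom_on_sum[OF hom\<Psi>] ring_hom_onD[OF hom\<Psi>] tensor_map_hom(2,3)[OF hom\<Phi>]
        sum_subtractf algebra_simps)
  also have "\<dots> \<in> J" by (intro ring_ideal_sum[OF ring_ideal_tensor_ideal] J(3) T)
  also have "(\<Sum>k\<in>UNIV. tensor_left (\<Phi> (V $ i $ k)) * T k) =
    (\<Sum>k\<in>UNIV. \<Sum>l\<in>UNIV. tensor_left (\<Phi> (V $ i $ k) * A $ k $ l) * tensor_right (U $ l $ j))"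
    by (simp add: T_def sum_distrib_left tl mult.assoc)
  also have "\<dots> = (\<Sum>l\<in>UNIV. \<Sum>k\<in>UNIV. tensor_left (\<Phi> (V $ i $ k) * A $ k $ l) * tensor_right (U $ l $ j))"
    by (rule sum.swap)
  also have "\<dots> = Z i j"
    by (simp add: sum_distrib_right[symmetric] ring_hom_on_sum[OF ring_hom_on_tensor_left, symmetric] V' Z_def)
  finally show ?thesis by (simp add: tensor_constants_def)
qed

text \<open>An identity in the monoid algebra itself, since \<open>U ** V = mat 1\<close> is used
  only in the first factor.\<close>

lemma right_U: "tensor_right (U $ k $ j) = (\<Sum>i\<in>UNIV. tensor_left (U $ k $ i) * Z i j)"
proof -
  have UV': "(\<Sum>i\<in>UNIV. U $ k $ i * V $ i $ l) = (if k = l then 1 else 0)" for l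
  proof -
    have "(U ** V) $ k $ l = (if k = l then 1 else 0)" by (simp add: UV mat_def)
    thus ?thesis by (simp add: matrix_matrix_mult_def)
  qed
  have "(\<Sum>i\<in>UNIV. tensor_left (U $ k $ i) * Z i j) =
    (\<Sum>i\<in>UNIV. \<Sum>l\<in>UNIV. tensor_left (U $ k $ i * V $ i $ l) * tensor_right (U $ l $ j))"
    by (simp add: Z_def sum_distrib_left tl mult.assoc)
  also have "\<dots> = (\<Sum>l\<in>UNIV. \<Sum>i\<in>UNIV. tensor_left (U $ k $ i * V $ i $ l) * tensor_right (U $ l $ j))"
    by (rule sum.swap)
  also have "\<dots> = (\<Sum>l\<in>UNIV. tensor_left (if k = l then 1 else 0) * tensor_right (U $ l $ j))"
    by (simp add: sum_distrib_right[symmetric] ring_hom_on_sum[OF ring_hom_on_tensor_left, symmetric] UV')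
  also have "\<dots> = (\<Sum>l\<in>UNIV. if k = l then tensor_right (U $ l $ j) else 0)"
    by (intro sum.cong refl) (auto simp: tl)
  finally show ?thesis by simp
qed

text \<open>The inverse of the determinant of the matrix \<open>Z\<close>, modulo
  \<open>J\<close>.\<close>

definition \<delta> :: "'r mult \<Rightarrow>\<^sub>0 'r" where
  "\<delta> = tensor_left (det U) * tensor_right d"

lemma \<delta>_const: "\<delta> \<in> tensor_constants"
proof -
  have "\<Psi> \<delta> - \<delta> = - (tensor_left (det U) * (tensor_right (det A * \<Phi> d) - tensor_left (det A) * tensor_right (\<Phi> d)))"
    using \<Phi>_d
    by (simp add: \<delta>_def ring_hom_onD[OF hom\<Psi>] tensor_map_hom(2,3)[OF hom\<Phi>] \<Phi>_det tl algebra_simps)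
  also have "\<dots> \<in> J" by (intro J(5) J(3) tensor_ideal_right_scale det_A_mem)
  finally show ?thesis by (simp add: tensor_constants_def)
qed

lemma right_d: "tensor_right d = tensor_left d * \<delta>"
  unfolding \<delta>_def mult.assoc[symmetric] tl(3)[symmetric] d_det tl(1) by simp

inductive_set constant_span :: "('r mult \<Rightarrow>\<^sub>0 'r) set" where
  ideal: "F \<in> J \<Longrightarrow> F \<in> constant_span"
| step: "s \<in> tensor_constants \<Longrightarrow> F \<in> constant_span \<Longrightarrow> tensor_left r * s + F \<in> constant_span"

lemma constant_span_add: "F \<in> constant_span \<Longrightarrow> G \<in> constant_span \<Longrightarrow> F + G \<in> constant_span"
proof (induction rule: constant_span.induct)
  case (ideal F)
  from ideal(2) show ?case
  proof induction
    case (ideal G)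
    thus ?case using \<open>F \<in> J\<close> J(2) by (auto intro: constant_span.ideal)
  next
    case (step s G r)
    thus ?case using constant_span.step[of s "F + G" r] by (simp add: add.left_commute)
  qed
qed (auto simp: add.assoc intro: constant_span.step)

lemma constant_span_term: "s \<in> tensor_constants \<Longrightarrow> tensor_left r * s \<in> constant_span"
  using constant_span.step[OF _ constant_span.ideal[OF J(1)], of s r] by simp

lemma constant_span_mult: "F \<in> constant_span \<Longrightarrow> G \<in> constant_span \<Longrightarrow> F * G \<in> constant_span"
proof (induction rule: constant_span.induct)
  case (ideal F)
  thus ?case by (auto intro: constant_span.ideal J)
next
  case (step s F r)
  have "tensor_left r * s * G \<in> constant_span"
    using step(4)
  proof induction
    case (ideal G)
    thus ?case by (auto intro: constant_span.ideal J)
  next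
    case (step t G q)
    have "tensor_left r * s * (tensor_left q * t + G) = tensor_left (r * q) * (s * t) + tensor_left r * s * G"
      by (simp add: tl algebra_simps)
    thus ?case using step tensor_constants_mult[OF \<open>s \<in> tensor_constants\<close>] by (auto intro: constant_span.step)
  qed
  thus ?case using step by (simp add: distrib_right constant_span_add)
qed

lemma constant_span_sum: "(\<And>i. i \<in> I \<Longrightarrow> f i \<in> constant_span) \<Longrightarrow> sum f I \<in> constant_span"
  by (induction I rule: infinite_finite_induct) (auto intro: constant_span_add constant_span.ideal J)

lemma constant_span_cong: "G \<in> constant_span \<Longrightarrow> F - G \<in> J \<Longrightarrow> F \<in> constant_span"
  using constant_span_add[OF constant_span.ideal, of "F - G" G] by simp

text \<open>The torsor property: over the first factor the tensor square is generated by its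
  constants. It suffices to check the generators of the second factor, where \<open>right_U\<close>
  and \<open>right_d\<close> apply.\<close>

lemma constant_span_UNIV: "F \<in> constant_span"
proof -
  have left: "tensor_left r \<in> constant_span" for r
    using constant_span_term[OF tensor_constants_1, of r] by simp
  have right: "tensor_right x \<in> constant_span"
    if "x \<in> generated_subring (\<kappa> \<union> {U $ i $ j | i j. True} \<union> {d})" for x
    using that
  proof induction
    case (gen x)
    then consider "x \<in> \<kappa>" | i j where "x = U $ i $ j" | "x = d" by blast
    thus ?case
    proof cases
      case 1
      have "tensor_right x - tensor_left x \<in> J"
        using tensor_ideal_right_scale[OF 1, of 1] by (simp add: tensor_right_1)
      thus ?thesis by (rule constant_span_cong[OF left])
    next
      case 2
      show ?thesis unfolding 2 right_U by (intro constant_span_sum constant_span_term Z_const)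
    next
      case 3
      show ?thesis unfolding 3 right_d by (intro constant_span_term \<delta>_const)
    qed
  next
    case one
    show ?case using left[of 1] by (simp add: tensor_right_1 tl)
  next
    case (add x y)
    show ?case by (rule constant_span_cong[OF constant_span_add tensor_ideal_right_add]) fact+
  next
    case (neg x)
    have "tensor_right (- x) - tensor_left (- 1) * tensor_right x \<in> J"
      using tensor_ideal_right_scale[OF uminus_mem[OF one_mem], of x] by simp
    thus ?case by (rule constant_span_cong[OF constant_span_mult[OF left neg.IH]])
  next
    case (mult x y)
    thus ?case by (simp add: tensor_right_mult constant_span_mult)
  qed
  hence right: "tensor_right x \<in> constant_span" for x unfolding generated by simp
  show ?thesis
    by (induction F rule: poly_mapping_induct_single)
       (simp_all add: single_eq_tensor constant_span_add constant_span_mult left right)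
qed

definition tensor_base :: "('r mult \<Rightarrow>\<^sub>0 'r) set" where
  "tensor_base = tensor_left ` \<kappa>"

definition tensor_monomials :: "('r mult \<Rightarrow>\<^sub>0 'r) set" where
  "tensor_monomials = (\<lambda>(e, f). tensor_left e * tensor_right f) ` (monomials \<times> monomials)"

lemma tensor_left_inj: "tensor_left x = tensor_left y \<Longrightarrow> x = (y::'r)"
  unfolding tensor_left_def by (metis lookup_single_eq)

sublocale tensor: ring_subfield tensor_base
proof
  fix x y assume "x \<in> tensor_base" "y \<in> tensor_base"
  then obtain k l where kl: "x = tensor_left k" "y = tensor_left l" "k \<in> \<kappa>" "l \<in> \<kappa>"
    by (auto simp: tensor_base_def)
  show "x + y \<in> tensor_base" "x * y \<in> tensor_base"
    unfolding kl tl(2,3)[symmetric] tensor_base_def using kl add_mem mult_mem by auto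
next
  fix x assume "x \<in> tensor_base"
  then obtain k where k: "x = tensor_left k" "k \<in> \<kappa>" by (auto simp: tensor_base_def)
  show "- x \<in> tensor_base"
    unfolding k tl(5)[symmetric] tensor_base_def using k uminus_mem by auto
  assume "x \<noteq> 0"
  hence "k \<noteq> 0" using k tl(4) by auto
  then obtain l where l: "l \<in> \<kappa>" "k * l = 1" using unit_mem k by blast
  have "x * tensor_left l = 1" by (simp add: k tl(3)[symmetric] l tl(1))
  thus "\<exists>y\<in>tensor_base. x * y = 1" using l(1) unfolding tensor_base_def by blast
next
  show "0 \<in> tensor_base" using imageI[OF zero_mem, of tensor_left] by (simp add: tensor_base_def tl(4))
  show "1 \<in> tensor_base" using imageI[OF one_mem, of tensor_left] by (simp add: tensor_base_def tl(1))
qed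

text \<open>Countable dimension of the tensor square over \<open>\<kappa>\<close>. The quotient by
  \<open>J\<close> is not formed, so \<open>J\<close> stands among the generators.\<close>

lemma tensor_kspan: "F \<in> tensor.kspan (tensor_monomials \<union> J)"
proof -
  note sp = tensor.subspaceD[OF tensor.subspace_kspan[of "tensor_monomials \<union> J"]]
  have tb: "tensor_left k \<in> tensor_base" if "k \<in> \<kappa>" for k
    using that by (simp add: tensor_base_def)
  have J_span: "G \<in> J \<Longrightarrow> G \<in> tensor.kspan (tensor_monomials \<union> J)" for G
    by (rule tensor.kspan_base) simp
  have base: "tensor_left e * tensor_right s \<in> tensor.kspan (tensor_monomials \<union> J)"
    if e: "e \<in> monomials" and "s \<in> kspan monomials" for e s
    using that(2)
  proof induction
    case zero
    have "tensor_right 0 \<in> J" using tensor_ideal_right_scale[of 0 0] by (simp add: tl)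
    thus ?case by (intro J_span J(3))
  next
    case (step k f x)
    have "tensor_left e * tensor_right (k * f + x) =
      tensor_left e * (tensor_right (k * f + x) - (tensor_right (k * f) + tensor_right x)) +
      tensor_left e * (tensor_right (k * f) - tensor_left k * tensor_right f) +
      (tensor_left k * (tensor_left e * tensor_right f) + tensor_left e * tensor_right x)"
      by (simp add: algebra_simps)
    also have "\<dots> \<in> tensor.kspan (tensor_monomials \<union> J)"
    proof (rule sp(2)[OF sp(2) sp(2)])
      show "tensor_left e * (tensor_right (k * f + x) - (tensor_right (k * f) + tensor_right x))
          \<in> tensor.kspan (tensor_monomials \<union> J)"
        by (rule J_span[OF J(3)[OF tensor_ideal_right_add]])
      show "tensor_left e * (tensor_right (k * f) - tensor_left k * tensor_right f)
          \<in> tensor.kspan (tensor_monomials \<union> J)"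
        by (rule J_span[OF J(3)[OF tensor_ideal_right_scale[OF step(1)]]])
      have "tensor_left e * tensor_right f \<in> tensor.kspan (tensor_monomials \<union> J)"
        using e step(2) by (intro tensor.kspan_base) (auto simp: tensor_monomials_def)
      thus "tensor_left k * (tensor_left e * tensor_right f) \<in> tensor.kspan (tensor_monomials \<union> J)"
        by (rule sp(3)[OF tb[OF step(1)]])
    qed (rule step)
    finally show ?case .
  qed
  have "tensor_left r * tensor_right s \<in> tensor.kspan (tensor_monomials \<union> J)"
    if "r \<in> kspan monomials" for r s
    using that
  proof induction
    case zero
    show ?case by (simp add: tl sp)
  next
    case (step k e x)
    have "tensor_left (k * e + x) * tensor_right s =
      tensor_left k * (tensor_left e * tensor_right s) + tensor_left x * tensor_right s"
      by (simp add: tl algebra_simps)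
    also have "\<dots> \<in> tensor.kspan (tensor_monomials \<union> J)"
    proof (rule sp(2))
      show "tensor_left k * (tensor_left e * tensor_right s) \<in> tensor.kspan (tensor_monomials \<union> J)"
        by (rule sp(3)[OF tb[OF step(1)] base[OF step(2)]]) (simp add: kspan_monomials)
    qed (rule step)
    finally show ?case .
  qed
  thus ?thesis
    by (induction F rule: poly_mapping_induct_single) (simp_all add: single_eq_tensor kspan_monomials sp)
qed

section \<open>From maximal difference ideals to automorphisms and invariants\<close>

lemma maximal_stable_ideal_exists:
  assumes "\<And>n. f ^ n \<notin> J"
  obtains M where "ring_ideal M" "\<Psi> ` M \<subseteq> M" "J \<subseteq> M" "\<And>n. f ^ n \<notin> M"
    "\<And>I. ring_ideal I \<Longrightarrow> \<Psi> ` I \<subseteq> I \<Longrightarrow> M \<subseteq> I \<Longrightarrow> I \<noteq> M \<Longrightarrow> \<exists>n. f ^ n \<in> I"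
proof -
  \<comment> \<open>The exponent 0 is included, so these ideals are proper.\<close>
  define \<A> where "\<A> = {I. ring_ideal I \<and> \<Psi> ` I \<subseteq> I \<and> J \<subseteq> I \<and> (\<forall>n. f ^ n \<notin> I)}"
  have "\<exists>M\<in>\<A>. \<forall>X\<in>\<A>. M \<subseteq> X \<longrightarrow> X = M"
  proof (rule subset_Zorn_nonempty)
    have "J \<in> \<A>" using ring_ideal_tensor_ideal J_stable assms by (auto simp: \<A>_def)
    thus "\<A> \<noteq> {}" by blast
  next
    fix \<C> assume ne: "\<C> \<noteq> {}" and ch: "subset.chain \<A> \<C>"
    have sub: "\<C> \<subseteq> \<A>" and tot: "\<And>X Y. X \<in> \<C> \<Longrightarrow> Y \<in> \<C> \<Longrightarrow> X \<subseteq> Y \<or> Y \<subseteq> X"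
      using ch by (auto simp: subset_chain_def)
    have id: "ring_ideal X" "\<Psi> ` X \<subseteq> X" "J \<subseteq> X" "f ^ n \<notin> X" if "X \<in> \<C>" for X n
    proof -
      have "X \<in> \<A>" using that sub by blast
      thus "ring_ideal X" "\<Psi> ` X \<subseteq> X" "J \<subseteq> X" "f ^ n \<notin> X" unfolding \<A>_def by blast+
    qed
    have "ring_ideal (\<Union>\<C>)"
      unfolding ring_ideal_def
    proof (intro conjI ballI allI)
      show "0 \<in> \<Union>\<C>" using ne ring_idealD(1)[OF id(1)] by blast
    next
      fix u v assume "u \<in> \<Union>\<C>" "v \<in> \<Union>\<C>"
      then obtain X Y where XY: "X \<in> \<C>" "Y \<in> \<C>" "u \<in> X" "v \<in> Y" by blast
      hence "\<exists>W\<in>\<C>. u \<in> W \<and> v \<in> W" using tot[of X Y] by blast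
      thus "u + v \<in> \<Union>\<C>" using ring_idealD(2)[OF id(1)] by blast
    next
      fix r u assume "u \<in> \<Union>\<C>"
      thus "r * u \<in> \<Union>\<C>" using ring_idealD(3)[OF id(1)] by blast
    qed
    moreover have "\<Psi> ` \<Union>\<C> \<subseteq> \<Union>\<C>" using id(2) by blast
    moreover have "J \<subseteq> \<Union>\<C>" using id(3) ne by blast
    moreover have "\<forall>n. f ^ n \<notin> \<Union>\<C>" using id(4) by blast
    ultimately show "\<Union>\<C> \<in> \<A>" by (simp add: \<A>_def)
  qed
  then obtain M where M: "M \<in> \<A>" "\<forall>X\<in>\<A>. M \<subseteq> X \<longrightarrow> X = M" by (elim bexE)
  have "\<exists>n. f ^ n \<in> I" if I: "ring_ideal I" "\<Psi> ` I \<subseteq> I" "M \<subseteq> I" "I \<noteq> M" for I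
  proof (rule ccontr)
    assume "\<nexists>n. f ^ n \<in> I"
    hence "I \<in> \<A>" using I M(1) by (auto simp: \<A>_def)
    thus False using M(2) I(3,4) by blast
  qed
  thus ?thesis using M(1) by (intro that[of M]) (simp_all add: \<A>_def)
qed

text \<open>
  A maximal difference ideal of the tensor square meets the first factor trivially and together
  with it spans everything, so the second factor is mapped back to the first one.
\<close>

lemma automorphism_avoiding:
  assumes f: "f \<in> tensor_constants" and nil: "\<And>n. f ^ n \<notin> J"
  obtains \<theta> C where "ring_hom_on UNIV \<theta>" "\<And>r. \<theta> (tensor_left r) = r" "\<And>F. F \<in> J \<Longrightarrow> \<theta> F = 0"
    "\<And>s. s \<in> tensor_constants \<Longrightarrow> \<theta> s \<in> range c" "\<theta> f \<noteq> 0"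
    "ring_automorphism (\<lambda>x. \<theta> (tensor_right x))" "\<And>k. k \<in> \<kappa> \<Longrightarrow> \<theta> (tensor_right k) = k"
    "\<And>x. \<theta> (tensor_right (\<Phi> x)) = \<Phi> (\<theta> (tensor_right x))"
    "map_matrix (\<lambda>x. \<theta> (tensor_right x)) U = U ** map_matrix c C"
proof -
  obtain M where M: "ring_ideal M" "\<Psi> ` M \<subseteq> M" "J \<subseteq> M" "\<And>n. f ^ n \<notin> M"
    "\<And>I. ring_ideal I \<Longrightarrow> \<Psi> ` I \<subseteq> I \<Longrightarrow> M \<subseteq> I \<Longrightarrow> I \<noteq> M \<Longrightarrow> \<exists>n. f ^ n \<in> I"
    by (rule maximal_stable_ideal_exists[OF nil]) (rule that; (assumption | simp))
  note Mi = ring_idealD[OF M(1)] and hc = homc and cm = c_mem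
  interpret maximal_difference_ideal tensor_base \<Psi> "\<lambda>z. tensor_left (c z)" tensor_monomials M f
  proof
    show "ring_hom_on UNIV (\<lambda>z. tensor_left (c z))"
      by (simp add: ring_hom_on_def tl ring_hom_onD[OF homc])
    show "tensor.kspan (tensor_monomials \<union> M) = UNIV"
    proof -
      have "tensor.kspan (tensor_monomials \<union> J) \<subseteq> tensor.kspan (tensor_monomials \<union> M)"
        by (rule tensor.kspan_mono) (use M(3) in blast)
      thus ?thesis using tensor_kspan by blast
    qed
    show "countable tensor_monomials"
      unfolding tensor_monomials_def using countable_monomials by (intro countable_image) auto
    show "k \<in> range (\<lambda>z. tensor_left (c z))" if k: "k \<in> tensor_base" "\<Psi> k = k" for k
    proof -
      obtain l where l: "k = tensor_left l" "l \<in> \<kappa>" using k(1) by (auto simp: tensor_base_def)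
      hence "\<Phi> l = l" using k(2) tensor_map_hom(2)[OF hom\<Phi>] by (auto intro: tensor_left_inj)
      thus ?thesis using fixed_mem l by blast
    qed
    show "\<Psi> k \<in> tensor_base" if "k \<in> tensor_base" for k
      using that \<Phi>_mem by (auto simp: tensor_base_def tensor_map_hom(2)[OF hom\<Phi>])
    show "\<exists>n. f ^ n \<in> I" if "ring_ideal I" "\<Psi> ` I \<subseteq> I" "M \<subseteq> I" "I \<noteq> M" for I
      using M(5) that .
    show "\<Psi> x \<in> M" if "x \<in> M" for x using M(2) that by blast
    show "\<Psi> f - f \<in> M" using f M(3) by (auto simp: tensor_constants_def)
  qed (simp_all add: hom\<Psi> tensor_base_def c_mem tensor_map_hom(2)[OF hom\<Phi>] c_fixed M)
  have const: "\<exists>z. s - tensor_left (c z) \<in> M" if "s \<in> tensor_constants" for s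
    using that M(3) by (intro const_eq_complex) (auto simp: tensor_constants_def)
  \<comment> \<open>The trace of \<open>M\<close> on the first factor is a
    \<open>\<Phi>\<close>-stable ideal without 1, hence zero by simplicity.\<close>
  have inter: "r = 0" if "tensor_left r \<in> M" for r
  proof -
    define I where "I = {r. tensor_left r \<in> M}"
    have "ring_ideal I" unfolding I_def ring_ideal_def using Mi by (auto simp: tl)
    moreover have "\<Phi> ` I \<subseteq> I"
      using M(2) by (auto simp: I_def tensor_map_hom(2)[OF hom\<Phi>, symmetric])
    moreover have "1 \<notin> I" using M(4)[of 0] by (simp add: I_def tl)
    ultimately have "I = {0}" using simple[of I] by blast
    thus ?thesis using that by (auto simp: I_def)
  qed
  \<comment> \<open>By the torsor property only constants have to be treated, and these are complex
    numbers modulo \<open>M\<close>.\<close>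
  have ex: "\<exists>r. F - tensor_left r \<in> M" for F
    using constant_span_UNIV[of F]
  proof induction
    case (ideal F)
    thus ?case using M(3) by (intro exI[of _ 0]) (auto simp: tl)
  next
    case (step s F q)
    obtain r z where rz: "F - tensor_left r \<in> M" "s - tensor_left (c z) \<in> M"
      using step const by blast
    have "tensor_left q * s + F - tensor_left (q * c z + r) =
      tensor_left q * (s - tensor_left (c z)) + (F - tensor_left r)"
      by (simp add: tl algebra_simps)
    thus ?case using Mi(2)[OF Mi(3)[OF rz(2)] rz(1)] by metis
  qed
  define \<theta> where "\<theta> F = (SOME r. F - tensor_left r \<in> M)" for F
  have \<theta>: "F - tensor_left (\<theta> F) \<in> M" for F
    unfolding \<theta>_def using ex[of F] by (rule someI_ex)
  have eq: "\<theta> F = r" if "F - tensor_left r \<in> M" for F r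
  proof -
    have "(F - tensor_left r) - (F - tensor_left (\<theta> F)) = tensor_left (\<theta> F - r)" by (simp add: tl)
    hence "\<theta> F - r = 0" using inter Mi(6)[OF that \<theta>[of F]] by metis
    thus ?thesis by simp
  qed
  have hom\<theta>: "ring_hom_on UNIV \<theta>"
    unfolding ring_hom_on_def
  proof (intro conjI ballI)
    show "\<theta> 1 = 1" by (rule eq) (simp add: tl Mi)
    fix F G
    have "F + G - tensor_left (\<theta> F + \<theta> G) = (F - tensor_left (\<theta> F)) + (G - tensor_left (\<theta> G))"
      by (simp add: tl)
    also have "\<dots> \<in> M" by (intro Mi(2) \<theta>)
    finally show "\<theta> (F + G) = \<theta> F + \<theta> G" by (rule eq)
    have "F * G - tensor_left (\<theta> F * \<theta> G) = (F - tensor_left (\<theta> F)) * G + tensor_left (\<theta> F) * (G - tensor_left (\<theta> G))"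
      by (simp add: tl algebra_simps)
    also have "\<dots> \<in> M" by (intro Mi(2) Mi(3)[OF \<theta>] Mi(4)[OF \<theta>])
    finally show "\<theta> (F * G) = \<theta> F * \<theta> G" by (rule eq)
  qed
  note h\<theta> = ring_hom_onD[OF hom\<theta>]
  have left: "\<theta> (tensor_left r) = r" for r by (rule eq) (simp add: Mi)
  have zero: "\<theta> F = 0" if "F \<in> M" for F by (rule eq) (simp add: tl that)
  have stable: "\<theta> (\<Psi> F) = \<Phi> (\<theta> F)" for F
  proof (rule eq)
    have "\<Psi> (F - tensor_left (\<theta> F)) \<in> M" using \<theta> M(2) by blast
    thus "\<Psi> F - tensor_left (\<Phi> (\<theta> F)) \<in> M"
      by (simp add: ring_hom_onD[OF hom\<Psi>] tensor_map_hom(2)[OF hom\<Phi>])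
  qed
  define \<sigma> where "\<sigma> = (\<lambda>x. \<theta> (tensor_right x))"
  have hom\<sigma>: "ring_hom_on UNIV \<sigma>"
    unfolding ring_hom_on_def
  proof (intro conjI ballI)
    show "\<sigma> 1 = 1" by (simp add: \<sigma>_def tensor_right_1 h\<theta>)
    fix x y
    have "\<theta> (tensor_right (x + y) - (tensor_right x + tensor_right y)) = 0"
      using zero tensor_ideal_right_add M(3) by blast
    thus "\<sigma> (x + y) = \<sigma> x + \<sigma> y" by (simp add: \<sigma>_def h\<theta>)
    show "\<sigma> (x * y) = \<sigma> x * \<sigma> y" by (simp add: \<sigma>_def tensor_right_mult h\<theta>)
  qed
  note h\<sigma> = ring_hom_onD[OF hom\<sigma>]
  have \<sigma>\<kappa>: "\<sigma> k = k" if "k \<in> \<kappa>" for k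
  proof -
    have "\<theta> (tensor_right (k * 1) - tensor_left k * tensor_right 1) = 0"
      using zero tensor_ideal_right_scale[OF that] M(3) by blast
    thus ?thesis by (simp add: \<sigma>_def h\<theta> left tensor_right_1)
  qed
  have \<sigma>\<Phi>: "\<sigma> (\<Phi> x) = \<Phi> (\<sigma> x)" for x
    using stable[of "tensor_right x"] by (simp add: \<sigma>_def tensor_map_hom(3)[OF hom\<Phi>])
  have constc: "\<theta> s \<in> range c" if "s \<in> tensor_constants" for s
  proof -
    obtain z where "s - tensor_left (c z) \<in> M" using const[OF \<open>s \<in> tensor_constants\<close>] by blast
    hence "\<theta> s = c z" by (rule eq)
    thus ?thesis by simp
  qed
  have "\<forall>i j. \<exists>z. \<theta> (Z i j) = c z" using constc[OF Z_const] by blast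
  then obtain g where g: "\<And>i j. \<theta> (Z i j) = c (g i j)" by metis
  define C where "C = (\<chi> i j. g i j)"
  have \<sigma>U: "map_matrix \<sigma> U = U ** map_matrix c C"
    unfolding vec_eq_iff
    by (simp add: map_matrix_def matrix_matrix_mult_def \<sigma>_def right_U ring_hom_on_sum[OF hom\<theta>] h\<theta> left C_def g)
  have inj: "inj \<sigma>"
  proof -
    define I where "I = {x. \<sigma> x = 0}"
    have "ring_ideal I" unfolding I_def ring_ideal_def by (auto simp: h\<sigma>)
    moreover have "\<Phi> ` I \<subseteq> I" by (auto simp: I_def \<sigma>\<Phi> ring_hom_onD[OF hom\<Phi>])
    moreover have "1 \<notin> I" by (simp add: I_def h\<sigma>)
    ultimately have "I = {0}" using simple[of I] by blast
    hence "\<sigma> x = 0 \<Longrightarrow> x = 0" for x by (auto simp: I_def)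
    thus ?thesis using h\<sigma>(6) by (metis injI right_minus_eq)
  qed
  have \<sigma>d: "\<sigma> d * (det U * c (det C)) = 1"
  proof -
    have "\<sigma> (det U) = det U * c (det C)"
      using det_map_matrix[OF hom\<sigma>, of U] det_map_matrix[OF hc, of C] by (simp add: \<sigma>U det_mul)
    moreover have "\<sigma> d * \<sigma> (det U) = 1" using d_det h\<sigma>(1,3) by metis
    ultimately show ?thesis by simp
  qed
  have "det C \<noteq> 0" using \<sigma>d ring_hom_onD(4)[OF hc] by auto
  then obtain C' where "C ** C' = mat 1" using invertible_det_nz invertible_def by metis
  hence CC': "map_matrix c C ** map_matrix c C' = mat 1"
    using map_matrix_mult[OF hc] map_matrix_mat_1[OF hc] by metis
  \<comment> \<open>Inverting \<open>C\<close> writes the entries of \<open>U\<close> through those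
    of \<open>map_matrix \<sigma> U\<close>; as \<open>\<sigma>\<close> fixes complex constants, the
    generators lie in its range.\<close>
  have U_eq: "U = map_matrix \<sigma> U ** map_matrix c C'"
    by (simp add: \<sigma>U matrix_mul_assoc[symmetric] CC')
  have Urange: "U $ k $ j \<in> range \<sigma>" for k j
  proof -
    have "U $ k $ j = (map_matrix \<sigma> U ** map_matrix c C') $ k $ j" using U_eq by simp
    also have "\<dots> = \<sigma> (\<Sum>i\<in>UNIV. U $ k $ i * c (C' $ i $ j))"
      by (simp add: map_matrix_def matrix_matrix_mult_def ring_hom_on_sum[OF hom\<sigma>] h\<sigma> \<sigma>\<kappa> cm)
    finally show ?thesis by blast
  qed
  have "d = d * (\<sigma> d * (det U * c (det C)))" by (simp add: \<sigma>d)
  also have "\<dots> = (d * det U) * (\<sigma> d * c (det C))" by (simp only: mult_ac)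
  also have "\<dots> = \<sigma> (d * c (det C))" by (simp add: d_det h\<sigma> \<sigma>\<kappa> cm)
  finally have drange: "d \<in> range \<sigma>" by blast
  have "x \<in> range \<sigma>" if "x \<in> generated_subring (\<kappa> \<union> {U $ i $ j | i j. True} \<union> {d})" for x
    using that
  proof induction
    case (gen x)
    then consider "x \<in> \<kappa>" | i j where "x = U $ i $ j" | "x = d" by blast
    thus ?case
    proof cases
      case 1
      thus ?thesis using rangeI[of \<sigma> x] \<sigma>\<kappa> by simp
    qed (use Urange drange in auto)
  next
    case one show ?case using rangeI[of \<sigma> 1] by (simp add: h\<sigma>(1))
  next
    case (add x y) thus ?case by (auto simp: h\<sigma>(2)[symmetric])
  next
    case (neg x) thus ?case by (auto simp: h\<sigma>(5)[symmetric])
  next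
    case (mult x y) thus ?case by (auto simp: h\<sigma>(3)[symmetric])
  qed
  hence "surj \<sigma>" unfolding generated by blast
  hence auto: "ring_automorphism \<sigma>" using inj hom\<sigma> by (simp add: ring_automorphism_def bij_def)
  have nz: "\<theta> f \<noteq> 0"
  proof
    assume "\<theta> f = 0"
    hence "f \<in> M" using \<theta>[of f] by (simp add: tl)
    thus False using M(4)[of 1] by simp
  qed
  have zeroJ: "\<theta> F = 0" if "F \<in> J" for F using zero[OF subsetD[OF M(3) that]] .
  show ?thesis
    by (rule that[OF hom\<theta> left zeroJ constc nz auto[unfolded \<sigma>_def] \<sigma>\<kappa>[unfolded \<sigma>_def]
      \<sigma>\<Phi>[unfolded \<sigma>_def] \<sigma>U[unfolded \<sigma>_def]])
qed

text \<open>Write \<open>P = 1 \<otimes> x - x \<otimes> 1\<close> as a sum of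
  \<open>r i \<otimes> 1\<close> times constants \<open>s i\<close> with the fewest summands. Then
  the \<open>r i\<close> are independent over the complex numbers. If \<open>x\<close> is not in
  \<open>\<kappa>\<close>, some \<open>s i\<close> is not nilpotent and survives under some
  \<open>\<theta>\<close>, which therefore does not kill \<open>P\<close>; but
  \<open>\<theta> P\<close> is \<open>\<sigma> x - x\<close>.\<close>

lemma fixed_mem_base:
  assumes inv: "\<And>\<sigma> C. ring_automorphism \<sigma> \<Longrightarrow> (\<And>k. k \<in> \<kappa> \<Longrightarrow> \<sigma> k = k) \<Longrightarrow> (\<And>y. \<sigma> (\<Phi> y) = \<Phi> (\<sigma> y)) \<Longrightarrow>
    map_matrix \<sigma> U = U ** map_matrix c C \<Longrightarrow> \<sigma> x = x"
  shows "x \<in> \<kappa>"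
proof (rule ccontr)
  assume x: "x \<notin> \<kappa>"
  define P where "P = tensor_right x - tensor_left x"
  define rep where "rep m \<longleftrightarrow> (\<exists>(I::nat set) r s. finite I \<and> card I = m \<and> s ` I \<subseteq> tensor_constants \<and>
    P - (\<Sum>i\<in>I. tensor_left (r i) * s i) \<in> J)" for m
  have "\<exists>m. rep m"
  proof -
    have "\<exists>(n::nat) r s. (\<forall>i<n. s i \<in> tensor_constants) \<and> F - (\<Sum>i<n. tensor_left (r i) * s i) \<in> J" for F
      using constant_span_UNIV[of F]
    proof induction
      case (ideal F)
      thus ?case by (intro exI[of _ 0]) auto
    next
      case (step t F q)
      then obtain n :: nat and r s where rs: "\<forall>i<n. s i \<in> tensor_constants"
        "F - (\<Sum>i<n. tensor_left (r i) * s i) \<in> J" by blast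
      have eq: "tensor_left q * t + F - (\<Sum>i<Suc n. tensor_left ((r(n := q)) i) * (s(n := t)) i) =
        F - (\<Sum>i<n. tensor_left (r i) * s i)" by simp
      have "\<forall>i<Suc n. (s(n := t)) i \<in> tensor_constants" using rs(1) step(1) by auto
      thus ?case using rs(2) unfolding eq[symmetric] by blast
    qed
    then obtain n :: nat and r s where "\<forall>i<n. s i \<in> tensor_constants"
      "P - (\<Sum>i<n. tensor_left (r i) * s i) \<in> J" by blast
    hence "rep n" unfolding rep_def by (intro exI[of _ "{..<n}"] exI[of _ r] exI[of _ s]) auto
    thus ?thesis by blast
  qed
  then obtain m where m: "rep m" "\<And>l. rep l \<Longrightarrow> m \<le> l" using ex_has_least_nat[of rep _ "\<lambda>m. m"] by blast
  then obtain I :: "nat set" and r s where I: "finite I" "card I = m"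
    "\<And>i. i \<in> I \<Longrightarrow> s i \<in> tensor_constants" "P - (\<Sum>i\<in>I. tensor_left (r i) * s i) \<in> J"
    unfolding rep_def by blast
  have indep: "z i = 0" if z: "(\<Sum>i\<in>I. r i * c (z i)) = 0" and i: "i \<in> I" for z i
  proof (rule ccontr)
    \<comment> \<open>A relation with \<open>z i \<noteq> 0\<close> expresses \<open>r i\<close>
      through the others; the \<open>s'\<close> absorb \<open>s i\<close>, leaving a shorter
      sum.\<close>
    assume zi: "z i \<noteq> 0"
    define s' where "s' j = s j - tensor_left (c (z j / z i)) * s i" for j
    have ri: "r i = - (\<Sum>j\<in>I - {i}. r j * c (z j / z i))"
    proof -
      have "0 = (\<Sum>j\<in>I. r j * c (z j)) * c (1 / z i)" using z by simp
      also have "\<dots> = (\<Sum>j\<in>I. r j * c (z j / z i))"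
        by (simp add: sum_distrib_right mult.assoc ring_hom_onD(3)[OF homc, symmetric])
      also have "\<dots> = r i * c (z i / z i) + (\<Sum>j\<in>I - {i}. r j * c (z j / z i))"
        using I(1) i by (rule sum.remove)
      finally show ?thesis using zi by (simp add: ring_hom_onD[OF homc] eq_neg_iff_add_eq_0)
    qed
    have "(\<Sum>j\<in>I. tensor_left (r j) * s j) = tensor_left (r i) * s i + (\<Sum>j\<in>I - {i}. tensor_left (r j) * s j)"
      using I(1) i by (rule sum.remove)
    also have "\<dots> = (\<Sum>j\<in>I - {i}. tensor_left (r j) * s' j)"
      by (simp add: ri tl ring_hom_on_sum[OF ring_hom_on_tensor_left] s'_def sum_distrib_right
          sum_subtractf right_diff_distrib mult.assoc)
    finally have "P - (\<Sum>j\<in>I - {i}. tensor_left (r j) * s' j) \<in> J" using I(4) by simp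
    moreover have "s' ` (I - {i}) \<subseteq> tensor_constants"
      using I(3) i by (auto simp: s'_def intro!: tensor_constants_diff tensor_constants_mult tensor_constants_c)
    ultimately have "rep (card (I - {i}))" unfolding rep_def using I(1) by blast
    hence "m \<le> card (I - {i})" by (rule m(2))
    thus False using I(1,2) i by (metis card_Diff1_less leD)
  qed
  \<comment> \<open>Otherwise \<open>P\<close> would be a sum of elements nilpotent modulo
    \<open>J\<close>, and \<open>x\<close> would lie in \<open>\<kappa>\<close>.\<close>
  have "\<exists>i\<in>I. \<forall>n. s i ^ n \<notin> J"
  proof (rule ccontr)
    assume "\<not> (\<exists>i\<in>I. \<forall>n. s i ^ n \<notin> J)"
    hence nil: "s i \<in> {F. \<exists>n. F ^ n \<in> J}" if "i \<in> I" for i using that by blast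
    note N = ring_ideal_nilradical[OF ring_ideal_tensor_ideal]
    have "(\<Sum>i\<in>I. tensor_left (r i) * s i) \<in> {F. \<exists>n. F ^ n \<in> J}"
      by (intro ring_ideal_sum[OF N] ring_idealD(3)[OF N] nil)
    moreover have "P - (\<Sum>i\<in>I. tensor_left (r i) * s i) \<in> {F. \<exists>n. F ^ n \<in> J}"
      using I(4) by (auto intro: exI[of _ 1])
    ultimately have "P \<in> {F. \<exists>n. F ^ n \<in> J}" using ring_idealD(2)[OF N] by fastforce
    then obtain n where "P ^ n \<in> J" by blast
    hence "x \<in> \<kappa>" unfolding P_def by (intro nilpotent_tensor_difference_mem[OF reduced char0])
    thus False using x by simp
  qed
  then obtain i where i: "i \<in> I" "\<And>n. s i ^ n \<notin> J" by blast
  obtain \<theta> C where \<theta>: "ring_hom_on UNIV \<theta>" "\<And>r. \<theta> (tensor_left r) = r" "\<And>F. F \<in> J \<Longrightarrow> \<theta> F = 0"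
    "\<And>s. s \<in> tensor_constants \<Longrightarrow> \<theta> s \<in> range c" "\<theta> (s i) \<noteq> 0"
    "ring_automorphism (\<lambda>x. \<theta> (tensor_right x))" "\<And>k. k \<in> \<kappa> \<Longrightarrow> \<theta> (tensor_right k) = k"
    "\<And>x. \<theta> (tensor_right (\<Phi> x)) = \<Phi> (\<theta> (tensor_right x))"
    "map_matrix (\<lambda>x. \<theta> (tensor_right x)) U = U ** map_matrix c C"
    by (rule automorphism_avoiding[OF I(3)[OF i(1)] i(2)]) (rule that; (assumption | simp))
  have "\<forall>j\<in>I. \<exists>z. \<theta> (s j) = c z" using \<theta>(4) I(3) by blast
  then obtain z where z: "\<And>j. j \<in> I \<Longrightarrow> \<theta> (s j) = c (z j)" by metis
  have "\<theta> (tensor_right x) = x" by (rule inv[OF \<theta>(6-9)])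
  hence "\<theta> P = 0" by (simp add: P_def ring_hom_onD[OF \<theta>(1)] \<theta>(2))
  moreover have "\<theta> (P - (\<Sum>i\<in>I. tensor_left (r i) * s i)) = 0" by (rule \<theta>(3)[OF I(4)])
  ultimately have "\<theta> (\<Sum>i\<in>I. tensor_left (r i) * s i) = 0" by (simp add: ring_hom_onD[OF \<theta>(1)])
  hence "(\<Sum>i\<in>I. r i * c (z i)) = 0"
    by (simp add: ring_hom_on_sum[OF \<theta>(1)] ring_hom_onD[OF \<theta>(1)] \<theta>(2) z)
  hence "z i = 0" using indep i(1) by blast
  thus False using \<theta>(5) z[OF i(1)] ring_hom_onD(4)[OF homc] by simp
qed

end

subsection \<open>Meromorphic functions whose orders are all even\<close>

text \<open>A Weierstrass product \<open>p\<close> with halved multiplicities makes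
  \<open>f / p\<^sup>2\<close> entire without zeros, and such a function has a square root on the
  plane. The product runs over a sequence of nonzero points, whence the infinitely many zeros and
  \<open>f 0 \<noteq> 0\<close>.\<close>

lemma entire_sqrt:
  assumes hol: "f holomorphic_on UNIV" and f0: "f 0 \<noteq> 0" and inf: "infinite {z. f z = 0}"
    and even: "\<And>z. even (zorder f z)"
  obtains g where "g holomorphic_on UNIV" "\<And>z. f z = (g z)\<^sup>2"
proof -
  define A where "A = {z. f z = 0}"
  have nolim: "\<not> x islimpt B" if "B \<subseteq> A" for x B
  proof
    assume "x islimpt B"
    hence "x islimpt A" using that by (rule islimpt_subset)
    hence "f 0 = 0"
      by (intro analytic_continuation[OF hol open_UNIV connected_UNIV subset_UNIV UNIV_I, of x A 0])
         (auto simp: A_def)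
    thus False using f0 by simp
  qed
  have "closed A" using nolim[of A] by (auto simp: closed_limpt)
  have fin: "finite (A \<inter> cball 0 r)" for r
  proof (rule ccontr)
    assume "infinite (A \<inter> cball 0 r)"
    then obtain x where "x islimpt (A \<inter> cball 0 r)"
      using compact_cball[of 0 r] unfolding compact_eq_Bolzano_Weierstrass by blast
    thus False using nolim by blast
  qed
  have freq: "\<exists>\<^sub>F w in at z. f w \<noteq> 0" for z
  proof -
    have "eventually (\<lambda>w. w \<notin> A) (at z)" using nolim[of A z] by (simp add: islimpt_iff_eventually)
    thus ?thesis by (intro eventually_frequently) (auto simp: A_def)
  qed
  define m where "m z = nat (zorder f z) div 2" for z
  have zA: "zorder f z = int (2 * m z)" "m z > 0" if "z \<in> A" for z
  proof -
    have "zorder f z > 0"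
      using zorder_pos_iff[OF hol open_UNIV UNIV_I freq, of z] that by (simp add: A_def)
    moreover obtain k where "zorder f z = 2 * k" using even[of z] by blast
    ultimately show "zorder f z = int (2 * m z)" "m z > 0" by (auto simp: m_def nat_mult_distrib)
  qed
  have "\<exists>a :: nat \<Rightarrow> complex. range a = A \<and> filterlim a at_infinity at_top \<and>
    (\<forall>z\<in>A. finite (a -` {z}) \<and> card (a -` {z}) = m z)"
  proof (rule sequence_of_sparse_set_exists'[of A m])
    show "infinite A" using inf by (simp add: A_def)
    fix a :: "nat \<Rightarrow> complex" assume "range a = A" "filterlim a at_infinity at_top"
      "\<And>z. z \<in> A \<Longrightarrow> finite (a -` {z}) \<and> card (a -` {z}) = m z"
    thus "\<exists>a :: nat \<Rightarrow> complex. range a = A \<and> filterlim a at_infinity at_top \<and>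
      (\<forall>z\<in>A. finite (a -` {z}) \<and> card (a -` {z}) = m z)"
      by (intro exI[of _ a]) simp
  qed (use \<open>closed A\<close> fin zA(2) in auto)
  then obtain a :: "nat \<Rightarrow> complex" where a: "range a = A" "filterlim a at_infinity at_top"
    "\<And>z. z \<in> A \<Longrightarrow> finite (a -` {z}) \<and> card (a -` {z}) = m z" by blast
  interpret W: weierstrass_product' a
  proof
    show "a n \<noteq> 0" for n using rangeI[of a n] a(1) f0 by (auto simp: A_def)
    show "finite (a -` {z})" if "z \<in> range a" for z using a(1,3) that by blast
  qed (rule a(2))
  define p where "p = W.f"
  have p: "p holomorphic_on UNIV" "\<And>z. p z = 0 \<longleftrightarrow> z \<in> A" "\<And>z. zorder p z = int (card (a -` {z}))"
    unfolding p_def using W.holomorphic W.zero W.zorder a(1) by auto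
  have an: "p analytic_on {z}" "f analytic_on {z}" for z
    using p(1) hol by (auto simp: analytic_at)
  obtain h where h: "h holomorphic_on UNIV" "\<And>z. z \<in> UNIV \<Longrightarrow> h z \<noteq> 0" "\<And>z. z \<in> UNIV \<Longrightarrow> f z = h z * (p z * p z)"
  proof (rule holomorphic_zorder_factorization[OF hol open_UNIV connected_UNIV, of "\<lambda>z. p z * p z"])
    show "(\<lambda>z. p z * p z) holomorphic_on UNIV" by (intro holomorphic_intros p)
    show "p z * p z = 0 \<longleftrightarrow> f z = 0" for z by (simp add: p A_def)
    show "zorder (\<lambda>z. p z * p z) z = zorder f z" for z
    proof (cases "z \<in> A")
      case True
      have "eventually (\<lambda>w. p w * p w \<noteq> 0) (at z)"
        using nolim[of A z] by (simp add: islimpt_iff_eventually p)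
      hence "zorder (\<lambda>z. p z * p z) z = zorder p z + zorder p z"
        by (intro zorder_times_analytic an)
      thus ?thesis using True a(3) zA(1) p(3) by simp
    next
      case False
      have "zorder (\<lambda>z. p z * p z) z = 0"
        using False by (intro zorder_eq_0I analytic_intros an) (simp add: p)
      moreover have "zorder f z = 0" using False by (intro zorder_eq_0I an) (simp add: A_def)
      ultimately show ?thesis by simp
    qed
  qed blast
  obtain s where s: "s holomorphic_on UNIV" "\<And>z. z \<in> UNIV \<Longrightarrow> h z = (s z)\<^sup>2"
    by (rule contractible_imp_holomorphic_sqrt[OF h(1) contractible_UNIV h(2)]) auto
  show ?thesis
  proof (rule that[of "\<lambda>z. s z * p z"])
    show "(\<lambda>z. s z * p z) holomorphic_on UNIV" by (intro holomorphic_intros s p)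
    show "f z = (s z * p z)\<^sup>2" for z using h(3)[of z] s(2)[of z] by (simp add: power2_eq_square)
  qed
qed

lemma infinite_cos_zeros: "infinite {z::complex. cos z = 0}"
proof
  assume "finite {z::complex. cos z = 0}"
  moreover have "range (\<lambda>n::nat. of_real (real n * pi + pi / 2) :: complex) \<subseteq> {z. cos z = 0}"
  proof
    fix z :: complex assume "z \<in> range (\<lambda>n::nat. of_real (real n * pi + pi / 2) :: complex)"
    then obtain n :: nat where z: "z = of_real (real n * pi + pi / 2)" by blast
    have "cos (real n * pi + pi / 2) = 0" by (simp add: cos_add)
    thus "z \<in> {z. cos z = 0}" unfolding z mem_Collect_eq cos_of_real by simp
  qed
  ultimately have "finite (range (\<lambda>n::nat. of_real (real n * pi + pi / 2) :: complex))"
    by (rule finite_subset[rotated])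
  moreover have "inj (\<lambda>n::nat. of_real (real n * pi + pi / 2) :: complex)"
    by (rule injI) simp
  ultimately show False using finite_imageD by blast
qed

lemma eventually_cos_nonzero: "eventually (\<lambda>w::complex. cos w \<noteq> 0) (at z)"
proof -
  have "cos holomorphic_on (UNIV :: complex set)" by (intro holomorphic_intros)
  from non_zero_neighbour_alt[OF this open_UNIV connected_UNIV, of z 0] show ?thesis by simp
qed

text \<open>Multiplying by the square of the cosine provides the infinitely many zeros \<open>entire_sqrt\<close> asks for.\<close>

lemma entire_sqrt_cos:
  assumes hol: "f holomorphic_on UNIV" and f0: "f 0 \<noteq> 0" and even: "\<And>z. even (zorder f z)"
  obtains g where "g holomorphic_on UNIV" "\<And>z. f z * (cos z)\<^sup>2 = (g z)\<^sup>2"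
proof (rule entire_sqrt[of "\<lambda>z. f z * (cos z)\<^sup>2"])
  show "(\<lambda>z. f z * (cos z)\<^sup>2) holomorphic_on UNIV" by (intro holomorphic_intros hol)
  show "f 0 * (cos 0)\<^sup>2 \<noteq> 0" using f0 by simp
  show "infinite {z. f z * (cos z)\<^sup>2 = 0}"
    using infinite_cos_zeros by (rule contrapos_nn) (auto elim: finite_subset[rotated])
  show "even (zorder (\<lambda>z. f z * (cos z)\<^sup>2) z)" for z
  proof -
    have "f analytic_on {z}" "cos analytic_on {z}"
      using hol by (auto simp: analytic_at intro!: holomorphic_intros)
    moreover have "eventually (\<lambda>w. f w \<noteq> 0) (at z)"
      using non_zero_neighbour_alt[OF hol open_UNIV connected_UNIV UNIV_I UNIV_I f0] by auto
    hence "eventually (\<lambda>w. f w * (cos w * cos w) \<noteq> 0) (at z)"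
      using eventually_cos_nonzero[of z] by eventually_elim auto
    moreover have "eventually (\<lambda>w. cos w * cos w \<noteq> 0) (at z)"
      using eventually_cos_nonzero[of z] by eventually_elim auto
    ultimately have "zorder (\<lambda>z. f z * (cos z * cos z)) z = zorder f z + (zorder cos z + zorder cos z)"
      by (simp add: zorder_times_analytic analytic_on_mult)
    thus ?thesis using even[of z] by (simp add: power2_eq_square)
  qed
qed (use that in blast)

text \<open>In \<open>h * f1 / f2\<close> the entire functions \<open>f1\<close> and
  \<open>f2\<close> carry the zeros and the poles, so their orders are even as well and each part
  gets its own root.\<close>

lemma mero_of_nonvanishing_sqrt:
  assumes f0: "eval_mero f 0 \<noteq> 0" and even: "\<And>z. even (zorder (eval_mero f) z)"
  shows "\<exists>g. g * g = f"
proof -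
  have nopole: "\<not> is_pole (eval_mero f) 0"
    using is_pole_zero_at_nicely_mero[OF nicely_eval_mero[of f]] f0 by auto
  obtain h f1 f2 where w: "h holomorphic_on UNIV" "f1 holomorphic_on UNIV" "f2 holomorphic_on UNIV"
    "\<forall>z. f1 z = 0 \<longleftrightarrow> \<not>is_pole (eval_mero f) z \<and> eval_mero f z = 0"
    "\<forall>z. f2 z = 0 \<longleftrightarrow> is_pole (eval_mero f) z"
    "\<forall>z. \<not>is_pole (eval_mero f) z \<longrightarrow> zorder f1 z = zorder (eval_mero f) z"
    "\<forall>z. is_pole (eval_mero f) z \<longrightarrow> zorder f2 z = - zorder (eval_mero f) z"
    "\<forall>z. h z \<noteq> 0" "\<forall>z. eval_mero f z = h z * f1 z / f2 z"
    by (rule weierstrass_factorization_meromorphic_UNIV[OF nicely_eval_mero])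
  have an: "f1 analytic_on {z}" "f2 analytic_on {z}" for z
    using w by (auto simp: analytic_at)
  have ev1: "even (zorder f1 z)" for z
    using w(4,6) even[of z] zorder_eq_0I[OF an(1), of z] by (cases "is_pole (eval_mero f) z") auto
  have nz1: "f1 0 \<noteq> 0" using w(4) f0 by auto
  obtain g1 where g1: "g1 holomorphic_on UNIV" "\<And>z. f1 z * (cos z)\<^sup>2 = (g1 z)\<^sup>2"
    by (rule entire_sqrt_cos[OF w(2) nz1 ev1]) (rule that; (assumption | simp))
  have ev2: "even (zorder f2 z)" for z
    using w(5,7) even[of z] zorder_eq_0I[OF an(2), of z] by (cases "is_pole (eval_mero f) z") auto
  have nz2: "f2 0 \<noteq> 0" using w(5) nopole by auto
  obtain g2 where g2: "g2 holomorphic_on UNIV" "\<And>z. f2 z * (cos z)\<^sup>2 = (g2 z)\<^sup>2"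
    by (rule entire_sqrt_cos[OF w(3) nz2 ev2]) (rule that; (assumption | simp))
  obtain s where s: "s holomorphic_on UNIV" "\<And>z. z \<in> UNIV \<Longrightarrow> h z = (s z)\<^sup>2"
    by (rule contractible_imp_holomorphic_sqrt[OF w(1) contractible_UNIV]) (use w(8) that in auto)
  have an: "F analytic_on UNIV" if "F holomorphic_on UNIV" for F :: "complex \<Rightarrow> complex"
    using that by (simp add: analytic_on_open)
  \<comment> \<open>\<open>g1\<close> and \<open>g2\<close> are roots of \<open>f1\<close> and
    \<open>f2\<close> times the same squared cosine, which cancels in the quotient.\<close>
  have mer: "(\<lambda>z. s z * g1 z / g2 z) meromorphic_on UNIV"
    using an[OF s(1)] an[OF g1(1)] an[OF g2(1)]
    by (intro meromorphic_intros) (auto intro: analytic_on_imp_meromorphic_on)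
  define g where "g = mero_of (\<lambda>z. s z * g1 z / g2 z)"
  have "g * g = f"
  proof (rule mero_eqI)
    fix z
    show "eventually (\<lambda>w. eval_mero (g * g) w = eval_mero f w) (at z)"
      using mero_ops_ev(6)[of g g z] eventually_eval_mero_of[OF mer, of z] eventually_cos_nonzero[of z]
    proof eventually_elim
      case (elim w)
      have "eval_mero (g * g) w = (s w)\<^sup>2 * (g1 w)\<^sup>2 / (g2 w)\<^sup>2"
        using elim by (simp add: g_def power2_eq_square)
      also have "\<dots> = h w * (f1 w * (cos w)\<^sup>2) / (f2 w * (cos w)\<^sup>2)"
        using s(2)[of w] g1(2)[of w] g2(2)[of w] by simp
      also have "\<dots> = eval_mero f w" using elim w(9) by simp
      finally show ?case .
    qed
  qed
  thus ?thesis by blast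
qed

subsection \<open>The difference field of elliptic functions\<close>

lemma eval_mero_eqI: "(\<And>z. eval_mero f z = eval_mero g z) \<Longrightarrow> f = g"
  by (simp add: eval_mero_inject[symmetric] fun_eq_iff)

lemma shift_shift_mero: "shift_mero h (shift_mero k f) = shift_mero (h + k) f"
  by (rule eval_mero_eqI) (simp add: eval_shift_mero add_ac)

lemma shift_mero_0 [simp]: "shift_mero 0 f = f"
  by (rule eval_mero_eqI) (simp add: eval_shift_mero)

lemma shift_const_mero [simp]: "shift_mero h (const_mero z) = const_mero z"
  by (rule eval_mero_eqI) (simp add: eval_shift_mero eval_const_mero)

lemma eventually_at_shift:
  fixes z h :: complex
  assumes "eventually P (at (z + h))"
  shows "eventually (\<lambda>w. P (w + h)) (at z)"
proof -
  have "filtermap (\<lambda>z. z + h) (at z) = at (z + h)"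
    using filtermap_at_shift[of "- h" z] by simp
  hence "eventually P (filtermap (\<lambda>z. z + h) (at z))" using assms by simp
  thus ?thesis by (simp add: eventually_filtermap)
qed

lemma ring_hom_on_shift_mero: "ring_hom_on UNIV (shift_mero h)"
  unfolding ring_hom_on_def
proof (intro conjI ballI)
  show "shift_mero h 1 = 1"
  proof (rule mero_eqI)
    show "eventually (\<lambda>w. eval_mero (shift_mero h 1) w = eval_mero 1 w) (at z)" for z
      using eventually_at_shift[OF mero_ops_ev(2)[of "z + h"]] mero_ops_ev(2)[of z]
      by eventually_elim (simp add: eval_shift_mero)
  qed
  fix f g
  show "shift_mero h (f + g) = shift_mero h f + shift_mero h g"
  proof (rule mero_eqI)
    show "eventually (\<lambda>w. eval_mero (shift_mero h (f + g)) w = eval_mero (shift_mero h f + shift_mero h g) w) (at z)" for z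
      using eventually_at_shift[OF mero_ops_ev(3)[of f g "z + h"]] mero_ops_ev(3)[of "shift_mero h f" "shift_mero h g" z]
      by eventually_elim (simp add: eval_shift_mero)
  qed
  show "shift_mero h (f * g) = shift_mero h f * shift_mero h g"
  proof (rule mero_eqI)
    show "eventually (\<lambda>w. eval_mero (shift_mero h (f * g)) w = eval_mero (shift_mero h f * shift_mero h g) w) (at z)" for z
      using eventually_at_shift[OF mero_ops_ev(6)[of f g "z + h"]] mero_ops_ev(6)[of "shift_mero h f" "shift_mero h g" z]
      by eventually_elim (simp add: eval_shift_mero)
  qed
qed

lemmas shift_mero_simps = ring_hom_onD[OF ring_hom_on_shift_mero]

lemma shift_mero_eq_iff: "shift_mero h f = shift_mero h g \<longleftrightarrow> f = g"
  by (rule ring_hom_on_inj[OF ring_hom_on_shift_mero])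

lemma shift_mero_inverse: "shift_mero h (inverse f) = inverse (shift_mero h f)"
proof (cases "f = 0")
  case False
  have "shift_mero h f * shift_mero h (inverse f) = shift_mero h (f * inverse f)"
    by (simp only: shift_mero_simps(3))
  also have "\<dots> = 1" using False by (simp add: shift_mero_simps(1))
  finally have "shift_mero h f * shift_mero h (inverse f) = 1" .
  thus ?thesis by (metis inverse_unique)
qed (simp add: shift_mero_simps)

lemma shift_mero_divide: "shift_mero h (f / g) = shift_mero h f / shift_mero h g"
  by (simp add: divide_inverse shift_mero_simps shift_mero_inverse)

lemma ring_hom_on_const_mero: "ring_hom_on UNIV const_mero"
  unfolding ring_hom_on_def
proof (intro conjI ballI)
  show "const_mero 1 = 1" by (simp add: const_mero_def one_mero_def)
  fix x y
  show "const_mero (x + y) = const_mero x + const_mero y"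
    by (simp add: plus_mero_def eval_const_mero) (simp add: const_mero_def)
  show "const_mero (x * y) = const_mero x * const_mero y"
    by (simp add: times_mero_def eval_const_mero) (simp add: const_mero_def)
qed

section \<open>Periods and the field \<open>K_elliptic\<close>\<close>

lemma M_periodic_iff: "f \<in> M_periodic L \<longleftrightarrow> (\<forall>w\<in>L. shift_mero w f = f)"
  unfolding M_periodic_def by (auto simp: eval_mero_inject[symmetric] fun_eq_iff eval_shift_mero)

lemma M_periodic_closed:
  assumes "f \<in> M_periodic L" "g \<in> M_periodic L"
  shows "f + g \<in> M_periodic L" "f * g \<in> M_periodic L" "- f \<in> M_periodic L" "inverse f \<in> M_periodic L"
    "f - g \<in> M_periodic L" "f / g \<in> M_periodic L" "shift_mero h f \<in> M_periodic L"
  using assms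
  by (auto simp: M_periodic_iff shift_mero_simps shift_mero_inverse shift_mero_divide shift_shift_mero)
     (metis add.commute shift_shift_mero)

lemma period_lattice_closed:
  assumes "v \<in> period_lattice \<tau>" "w \<in> period_lattice \<tau>"
  shows "v + w \<in> period_lattice \<tau>" "of_nat n * w \<in> period_lattice \<tau>"
proof -
  obtain m n m' n' where vw: "v = of_int m + of_int n * \<tau>" "w = of_int m' + of_int n' * \<tau>"
    using assms by (auto simp: period_lattice_def)
  have "v + w = of_int (m + m') + of_int (n + n') * \<tau>" by (simp add: vw algebra_simps)
  thus "v + w \<in> period_lattice \<tau>" unfolding period_lattice_def by blast
  have "of_nat k * w = of_int (int k * m') + of_int (int k * n') * \<tau>" for k by (simp add: vw algebra_simps)
  thus "of_nat n * w \<in> period_lattice \<tau>" for n unfolding period_lattice_def by blast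
qed

lemma scaled_lattice_mult:
  "scaled_lattice (k * l) \<tau> \<subseteq> scaled_lattice k \<tau>"
  using period_lattice_closed(2) by (force simp: scaled_lattice_def)

lemma M_periodic_mono: "L \<subseteq> L' \<Longrightarrow> M_periodic L' \<subseteq> M_periodic L"
  by (auto simp: M_periodic_def)

lemma M_periodic_period_lattice: "M_periodic (period_lattice \<tau>) \<subseteq> K_elliptic \<tau>"
  unfolding K_elliptic_def by (rule subsetI, rule UN_I[of 1]) (auto simp: scaled_lattice_def)

lemma M_periodic_scaled: "k \<ge> 1 \<Longrightarrow> M_periodic (scaled_lattice k \<tau>) \<subseteq> K_elliptic \<tau>"
  unfolding K_elliptic_def by auto

lemma K_elliptic_common:
  assumes "f \<in> K_elliptic \<tau>" "g \<in> K_elliptic \<tau>"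
  obtains k where "k \<ge> 1" "f \<in> M_periodic (scaled_lattice k \<tau>)" "g \<in> M_periodic (scaled_lattice k \<tau>)"
proof -
  obtain k l where kl: "k \<ge> 1" "l \<ge> 1" "f \<in> M_periodic (scaled_lattice k \<tau>)" "g \<in> M_periodic (scaled_lattice l \<tau>)"
    using assms by (auto simp: K_elliptic_def)
  show ?thesis
  proof (rule that[of "k * l"])
    show "k * l \<ge> 1" using kl by simp
    show "f \<in> M_periodic (scaled_lattice (k * l) \<tau>)"
      using kl M_periodic_mono[OF scaled_lattice_mult] by blast
    show "g \<in> M_periodic (scaled_lattice (k * l) \<tau>)"
      using kl M_periodic_mono[OF scaled_lattice_mult[of l k]] by (auto simp: mult.commute)
  qed
qed

lemma K_elliptic_closed:
  assumes "f \<in> K_elliptic \<tau>" "g \<in> K_elliptic \<tau>"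
  shows "f + g \<in> K_elliptic \<tau>" "f * g \<in> K_elliptic \<tau>" "- f \<in> K_elliptic \<tau>" "inverse f \<in> K_elliptic \<tau>"
    "f - g \<in> K_elliptic \<tau>" "f / g \<in> K_elliptic \<tau>"
proof -
  obtain k where k: "k \<ge> 1" "f \<in> M_periodic (scaled_lattice k \<tau>)" "g \<in> M_periodic (scaled_lattice k \<tau>)"
    using K_elliptic_common[OF assms] .
  note M = M_periodic_scaled[OF k(1), THEN subsetD]
  show "f + g \<in> K_elliptic \<tau>" "f * g \<in> K_elliptic \<tau>" "- f \<in> K_elliptic \<tau>" "inverse f \<in> K_elliptic \<tau>"
    "f - g \<in> K_elliptic \<tau>" "f / g \<in> K_elliptic \<tau>"
    using M_periodic_closed[OF k(2,3), THEN M] by blast+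
qed

lemma K_elliptic_const: "const_mero c \<in> K_elliptic \<tau>"
  by (rule subsetD[OF M_periodic_period_lattice]) (simp add: M_periodic_iff)

lemma K_elliptic_0_1: "0 \<in> K_elliptic \<tau>" "1 \<in> K_elliptic \<tau>"
  using K_elliptic_const[of 0] K_elliptic_const[of 1] ring_hom_onD(1,4)[OF ring_hom_on_const_mero] by metis+

lemma K_elliptic_shift: "f \<in> K_elliptic \<tau> \<Longrightarrow> shift_mero h f \<in> K_elliptic \<tau>"
  using M_periodic_closed(7) by (fastforce simp: K_elliptic_def)

text \<open>Modulo the scaled lattice, the multiples of \<open>h\<close> lie in a bounded
  parallelogram, so two of them come arbitrarily close. Their difference is not zero because no
  positive multiple of \<open>h\<close> is a lattice point.\<close>

lemma small_period_exists:
  assumes \<tau>: "Im \<tau> > 0" and h: "\<forall>n\<ge>1. of_nat n * h \<notin> period_lattice \<tau>" and k: "k \<ge> 1" and \<epsilon>: "\<epsilon> > 0"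
  obtains n w where "w \<in> scaled_lattice k \<tau>" "of_nat n * h + w \<noteq> 0" "norm (of_nat n * h + w) < \<epsilon>"
proof -
  \<comment> \<open>\<open>A n\<close> and \<open>B n\<close> are the real coordinates of
    \<open>of_nat n * h\<close> in the basis \<open>1, \<tau>\<close>; rounding
    \<open>A n / k\<close> and \<open>B n / k\<close> down gives the representative
    \<open>x n\<close> in the parallelogram.\<close>
  define B where "B n = Im (of_nat n * h) / Im \<tau>" for n :: nat
  define A where "A n = Re (of_nat n * h) - B n * Re \<tau>" for n :: nat
  have AB: "of_nat n * h = of_real (A n) + of_real (B n) * \<tau>" for n
    using \<tau> by (simp add: complex_eq_iff A_def B_def)
  define x where "x n = of_nat n * h - of_nat k * (of_int \<lfloor>A n / k\<rfloor> + of_int \<lfloor>B n / k\<rfloor> * \<tau>)" for n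
  have x_eq: "x n = of_real (k * frac (A n / k)) + of_real (k * frac (B n / k)) * \<tau>" for n
    unfolding x_def AB frac_def using k by (simp add: algebra_simps)
  have "norm (x n) \<le> k * (1 + norm \<tau>)" for n
  proof -
    have "norm (x n) \<le> norm (of_real (k * frac (A n / k)) :: complex) + norm (of_real (k * frac (B n / k)) * \<tau>)"
      unfolding x_eq by (rule norm_triangle_ineq)
    also have "\<dots> = k * frac (A n / k) + k * frac (B n / k) * norm \<tau>"
      by (simp add: norm_mult abs_mult)
    also have "\<dots> \<le> k * 1 + k * 1 * norm \<tau>"
    proof -
      have "real k * frac t \<le> real k * 1" for t :: real
        by (intro mult_left_mono) (auto intro: less_imp_le[OF frac_lt_1])
      thus ?thesis by (intro add_mono mult_right_mono) auto
    qed
    finally show ?thesis by (simp add: algebra_simps)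
  qed
  hence "bounded (range x)" by (auto simp: bounded_iff)
  then obtain l r where r: "strict_mono r" "(x \<circ> r) \<longlonglongrightarrow> l"
    using bounded_imp_convergent_subsequence by blast
  then obtain N where N: "\<And>i j. i \<ge> N \<Longrightarrow> j \<ge> N \<Longrightarrow> dist (x (r i)) (x (r j)) < \<epsilon>"
    using metric_CauchyD[OF LIMSEQ_imp_Cauchy[OF r(2)] \<epsilon>] by (auto simp: o_def)
  define i j n where "i = r N" and "j = r (Suc N)" and "n = r (Suc N) - r N"
  have "i < j" unfolding i_def j_def using r(1) by (simp add: strict_mono_def)
  hence n: "n \<ge> 1" "of_nat n = (of_nat j - of_nat i :: complex)" by (auto simp: n_def i_def j_def of_nat_diff)
  define u where "u = of_int (\<lfloor>A i / k\<rfloor> - \<lfloor>A j / k\<rfloor>) + of_int (\<lfloor>B i / k\<rfloor> - \<lfloor>B j / k\<rfloor>) * \<tau>"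
  have u: "u \<in> period_lattice \<tau>" unfolding u_def period_lattice_def by blast
  have eq: "of_nat n * h + of_nat k * u = x j - x i"
    by (simp add: n(2) u_def x_def algebra_simps)
  show ?thesis
  proof (rule that[of "of_nat k * u" n])
    show "of_nat k * u \<in> scaled_lattice k \<tau>" using u by (auto simp: scaled_lattice_def)
    show "norm (of_nat n * h + of_nat k * u) < \<epsilon>"
      unfolding eq using N[of "Suc N" N] by (simp add: dist_norm i_def j_def)
    show "of_nat n * h + of_nat k * u \<noteq> 0"
    proof
      assume "of_nat n * h + of_nat k * u = 0"
      moreover have "- 1 * u \<in> period_lattice \<tau>"
      proof -
        have "- 1 * u = of_int (\<lfloor>A j / k\<rfloor> - \<lfloor>A i / k\<rfloor>) + of_int (\<lfloor>B j / k\<rfloor> - \<lfloor>B i / k\<rfloor>) * \<tau>"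
          by (simp add: u_def algebra_simps)
        thus ?thesis unfolding period_lattice_def by blast
      qed
      hence "of_nat k * (- 1 * u) \<in> period_lattice \<tau>" by (rule period_lattice_closed(2)[OF u])
      moreover have "of_nat n * h \<notin> period_lattice \<tau>" using h n(1) by blast
      ultimately show False by (simp add: eq_neg_iff_add_eq_0[symmetric])
    qed
  qed
qed

text \<open>Small nonzero combinations of \<open>h\<close> and periods leave \<open>F\<close>
  invariant, so each value recurs arbitrarily near. The value type is arbitrary: \<open>F\<close>
  will be a meromorphic function or the parity of its order.\<close>

lemma frequently_same_value:
  assumes "Im \<tau> > 0" "\<forall>n\<ge>1. of_nat n * h \<notin> period_lattice \<tau>" "k \<ge> 1"
    and per: "\<And>z. F (z + h) = F z" "\<And>z w. w \<in> scaled_lattice k \<tau> \<Longrightarrow> F (z + w) = F z"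
  shows "\<exists>\<^sub>F w in at z. F w = F z"
  unfolding frequently_def
proof
  assume "eventually (\<lambda>w. \<not> F w = F z) (at z)"
  then obtain \<epsilon> where \<epsilon>: "\<epsilon> > 0" "\<And>w. w \<noteq> z \<Longrightarrow> dist w z < \<epsilon> \<Longrightarrow> F w \<noteq> F z"
    by (auto simp: eventually_at)
  obtain n w where w: "w \<in> scaled_lattice k \<tau>" "of_nat n * h + w \<noteq> 0" "norm (of_nat n * h + w) < \<epsilon>"
    using small_period_exists[OF assms(1-3) \<epsilon>(1)] .
  have "F (z + of_nat n * h) = F z" for n
  proof (induction n)
    case (Suc n)
    have "F (z + of_nat (Suc n) * h) = F (z + of_nat n * h + h)" by (simp add: algebra_simps)
    thus ?case using Suc per(1) by simp
  qed simp
  hence "F (z + of_nat n * h + w) = F z" using per(2)[OF w(1)] by simp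
  thus False using \<epsilon>(2)[of "z + of_nat n * h + w"] w(2,3) by (auto simp: dist_norm add.assoc)
qed

text \<open>The value at 0 recurs near 0, whereas a nonzero meromorphic function has isolated zeros.
  A pole at 0 does no harm: there the normal form has the value 0.\<close>

lemma K_elliptic_fixed:
  assumes "Im \<tau> > 0" "\<forall>n\<ge>1. of_nat n * h \<notin> period_lattice \<tau>"
    and f: "f \<in> K_elliptic \<tau>" "shift_mero h f = f"
  shows "f \<in> range const_mero"
proof -
  obtain k where k: "k \<ge> 1" "f \<in> M_periodic (scaled_lattice k \<tau>)"
    using f(1) by (auto simp: K_elliptic_def)
  define c where "c = eval_mero f 0"
  have "\<exists>\<^sub>F w in at 0. eval_mero f w = eval_mero f 0"
  proof (rule frequently_same_value[OF assms(1,2) k(1)])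
    show "eval_mero f (z + h) = eval_mero f z" for z using f(2) by (metis eval_shift_mero)
    show "eval_mero f (z + w) = eval_mero f z" if "w \<in> scaled_lattice k \<tau>" for z w
      using k(2) that by (auto simp: M_periodic_def)
  qed
  hence freq: "\<exists>\<^sub>F w in at 0. eval_mero f w = c" by (simp add: c_def)
  have "f - const_mero c = 0"
  proof (rule ccontr)
    assume "f - const_mero c \<noteq> 0"
    from mero_nonzero_ev[OF this] mero_ops_ev(4)[of f "const_mero c"]
    have "eventually (\<lambda>w. eval_mero f w \<noteq> c) (at 0)"
      by (rule eventually_elim2) (auto simp: eval_const_mero)
    with freq show False by (simp add: frequently_def)
  qed
  thus ?thesis by auto
qed

lemma zorder_mero_mult:
  assumes "f \<noteq> 0" "g \<noteq> 0"
  shows "zorder (eval_mero (f * g)) z = zorder (eval_mero f) z + zorder (eval_mero g) z"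
proof -
  have "zorder (eval_mero (f * g)) z = zorder (\<lambda>w. eval_mero f w * eval_mero g w) z"
    by (rule zorder_cong[OF mero_ops_ev(6) refl])
  also have "\<dots> = zorder (eval_mero f) z + zorder (eval_mero g) z"
    using assms by (intro zorder_mult meromorphic_eval_mero eventually_frequently mero_nonzero_ev) auto
  finally show ?thesis .
qed

lemma zorder_shift_mero: "zorder (eval_mero (shift_mero h f)) z = zorder (eval_mero f) (z + h)"
proof -
  have "zorder (eval_mero (shift_mero h f)) z = zorder (\<lambda>u. eval_mero f (u + z + h)) 0"
    unfolding zorder_shift[of _ z] by (simp add: eval_shift_mero)
  also have "\<dots> = zorder (eval_mero f) (z + h)"
    unfolding zorder_shift[of _ "z + h"] by (simp add: add.assoc)
  finally show ?thesis .
qed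

lemma eventually_zorder_mero:
  assumes "f \<noteq> 0"
  shows "eventually (\<lambda>w. zorder (eval_mero f) w = 0) (at z)"
proof -
  have "isolated_singularity_at (eval_mero f) z"
    using meromorphic_eval_mero[of f "{z}"] by (simp add: meromorphic_at_iff)
  then obtain r where r: "r > 0" "eval_mero f analytic_on ball z r - {z}"
    by (auto simp: isolated_singularity_at_def)
  have "eventually (\<lambda>w. w \<in> ball z r - {z}) (at z)"
    using r(1) by (intro eventually_at_in_open) auto
  with mero_nonzero_ev[OF assms, of z] show ?thesis
  proof eventually_elim
    case (elim w)
    have "eval_mero f analytic_on {w}" by (rule analytic_on_subset[OF r(2)]) (use elim in auto)
    thus ?case using elim by (intro zorder_eq_0I)
  qed
qed

text \<open>A translation moves a point where the normal form is nonzero, hence neither a zero nor a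
  pole, to the origin.\<close>

lemma mero_sqrt:
  assumes "f \<noteq> 0" and even: "\<And>z. even (zorder (eval_mero f) z)"
  shows "\<exists>g. g * g = f"
proof -
  have "\<exists>z0. eval_mero f z0 \<noteq> 0"
    using eventually_happens'[OF at_neq_bot mero_nonzero_ev[OF assms(1)]] by blast
  then obtain z0 where z0: "eval_mero f z0 \<noteq> 0" by blast
  have "\<exists>g. g * g = shift_mero z0 f"
    by (rule mero_of_nonvanishing_sqrt) (use z0 even in \<open>auto simp: eval_shift_mero zorder_shift_mero\<close>)
  then obtain g where "g * g = shift_mero z0 f" by blast
  hence "shift_mero (- z0) g * shift_mero (- z0) g = f"
    by (simp add: shift_mero_simps(3)[symmetric] shift_shift_mero)
  thus ?thesis by blast
qed

text \<open>
  The zeros and poles of odd order form a discrete set invariant under a non-discrete group of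
  translations, so there are none. Hence \<open>K\<close> has no quadratic difference field extension.
\<close>

lemma K_elliptic_sqrt:
  assumes "Im \<tau> > 0" "\<forall>n\<ge>1. of_nat n * h \<notin> period_lattice \<tau>"
    and f: "f \<in> K_elliptic \<tau>" "f \<noteq> 0" and g: "shift_mero h f = g * g * f"
  shows "\<exists>s\<in>K_elliptic \<tau>. s * s = f"
proof -
  obtain k where k: "k \<ge> 1" "f \<in> M_periodic (scaled_lattice k \<tau>)"
    using f(1) by (auto simp: K_elliptic_def)
  define F where "F z = even (zorder (eval_mero f) z)" for z
  have "g \<noteq> 0" using g f(2) shift_mero_eq_iff[of h f 0] by (auto simp: shift_mero_simps)
  have "F z" for z
  proof -
    have "\<exists>\<^sub>F w in at z. F w = F z"
    proof (rule frequently_same_value[OF assms(1,2) k(1)])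
      show "F (z + h) = F z" for z
        using \<open>g \<noteq> 0\<close> f(2) unfolding F_def zorder_shift_mero[symmetric] g
        by (simp add: zorder_mero_mult)
      show "F (z + w) = F z" if "w \<in> scaled_lattice k \<tau>" for z w
      proof -
        have "shift_mero w f = f" using k(2) that by (auto simp: M_periodic_iff)
        thus ?thesis unfolding F_def zorder_shift_mero[symmetric] by simp
      qed
    qed
    moreover have "eventually F (at z)"
      using eventually_zorder_mero[OF f(2)] by eventually_elim (simp add: F_def)
    ultimately have "\<exists>\<^sub>F w in at z. F w = F z \<and> F w" by (rule frequently_eventually_frequently)
    thus ?thesis using frequently_ex by blast
  qed
  then obtain s where s: "s * s = f" using mero_sqrt[OF f(2)] by (auto simp: F_def)
  \<comment> \<open>A period of \<open>f\<close> multiplies the root \<open>s\<close> by a sign, so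
    twice that period fixes \<open>s\<close>. Here it matters that \<open>K\<close> is the union
    over all scaled lattices.\<close>
  have "s \<in> M_periodic (scaled_lattice (k * 2) \<tau>)"
    unfolding M_periodic_iff
  proof
    fix w assume "w \<in> scaled_lattice (k * 2) \<tau>"
    then obtain u where u: "u \<in> period_lattice \<tau>" "w = of_nat (k * 2) * u" by (auto simp: scaled_lattice_def)
    define v where "v = of_nat k * u"
    have v: "v \<in> scaled_lattice k \<tau>" "w = v + v" using u by (auto simp: v_def scaled_lattice_def)
    have "shift_mero v s * shift_mero v s = s * s"
      using k(2) v(1) by (simp add: shift_mero_simps(3)[symmetric] s M_periodic_iff)
    hence "shift_mero v s = s \<or> shift_mero v s = - s" by (simp add: square_eq_iff)
    hence "shift_mero v (shift_mero v s) = s" by (auto simp: shift_mero_simps)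
    thus "shift_mero w s = s" by (simp add: v(2) shift_shift_mero)
  qed
  hence "s \<in> K_elliptic \<tau>" using M_periodic_scaled[of "k * 2" \<tau>] k(1) by auto
  thus ?thesis using s by blast
qed

subsection \<open>Solutions of the Riccati equation\<close>

lemma mero_two_nonzero: "(2::mero) \<noteq> 0"
proof
  assume "(2::mero) = 0"
  moreover have "const_mero (1 + 1) = const_mero 1 + const_mero 1"
    by (rule ring_hom_onD(2)[OF ring_hom_on_const_mero])
  ultimately have "const_mero (1 + 1) = const_mero 0"
    by (simp add: ring_hom_onD(1,4)[OF ring_hom_on_const_mero])
  thus False by (simp add: ring_hom_on_inj[OF ring_hom_on_const_mero])
qed

text \<open>The Riccati map is fractional linear, hence preserves cross ratios; exchanging
  \<open>w1\<close> with \<open>w2\<close> and \<open>w3\<close> with \<open>w4\<close> preserves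
  them too. So \<open>\<rho>\<close> is constant, and a midpoint of the second orbit relative to the
  first is fixed.\<close>

lemma cross_ratio_fixed_point:
  fixes \<tau> h :: complex and a b w1 w2 w3 w4 :: mero
  defines "\<phi> \<equiv> shift_mero h"
  assumes \<tau>: "Im \<tau> > 0" "\<forall>n\<ge>1. of_nat n * h \<notin> period_lattice \<tau>" and b: "b \<noteq> 0"
    and K: "w1 \<in> K_elliptic \<tau>" "w2 \<in> K_elliptic \<tau>" "w3 \<in> K_elliptic \<tau>" "w4 \<in> K_elliptic \<tau>"
    and nz: "w1 \<noteq> 0" "w2 \<noteq> 0" "w3 \<noteq> 0" "w4 \<noteq> 0"
    and \<phi>: "\<phi> w1 = - a - b / w2" "\<phi> w2 = - a - b / w1" "\<phi> w3 = - a - b / w4" "\<phi> w4 = - a - b / w3"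
    and ne: "w3 \<noteq> w1" "w3 \<noteq> w2" "w4 \<noteq> w1" "w4 \<noteq> w2"
  shows "\<exists>w\<in>K_elliptic \<tau>. w \<noteq> 0 \<and> \<phi> w = - a - b / w"
proof -
  note \<phi>s = shift_mero_simps[of h, folded \<phi>_def] shift_mero_divide[of h, folded \<phi>_def]
  note cs = ring_hom_onD[OF ring_hom_on_const_mero]
  define \<rho> where "\<rho> = ((w3 - w1) * (w4 - w2)) / ((w3 - w2) * (w4 - w1))"
  have d: "\<phi> (w3 - w1) = b * (w4 - w2) / (w4 * w2)" "\<phi> (w4 - w2) = b * (w3 - w1) / (w1 * w3)"
    "\<phi> (w3 - w2) = b * (w4 - w1) / (w1 * w4)" "\<phi> (w4 - w1) = b * (w3 - w2) / (w2 * w3)"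
    using nz by (simp_all add: \<phi>s \<phi> field_simps)
  have cancel: "b * q / (w4 * w2) * (b * p / (w1 * w3)) / (b * t / (w1 * w4) * (b * r / (w2 * w3))) = p * q / (r * t)"
    "b * q / (w4 * w2) / (b * t / (w1 * w4)) = p * q / (r * t) * w1 / (p / r * w2)"
    if "p \<noteq> 0" "q \<noteq> 0" "r \<noteq> 0" "t \<noteq> 0" for p q r t :: mero
    using that b nz by (simp_all add: field_simps)
  have diff0: "w3 - w1 \<noteq> 0" "w4 - w2 \<noteq> 0" "w3 - w2 \<noteq> 0" "w4 - w1 \<noteq> 0" using ne by auto
  have "\<phi> \<rho> = \<phi> (w3 - w1) * \<phi> (w4 - w2) / (\<phi> (w3 - w2) * \<phi> (w4 - w1))"
    unfolding \<rho>_def by (simp only: \<phi>s(7) \<phi>s(3))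
  also have "\<dots> = \<rho>"
    unfolding d \<rho>_def by (rule cancel(1)[OF diff0])
  finally have "\<phi> \<rho> = \<rho>" .
  moreover have "\<rho> \<in> K_elliptic \<tau>" unfolding \<rho>_def by (intro K_elliptic_closed K)
  ultimately obtain r where r: "\<rho> = const_mero r"
    using K_elliptic_fixed[OF \<tau>] unfolding \<phi>_def by blast
  have "\<rho> \<noteq> 0" using ne by (simp add: \<rho>_def)
  hence "r \<noteq> 0" using r cs(4) by auto
  \<comment> \<open>In the coordinate \<open>(w - w1) / (w - w2)\<close>, the first orbit sits at 0
    and infinity, \<open>w3\<close> at \<open>m\<close>, and \<open>w4\<close> at
    \<open>m / \<rho>\<close>.\<close>
  define m where "m = (w3 - w1) / (w3 - w2)"
  \<comment> \<open>With \<open>x = const_mero q * m\<close>, \<open>x * x\<close> is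
    \<open>m * (m / \<rho>)\<close>, so \<open>x\<close> is a geometric mean of the coordinates of
    \<open>w3\<close> and \<open>w4\<close>. The sign of \<open>q\<close> is free and is used to
    avoid \<open>x = 1\<close>, the coordinate of infinity.\<close>
  obtain q where q: "q * q * r = 1" "const_mero q * m \<noteq> 1"
  proof -
    define q where "q = 1 / csqrt r"
    have "csqrt r * csqrt r = r" using power2_csqrt[of r] by (simp only: power2_eq_square)
    hence qq: "q * q * r = 1" using \<open>r \<noteq> 0\<close> by (simp add: q_def field_simps)
    show thesis
    proof (cases "const_mero q * m = 1")
      case True
      have "const_mero (- q) * m \<noteq> 1"
      proof
        assume "const_mero (- q) * m = 1"
        hence "(1::mero) + 1 = 0" using True by (simp add: cs)
        thus False using mero_two_nonzero by simp
      qed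
      thus ?thesis using that[of "- q"] qq by simp
    next
      case False thus ?thesis using that qq by blast
    qed
  qed
  define x where "x = const_mero q * m"
  have qq: "const_mero q * const_mero q * \<rho> = 1"
    using q(1) by (simp add: r cs(3)[symmetric] cs(1))
  have mK: "m \<in> K_elliptic \<tau>" unfolding m_def by (intro K_elliptic_closed K)
  have xK: "x \<in> K_elliptic \<tau>" unfolding x_def by (intro K_elliptic_closed K_elliptic_const mK)
  have m0: "m \<noteq> 0" using ne by (simp add: m_def)
  have "const_mero q \<noteq> 0" using qq by auto
  hence x0: "x \<noteq> 0" using m0 by (simp add: x_def)
  have \<phi>m: "\<phi> m = \<rho> * w1 / (m * w2)"
    unfolding m_def \<phi>s(7) d \<rho>_def by (rule cancel(2)[OF diff0])
  have "\<phi> x = const_mero q * \<phi> m" by (simp add: x_def \<phi>s) (simp add: \<phi>_def)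
  also have "\<dots> = (const_mero q * const_mero q * \<rho>) * w1 / (x * w2)"
    unfolding \<phi>m x_def using m0 nz \<open>const_mero q \<noteq> 0\<close> by (simp add: field_simps)
  finally have \<phi>x: "\<phi> x = w1 / (x * w2)" by (simp add: qq)
  have x1: "1 - x \<noteq> 0" using q(2) by (simp add: x_def)
  have wx: "w1 - x * w2 \<noteq> 0"
  proof
    assume "w1 - x * w2 = 0"
    hence "\<phi> x = \<phi> 1" using \<phi>x x0 nz by (simp add: \<phi>s)
    thus False using x1 shift_mero_eq_iff[of h x 1] by (simp add: \<phi>_def)
  qed
  \<comment> \<open>The point with coordinate \<open>x\<close>.\<close>
  define w where "w = (w1 - x * w2) / (1 - x)"
  have "\<phi> w = (- a - b / w2 - w1 / (x * w2) * (- a - b / w1)) / (1 - w1 / (x * w2))"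
    unfolding w_def by (simp add: \<phi>s \<phi>x \<phi>)
  also have "1 - w1 / (x * w2) = - (w1 - x * w2) / (x * w2)" using x0 nz by (simp add: field_simps)
  also have "- a - b / w2 - w1 / (x * w2) * (- a - b / w1) = (a * (w1 - x * w2) + b * (1 - x)) / (x * w2)"
    using x0 nz by (simp add: field_simps)
  also have "\<dots> / (- (w1 - x * w2) / (x * w2)) = - a - b / w"
    unfolding w_def using x0 nz wx x1 by (simp add: field_simps)
  finally have "\<phi> w = - a - b / w" .
  moreover have "w \<in> K_elliptic \<tau>" unfolding w_def by (intro K_elliptic_closed K_elliptic_0_1 K xK)
  moreover have "w \<noteq> 0" using wx x1 by (simp add: w_def)
  ultimately show ?thesis by blast
qed

text \<open>
  By the previous lemma, a Riccati equation without solution in \<open>K\<close> has at most one orbit of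
  length two, and the periods permute the two elements of that orbit.
\<close>

lemma riccati_orbit_periodic:
  fixes \<tau> h :: complex and a b w1 w2 :: mero
  defines "\<phi> \<equiv> shift_mero h"
  assumes \<tau>: "Im \<tau> > 0" "\<forall>n\<ge>1. of_nat n * h \<notin> period_lattice \<tau>" and b: "b \<noteq> 0"
    and ab: "a \<in> M_periodic (period_lattice \<tau>)" "b \<in> M_periodic (period_lattice \<tau>)"
    and K: "w1 \<in> K_elliptic \<tau>" "w2 \<in> K_elliptic \<tau>" and nz: "w1 \<noteq> 0" "w2 \<noteq> 0"
    and \<phi>: "\<phi> w1 = - a - b / w2" "\<phi> w2 = - a - b / w1"
    and none: "\<not> (\<exists>w\<in>K_elliptic \<tau>. w \<noteq> 0 \<and> \<phi> w = - a - b / w)"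
  shows "w1 \<in> M_periodic (scaled_lattice 2 \<tau>)"
  unfolding M_periodic_iff
proof
  fix w assume "w \<in> scaled_lattice 2 \<tau>"
  then obtain v where v: "v \<in> period_lattice \<tau>" "w = v + v" by (auto simp: scaled_lattice_def)
  define w3 w4 where "w3 = shift_mero v w1" and "w4 = shift_mero v w2"
  note vs = shift_mero_simps[of v] shift_mero_divide[of v]
  have abv: "shift_mero v a = a" "shift_mero v b = b" using ab v(1) by (auto simp: M_periodic_iff)
  have comm: "\<phi> (shift_mero v f) = shift_mero v (\<phi> f)" for f
    by (simp add: \<phi>_def shift_shift_mero add.commute)
  have \<phi>34: "\<phi> w3 = - a - b / w4" "\<phi> w4 = - a - b / w3"
    by (simp_all add: w3_def w4_def comm \<phi> vs abv)
  have nz34: "w3 \<noteq> 0" "w4 \<noteq> 0"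
    using nz shift_mero_eq_iff[of v _ 0] by (auto simp: w3_def w4_def vs)
  have inj: "- a - b / x = - a - b / y \<longleftrightarrow> x = y" if "x \<noteq> 0" "y \<noteq> 0" for x y
    using that b by (auto simp: field_simps)
  have eq: "w3 = w1 \<longleftrightarrow> w4 = w2" "w3 = w2 \<longleftrightarrow> w4 = w1"
    using shift_mero_eq_iff[of h] \<phi> \<phi>34 inj nz nz34 unfolding \<phi>_def by metis+
  have "w3 = w1 \<or> w3 = w2"
  proof (rule ccontr)
    assume ne: "\<not> (w3 = w1 \<or> w3 = w2)"
    have "\<exists>w\<in>K_elliptic \<tau>. w \<noteq> 0 \<and> shift_mero h w = - a - b / w"
      by (rule cross_ratio_fixed_point[OF \<tau> b K, of w3 w4])
         (use nz nz34 \<phi> \<phi>34 ne eq K in \<open>auto simp: \<phi>_def w3_def w4_def intro: K_elliptic_shift\<close>)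
    thus False using none by (simp add: \<phi>_def)
  qed
  hence "shift_mero v w3 = w1"
    using eq by (auto simp: w3_def w4_def)
  thus "shift_mero w w1 = w1" by (simp add: v(2) w3_def shift_shift_mero)
qed

text \<open>For solutions \<open>y\<^sub>1, y\<^sub>2\<close>, the hypotheses describe
  \<open>e = F0\<^sup>2 / \<Delta>\<^sup>2\<close>, \<open>e1 = F0 F1 / \<Delta>\<^sup>2\<close>,
  \<open>e2 = F0 F2 / \<Delta>\<^sup>2\<close> with \<open>F0 = y\<^sub>1 y\<^sub>2\<close>,
  \<open>F1 = y\<^sub>1 \<Phi> y\<^sub>2 + y\<^sub>2 \<Phi> y\<^sub>1\<close>,
  \<open>F2 = \<Phi> F0\<close> and \<open>\<Delta>\<close> the Casoratian. With
  \<open>t = 2\<close> and \<open>s = F0 / \<Delta>\<close> up to sign, \<open>w1\<close> and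
  \<open>w2\<close> are the two quotients \<open>\<Phi> y\<^sub>i / y\<^sub>i\<close>.\<close>

lemma riccati_of_invariants:
  fixes h :: complex and a b e e1 e2 s t :: mero
  defines "\<phi> \<equiv> shift_mero h"
  assumes t: "t \<noteq> 0" "\<phi> t = t" and e: "e \<noteq> 0" and b: "b \<noteq> 0" and s: "s * s = e"
    and r1: "e1 * e1 = e * (1 + t * t * e2)" and r2: "e2 * e2 = e * \<phi> e * (b * b)"
    and r3: "b * e * (\<phi> e1 + t * a * \<phi> e) = - e1 * e2"
  defines "w1 \<equiv> (e1 + s) / (t * e)" and "w2 \<equiv> (e1 - s) / (t * e)"
  shows "w1 \<noteq> 0" "w2 \<noteq> 0"
    "\<phi> w1 = - a - b / w1 \<or> \<phi> w1 = - a - b / w2 \<and> \<phi> w2 = - a - b / w1"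
proof -
  note \<phi>s = shift_mero_simps[of h, folded \<phi>_def] shift_mero_divide[of h, folded \<phi>_def]
  have "\<phi> e \<noteq> 0" using e shift_mero_eq_iff[of h e 0] by (simp add: \<phi>_def shift_mero_simps)
  hence e2: "e2 \<noteq> 0" using r2 e b by auto
  have s0: "s \<noteq> 0" using s e by auto
  have prod: "w1 * w2 = e2 / e"
  proof -
    have "(e1 + s) * (e1 - s) = t * t * e * e2" using r1 s by (simp add: algebra_simps)
    hence "w1 * w2 = (t * t * e * e2) / ((t * e) * (t * e))" by (simp add: w1_def w2_def)
    thus ?thesis using e t(1) by simp
  qed
  show w: "w1 \<noteq> 0" "w2 \<noteq> 0" using prod e2 e by auto
  have \<phi>e: "\<phi> e = e2 * e2 / (e * (b * b))" using r2 e b by (simp add: field_simps)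
  have "\<phi> e1 + t * a * \<phi> e = (b * e * (\<phi> e1 + t * a * \<phi> e)) / (b * e)" using e b by simp
  hence "\<phi> e1 + t * a * \<phi> e = - (e1 * e2 / (b * e))" by (simp add: r3)
  hence \<phi>e1: "\<phi> e1 = - (t * a * \<phi> e) - e1 * e2 / (b * e)" by (simp add: eq_neg_iff_add_eq_0 eq_diff_eq add_ac)
  have "\<phi> s * \<phi> s = (e2 / (s * b)) * (e2 / (s * b))"
  proof -
    have "\<phi> s * \<phi> s = \<phi> e" by (simp add: s[symmetric] \<phi>s)
    also have "\<dots> = (e2 / (s * b)) * (e2 / (s * b))" unfolding \<phi>e by (simp add: s[symmetric] mult_ac)
    finally show ?thesis .
  qed
  \<comment> \<open>The square of \<open>\<phi> s\<close> is known, and its sign decides whether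
    \<open>\<phi>\<close> acts on the roots as the Riccati map or also exchanges them.\<close>
  hence "\<phi> s = e2 / (s * b) \<or> \<phi> s = - (e2 / (s * b))" by (simp only: square_eq_iff)
  hence "\<phi> s = 1 * (e2 / (s * b)) \<or> \<phi> s = - 1 * (e2 / (s * b))" by simp
  then obtain \<eta> :: mero where \<eta>: "\<eta> = 1 \<or> \<eta> = - 1" "\<phi> s = \<eta> * (e2 / (s * b))" by blast
  \<comment> \<open>\<open>\<theta> = 1\<close> gives the image of \<open>w1\<close> and
    \<open>\<theta> = - 1\<close> that of \<open>w2\<close>.\<close>
  have key: "\<phi> ((e1 + \<theta> * s) / (t * e)) = - a - b * (e1 - \<theta> * \<eta> * s) / (t * e2)"
    if "\<phi> \<theta> = \<theta>" for \<theta>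
  proof -
    have es: "e2 / (s * b) = e2 * s / (e * b)" using s s0 e b by (simp add: field_simps)
    have "\<phi> ((e1 + \<theta> * s) / (t * e)) = (\<phi> e1 + \<theta> * \<phi> s) / (t * \<phi> e)"
      by (simp add: \<phi>s t(2) that)
    also have "\<phi> e1 + \<theta> * \<phi> s = - (t * a * \<phi> e) + (- (e1 * e2 / (b * e)) + \<theta> * \<eta> * (e2 * s / (e * b)))"
      by (simp add: \<phi>e1 \<eta>(2) es mult.assoc)
    also have "\<dots> / (t * \<phi> e) = (- (t * a * \<phi> e)) / (t * \<phi> e) + (- (e1 * e2 / (b * e)) + \<theta> * \<eta> * (e2 * s / (e * b))) / (t * \<phi> e)"
      by (rule add_divide_distrib)
    also have "(- (t * a * \<phi> e)) / (t * \<phi> e) = - a" using t(1) \<open>\<phi> e \<noteq> 0\<close> by simp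
    also have "(- (e1 * e2 / (b * e)) + \<theta> * \<eta> * (e2 * s / (e * b))) / (t * \<phi> e) = - (b * (e1 - \<theta> * \<eta> * s) / (t * e2))"
      unfolding \<phi>e using e b e2 t(1) by (simp add: field_simps)
    finally show ?thesis by simp
  qed
  have inv: "b / w1 = b * (e1 - s) / (t * e2)" "b / w2 = b * (e1 + s) / (t * e2)"
  proof -
    have cancel: "b * (x / (t * e)) / (e2 / e) = b * x / (t * e2)" for x
      using e e2 t(1) by (simp add: field_simps)
    have "b / w1 = b * w2 / (w1 * w2)" using w by simp
    also have "\<dots> = b * (e1 - s) / (t * e2)" unfolding prod unfolding w2_def by (rule cancel)
    finally show "b / w1 = b * (e1 - s) / (t * e2)" .
    have "b / w2 = b * w1 / (w1 * w2)" using w by simp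
    also have "\<dots> = b * (e1 + s) / (t * e2)" unfolding prod unfolding w1_def by (rule cancel)
    finally show "b / w2 = b * (e1 + s) / (t * e2)" .
  qed
  have k1: "\<phi> w1 = - a - b * (e1 - \<eta> * s) / (t * e2)" using key[of 1] by (simp add: \<phi>s w1_def)
  have k2: "\<phi> w2 = - a - b * (e1 + \<eta> * s) / (t * e2)" using key[of "- 1"] by (simp add: \<phi>s w2_def)
  show "\<phi> w1 = - a - b / w1 \<or> \<phi> w1 = - a - b / w2 \<and> \<phi> w2 = - a - b / w1"
    using \<eta>(1) unfolding k1 k2 inv by auto
qed

text \<open>Eliminating \<open>w2\<close> expresses \<open>\<phi> (\<phi> w1)\<close> as a
  fractional linear function of \<open>w1\<close> with denominator
  \<open>a * w1 + b = - (a * u)\<close>, which is not zero because \<open>\<phi> w2\<close> is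
  not.\<close>

lemma riccati_orbit_solution:
  fixes h :: complex and a b w1 w2 :: mero
  defines "\<phi> \<equiv> shift_mero h"
  assumes a: "a \<noteq> 0" and nz: "w1 \<noteq> 0" "w2 \<noteq> 0" and \<phi>: "\<phi> w1 = - a - b / w2" "\<phi> w2 = - a - b / w1"
  defines "u \<equiv> - w1 - b / a"
  shows "(\<phi> (\<phi> u) + (\<phi> (\<phi> (b / a)) - \<phi> a + \<phi> b / a)) * u = - (\<phi> b * b) / a ^ 2"
proof -
  note \<phi>s = shift_mero_simps[of h, folded \<phi>_def] shift_mero_divide[of h, folded \<phi>_def]
  have "\<phi> w2 \<noteq> 0" using nz shift_mero_eq_iff[of h w2 0] by (simp add: \<phi>_def shift_mero_simps)
  have \<phi>w2: "\<phi> w2 = - (a * w1 + b) / w1" unfolding \<phi>(2) using nz(1) by (simp add: field_simps)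
  have ne: "a * w1 + b \<noteq> 0"
  proof
    assume "a * w1 + b = 0"
    hence "\<phi> w2 = 0" by (simp only: \<phi>w2) simp
    thus False using \<open>\<phi> w2 \<noteq> 0\<close> by simp
  qed
  have "\<phi> (\<phi> w1) = - \<phi> a - \<phi> b / \<phi> w2" by (simp add: \<phi>(1) \<phi>s)
  also have "\<phi> b / \<phi> w2 = - (\<phi> b * w1 / (a * w1 + b))"
  proof -
    have "x / (- n / w1) = - (x * w1 / n)" for x n by simp
    thus ?thesis unfolding \<phi>w2 .
  qed
  finally have 2: "\<phi> (\<phi> w1) = - \<phi> a + \<phi> b * w1 / (a * w1 + b)" by simp
  have "\<phi> (\<phi> u) + (\<phi> (\<phi> (b / a)) - \<phi> a + \<phi> b / a) = - \<phi> (\<phi> w1) - \<phi> a + \<phi> b / a"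
    by (simp add: u_def \<phi>s)
  also have "\<dots> = \<phi> b / a - \<phi> b * w1 / (a * w1 + b)" by (simp add: 2)
  also have "\<dots> = \<phi> b * b / (a * (a * w1 + b))" using a ne by (simp add: field_simps)
  also have "\<dots> * u = - (\<phi> b * b) / a ^ 2"
  proof -
    have u: "u = - (a * w1 + b) / a" using a by (simp add: u_def field_simps)
    have "x / (a * n) * (- n / a) = - x / a ^ 2" if "n \<noteq> 0" for x n
      using that a by (simp add: power2_eq_square)
    thus ?thesis unfolding u using ne .
  qed
  finally show ?thesis .
qed

subsection \<open>Conjugation of complex matrices\<close>

lemma
  fixes A :: "'a::semiring_1^'n^'m"
  assumes "invertible A"
  shows matrix_inv_right: "A ** matrix_inv A = mat 1" and matrix_inv_left: "matrix_inv A ** A = mat 1"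
  using someI_ex[of "\<lambda>A'. A ** A' = mat 1 \<and> A' ** A = mat 1"] assms
  by (auto simp: invertible_def matrix_inv_def)

text \<open>\<open>(z1, z2)\<close> is a common left eigenvector. As the second row of
  \<open>P\<close> it makes the second row of every conjugate a multiple of
  \<open>(0, 1)\<close>.\<close>

lemma conjugate_into_upperI:
  fixes z1 z2 :: complex
  assumes z: "z1 \<noteq> 0 \<or> z2 \<noteq> 0" and det: "\<And>C. C \<in> G \<Longrightarrow> det C \<noteq> 0"
    and eig: "\<And>C. C \<in> G \<Longrightarrow> \<exists>\<mu>. z1 * C $ 1 $ 1 + z2 * C $ 2 $ 1 = \<mu> * z1 \<and> z1 * C $ 1 $ 2 + z2 * C $ 2 $ 2 = \<mu> * z2"
  shows "\<not> irreducible_GL2 G"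
proof -
  define p :: "complex \<times> complex" where "p = (if z2 \<noteq> 0 then (1, 0) else (0, 1))"
  define P :: "complex^2^2" where "P = vector [vector [fst p, snd p], vector [z1, z2]]"
  have "det P \<noteq> 0" using z by (auto simp: P_def p_def det_2)
  hence P: "invertible P" by (simp add: invertible_det_nz)
  note inv = matrix_inv_right[OF P] matrix_inv_left[OF P]
  have "P ** C ** matrix_inv P \<in> {vector [vector [\<alpha>, \<beta>], vector [0, \<delta>]] | \<alpha> \<beta> \<delta>. \<alpha> \<noteq> 0 \<and> \<delta> \<noteq> 0}"
    if C: "C \<in> G" for C
  proof -
    define X where "X = P ** C ** matrix_inv P"
    have XP: "X ** P = P ** C" by (simp add: X_def matrix_mul_assoc[symmetric] inv)
    hence "det X * det P = det P * det C" by (metis det_mul)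
    hence detX: "det X \<noteq> 0" using det[OF C] \<open>det P \<noteq> 0\<close> by auto
    obtain \<mu> where \<mu>: "z1 * C $ 1 $ 1 + z2 * C $ 2 $ 1 = \<mu> * z1" "z1 * C $ 1 $ 2 + z2 * C $ 2 $ 2 = \<mu> * z2"
      using eig[OF C] by blast
    have "(X ** P) $ 2 $ j = (P ** C) $ 2 $ j" for j by (simp add: XP)
    from this[of 1] this[of 2]
    have 1: "X $ 2 $ 1 * fst p + X $ 2 $ 2 * z1 = \<mu> * z1" and 2: "X $ 2 $ 1 * snd p + X $ 2 $ 2 * z2 = \<mu> * z2"
      using \<mu> by (simp_all add: matrix_matrix_mult_def sum_2 P_def)
    have "X $ 2 $ 1 * (fst p * z2 - snd p * z1) =
      (X $ 2 $ 1 * fst p + X $ 2 $ 2 * z1) * z2 - (X $ 2 $ 1 * snd p + X $ 2 $ 2 * z2) * z1"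
      by (simp add: algebra_simps)
    also have "\<dots> = 0" unfolding 1 2 by simp
    finally have X21: "X $ 2 $ 1 = 0" using z by (auto simp: p_def split: if_splits)
    have "X = vector [vector [X $ 1 $ 1, X $ 1 $ 2], vector [0, X $ 2 $ 2]]"
      by (simp add: vec_eq_iff forall_2 X21)
    moreover have "X $ 1 $ 1 \<noteq> 0" "X $ 2 $ 2 \<noteq> 0" using detX by (auto simp: det_2 X21)
    ultimately show ?thesis unfolding X_def[symmetric] by blast
  qed
  thus ?thesis using P unfolding irreducible_GL2_def conjugate_into_def by blast
qed

lemma quadratic_form_factor:
  fixes f g h :: complex
  assumes "g * g - 4 * f * h \<noteq> 0"
  obtains p q r s where "p * s - q * r \<noteq> 0"
    "\<And>x y. f * x * x + g * x * y + h * y * y = (p * x + q * y) * (r * x + s * y)"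
proof (cases "f = 0")
  case True
  show ?thesis
    \<comment> \<open>The instances stand for \<open>p\<close>, \<open>s\<close>, \<open>q\<close>,
      \<open>r\<close> in this order: the form is \<open>y * (g * x + h * y)\<close>.\<close>
    by (rule that[of 0 h 1 g]) (use assms True in \<open>auto simp: algebra_simps\<close>)
next
  case False
  define t where "t = csqrt (g * g - 4 * f * h)"
  have tt: "t * t = g * g - 4 * f * h"
    unfolding t_def using power2_csqrt by (simp only: power2_eq_square)
  have t0: "t \<noteq> 0" using tt assms by auto
  show ?thesis
  proof (rule that[of f "(g - t) / (2 * f)" "(g + t) / 2" 1])
    show "f * ((g - t) / (2 * f)) - (g + t) / 2 * 1 \<noteq> 0" using False t0 by (simp add: field_simps)
    fix x y
    have h: "h = (g * g - t * t) / (4 * f)" using False by (simp add: tt)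
    show "f * x * x + g * x * y + h * y * y = (f * x + (g + t) / 2 * y) * (1 * x + (g - t) / (2 * f) * y)"
      unfolding h using False by (simp add: field_simps)
  qed
qed

text \<open>The two linear factors of the nondegenerate form become the rows of \<open>P\<close>, so
  a conjugate \<open>X\<close> multiplies the product of the two coordinates by a scalar. At the
  basis vectors this says that each column of \<open>X\<close> contains a zero.\<close>

lemma conjugate_into_monomialI:
  fixes f g h :: complex
  assumes disc: "g * g - 4 * f * h \<noteq> 0" and det: "\<And>C. C \<in> G \<Longrightarrow> det C \<noteq> 0"
    and semi: "\<And>C. C \<in> G \<Longrightarrow> \<exists>\<mu>. \<forall>x y.
      (let x' = C $ 1 $ 1 * x + C $ 1 $ 2 * y; y' = C $ 2 $ 1 * x + C $ 2 $ 2 * y in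
        f * x' * x' + g * x' * y' + h * y' * y') = \<mu> * (f * x * x + g * x * y + h * y * y)"
  shows "imprimitive_GL2 G"
proof -
  obtain p q r s where pq: "p * s - q * r \<noteq> 0"
    "\<And>x y. f * x * x + g * x * y + h * y * y = (p * x + q * y) * (r * x + s * y)"
    by (rule quadratic_form_factor[OF disc]) (rule that; (assumption | simp))
  define P :: "complex^2^2" where "P = vector [vector [p, q], vector [r, s]]"
  have "det P \<noteq> 0" using pq(1) by (simp add: P_def det_2)
  hence P: "invertible P" by (simp add: invertible_det_nz)
  define Q where "Q = matrix_inv P"
  note inv = matrix_inv_right[OF P, folded Q_def] matrix_inv_left[OF P, folded Q_def]
  have "P ** C ** Q \<in> {vector [vector [\<alpha>, 0], vector [0, \<beta>]] | \<alpha> \<beta>. \<alpha> \<noteq> 0 \<and> \<beta> \<noteq> 0} \<union>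
        {vector [vector [0, \<gamma>], vector [\<delta>, 0]] | \<gamma> \<delta>. \<gamma> \<noteq> 0 \<and> \<delta> \<noteq> 0}"
    if C: "C \<in> G" for C
  proof -
    define X where "X = P ** C ** Q"
    have XP: "X ** P = P ** C" by (simp add: X_def matrix_mul_assoc[symmetric] inv)
    hence "det X * det P = det P * det C" by (metis det_mul)
    hence detX: "det X \<noteq> 0" using det[OF C] \<open>det P \<noteq> 0\<close> by auto
    obtain \<mu> where \<mu>: "\<And>x y. (let x' = C $ 1 $ 1 * x + C $ 1 $ 2 * y; y' = C $ 2 $ 1 * x + C $ 2 $ 2 * y in
        f * x' * x' + g * x' * y' + h * y' * y') = \<mu> * (f * x * x + g * x * y + h * y * y)"
      using semi[OF C] by blast
    have prod: "(X *v v) $ 1 * (X *v v) $ 2 = \<mu> * (v $ 1 * v $ 2)" for v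
    proof -
      define w where "w = Q *v v"
      have Pw: "P *v w = v" by (simp add: w_def matrix_vector_mul_assoc inv)
      have "X *v v = P *v (C *v w)" by (simp add: w_def X_def matrix_vector_mul_assoc[symmetric])
      hence "(X *v v) $ 1 * (X *v v) $ 2 =
        (let x' = C $ 1 $ 1 * w $ 1 + C $ 1 $ 2 * w $ 2; y' = C $ 2 $ 1 * w $ 1 + C $ 2 $ 2 * w $ 2 in
          f * x' * x' + g * x' * y' + h * y' * y')"
        unfolding pq(2) Let_def by (simp add: matrix_vector_mult_def sum_2 P_def)
      also have "\<dots> = \<mu> * ((P *v w) $ 1 * (P *v w) $ 2)"
        unfolding \<mu> unfolding pq(2) by (simp add: matrix_vector_mult_def sum_2 P_def)
      finally show ?thesis by (simp add: Pw)
    qed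
    have "X $ 1 $ 1 * X $ 2 $ 1 = 0" "X $ 1 $ 2 * X $ 2 $ 2 = 0"
      using prod[of "vector [1, 0]"] prod[of "vector [0, 1]"] by (auto simp: matrix_vector_mult_def sum_2)
    moreover have "X $ 1 $ 1 * X $ 2 $ 2 - X $ 1 $ 2 * X $ 2 $ 1 \<noteq> 0" using detX by (simp add: det_2)
    ultimately have cases: "X $ 1 $ 2 = 0 \<and> X $ 2 $ 1 = 0 \<and> X $ 1 $ 1 \<noteq> 0 \<and> X $ 2 $ 2 \<noteq> 0 \<or>
      X $ 1 $ 1 = 0 \<and> X $ 2 $ 2 = 0 \<and> X $ 1 $ 2 \<noteq> 0 \<and> X $ 2 $ 1 \<noteq> 0" by auto
    have "X = vector [vector [X $ 1 $ 1, X $ 1 $ 2], vector [X $ 2 $ 1, X $ 2 $ 2]]"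
      by (simp add: vec_eq_iff forall_2)
    with cases have "X = vector [vector [X $ 1 $ 1, 0], vector [0, X $ 2 $ 2]] \<and> X $ 1 $ 1 \<noteq> 0 \<and> X $ 2 $ 2 \<noteq> 0 \<or>
      X = vector [vector [0, X $ 1 $ 2], vector [X $ 2 $ 1, 0]] \<and> X $ 1 $ 2 \<noteq> 0 \<and> X $ 2 $ 1 \<noteq> 0" by auto
    thus ?thesis unfolding X_def[symmetric] by blast
  qed
  thus ?thesis using P unfolding imprimitive_GL2_def conjugate_into_def Q_def by blast
qed

subsection \<open>Second order equations over the field of elliptic functions\<close>

locale elliptic_pv =
  fixes \<tau> h :: complex and a b :: mero and \<iota> :: "mero \<Rightarrow> 'r::comm_ring_1" and \<Phi> :: "'r \<Rightarrow> 'r" and U :: "'r^2^2"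
  assumes \<tau>: "Im \<tau> > 0" and h: "\<forall>n\<ge>1. of_nat n * h \<notin> period_lattice \<tau>"
    and a: "a \<in> M_periodic (period_lattice \<tau>)" and b: "b \<in> M_periodic (period_lattice \<tau>)" "b \<noteq> 0"
    and pv: "picard_vessiot (K_elliptic \<tau>) (shift_mero h) (companion2 a b) \<iota> \<Phi> U"
begin

abbreviation "K \<equiv> K_elliptic \<tau>"
abbreviation "\<phi> \<equiv> shift_mero h"
abbreviation "G \<equiv> difference_galois_group const_mero K \<iota> \<Phi> U"
abbreviation "c z \<equiv> \<iota> (const_mero z)"

lemma aK: "a \<in> K" and bK: "b \<in> K"
  using a b M_periodic_period_lattice by auto

lemma \<iota>_add: "x \<in> K \<Longrightarrow> y \<in> K \<Longrightarrow> \<iota> (x + y) = \<iota> x + \<iota> y"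
  and \<iota>_mult: "x \<in> K \<Longrightarrow> y \<in> K \<Longrightarrow> \<iota> (x * y) = \<iota> x * \<iota> y"
  and \<iota>_1: "\<iota> 1 = 1"
  and \<iota>_inj: "x \<in> K \<Longrightarrow> y \<in> K \<Longrightarrow> \<iota> x = \<iota> y \<longleftrightarrow> x = y"
  and \<Phi>_\<iota>: "x \<in> K \<Longrightarrow> \<Phi> (\<iota> x) = \<iota> (\<phi> x)"
  using pv by (auto simp: picard_vessiot_def ring_hom_on_def inj_on_def)

lemma \<iota>_0: "\<iota> 0 = 0"
  using \<iota>_add[of 0 0] K_elliptic_0_1 by simp

lemma \<iota>_uminus: "x \<in> K \<Longrightarrow> \<iota> (- x) = - \<iota> x"
  using \<iota>_add[of x "- x"] K_elliptic_closed(3) by (auto simp: \<iota>_0 eq_neg_iff_add_eq_0 add.commute)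

lemma \<iota>_diff: "x \<in> K \<Longrightarrow> y \<in> K \<Longrightarrow> \<iota> (x - y) = \<iota> x - \<iota> y"
  using \<iota>_add[of x "- y"] K_elliptic_closed(3) by (auto simp: \<iota>_uminus)

lemma \<iota>_eq_0_iff: "x \<in> K \<Longrightarrow> \<iota> x = 0 \<longleftrightarrow> x = 0"
  using \<iota>_inj[of x 0] K_elliptic_0_1 by (simp add: \<iota>_0)

lemma \<iota>_divide: "x \<in> K \<Longrightarrow> y \<in> K \<Longrightarrow> y \<noteq> 0 \<Longrightarrow> \<iota> (x / y) * \<iota> y = \<iota> x"
  by (subst \<iota>_mult[symmetric]) (auto intro: K_elliptic_closed)

lemma U_invertible: "invertible U"
  and \<Phi>U_eq: "map_matrix \<Phi> U = map_matrix \<iota> (companion2 a b) ** U"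
  and \<Phi>_auto: "ring_automorphism \<Phi>"
  and U_generates: "generated_subring (\<iota> ` K \<union> {U $ i $ j | i j. True} \<union> {d. d * det U = 1}) = UNIV"
  and \<Phi>_simple: "ring_ideal I \<Longrightarrow> \<Phi> ` I \<subseteq> I \<Longrightarrow> I = {0} \<or> I = UNIV"
  using pv by (auto simp: picard_vessiot_def)

sublocale pv_ring "\<iota> ` K" \<Phi> c "map_matrix \<iota> (companion2 a b)" U "matrix_inv U" "det (matrix_inv U)"
proof
  show "0 \<in> \<iota> ` K" "1 \<in> \<iota> ` K"
    using imageI[OF K_elliptic_0_1(1), of \<iota> \<tau>] imageI[OF K_elliptic_0_1(2), of \<iota> \<tau>] by (simp_all add: \<iota>_0 \<iota>_1)
  show "x + y \<in> \<iota> ` K" "x * y \<in> \<iota> ` K" if "x \<in> \<iota> ` K" "y \<in> \<iota> ` K" for x y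
    using that by (auto simp: \<iota>_add[symmetric] \<iota>_mult[symmetric] intro: K_elliptic_closed)
  show "- x \<in> \<iota> ` K" if "x \<in> \<iota> ` K" for x
    using that by (auto simp: \<iota>_uminus[symmetric] intro: K_elliptic_closed)
  show "\<exists>y\<in>\<iota> ` K. x * y = 1" if x: "x \<in> \<iota> ` K" "x \<noteq> 0" for x
  proof -
    obtain k where k: "k \<in> K" "x = \<iota> k" using x by blast
    hence "k \<noteq> 0" using x \<iota>_0 by auto
    hence "x * \<iota> (inverse k) = 1"
      using k K_elliptic_closed(4)[OF k(1) k(1)] by (simp add: \<iota>_mult[symmetric] \<iota>_1)
    thus ?thesis using K_elliptic_closed(4)[OF k(1) k(1)] by blast
  qed
  show "ring_hom_on UNIV \<Phi>" "bij \<Phi>" using \<Phi>_auto by (auto simp: ring_automorphism_def)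
  show "ring_hom_on UNIV c"
    by (simp add: ring_hom_on_def ring_hom_onD[OF ring_hom_on_const_mero] \<iota>_add \<iota>_mult \<iota>_1 K_elliptic_const)
  show "c z \<in> \<iota> ` K" "\<Phi> (c z) = c z" for z
    by (auto simp: \<Phi>_\<iota> K_elliptic_const)
  show "k \<in> range c" if k: "k \<in> \<iota> ` K" "\<Phi> k = k" for k
  proof -
    obtain l where l: "l \<in> K" "k = \<iota> l" using k by blast
    hence "\<phi> l = l" using k \<iota>_inj[OF K_elliptic_shift] by (auto simp: \<Phi>_\<iota>)
    hence "l \<in> range const_mero" by (rule K_elliptic_fixed[OF \<tau> h l(1)])
    thus ?thesis using l by auto
  qed
  show "\<Phi> k \<in> \<iota> ` K \<longleftrightarrow> k \<in> \<iota> ` K" for k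
  proof
    assume "\<Phi> k \<in> \<iota> ` K"
    then obtain l where l: "l \<in> K" "\<Phi> k = \<iota> l" by blast
    have l': "shift_mero (- h) l \<in> K" using l(1) by (rule K_elliptic_shift)
    have "\<Phi> (\<iota> (shift_mero (- h) l)) = \<Phi> k" using l by (simp add: \<Phi>_\<iota>[OF l'] shift_shift_mero)
    hence "\<iota> (shift_mero (- h) l) = k" using \<Phi>_auto by (simp add: ring_automorphism_def bij_def inj_eq)
    thus "k \<in> \<iota> ` K" using l' by blast
  next
    assume "k \<in> \<iota> ` K" thus "\<Phi> k \<in> \<iota> ` K" by (auto simp: \<Phi>_\<iota> intro: K_elliptic_shift)
  qed
  show "map_matrix \<iota> (companion2 a b) $ i $ j \<in> \<iota> ` K" for i j
    using exhaust_2[of i] exhaust_2[of j] K_elliptic_0_1 K_elliptic_closed(3)[OF aK aK] K_elliptic_closed(3)[OF bK bK]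
    by (auto simp: map_matrix_def companion2_def)
  show "map_matrix \<Phi> U = map_matrix \<iota> (companion2 a b) ** U" by (rule \<Phi>U_eq)
  show inv: "matrix_inv U ** U = mat 1" "U ** matrix_inv U = mat 1"
    using matrix_inv_left[OF U_invertible] matrix_inv_right[OF U_invertible] .
  have "det (matrix_inv U ** U) = 1" by (simp add: inv)
  thus det: "det (matrix_inv U) * det U = 1" by (simp add: det_mul)
  have "{d. d * det U = 1} = {det (matrix_inv U)}"
  proof -
    have uniq: "x = det (matrix_inv U)" if "x * det U = 1" for x
    proof -
      have "x = (x * det U) * det (matrix_inv U)" using det by (simp add: mult_ac)
      thus ?thesis using that by simp
    qed
    show ?thesis using uniq det by blast
  qed
  thus "generated_subring (\<iota> ` K \<union> {U $ i $ j | i j. True} \<union> {det (matrix_inv U)}) = UNIV"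
    using U_generates by simp
qed (rule \<Phi>_simple)

lemma \<Phi>U1: "\<Phi> (U $ 1 $ j) = U $ 2 $ j" and \<Phi>U2: "\<Phi> (U $ 2 $ j) = - \<iota> b * U $ 1 $ j - \<iota> a * U $ 2 $ j"
proof -
  have "map_matrix \<Phi> U $ i $ j = (map_matrix \<iota> (companion2 a b) ** U) $ i $ j" for i by (simp add: \<Phi>U_eq)
  from this[of 1] this[of 2] show "\<Phi> (U $ 1 $ j) = U $ 2 $ j" "\<Phi> (U $ 2 $ j) = - \<iota> b * U $ 1 $ j - \<iota> a * U $ 2 $ j"
    by (simp_all add: map_matrix_def matrix_matrix_mult_def sum_2 companion2_def \<iota>_0 \<iota>_1 \<iota>_uminus aK bK)
qed

section \<open>Semi-invariants and the group acting on them\<close>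

lemma c_mult_eq_0: "c z * q = 0 \<Longrightarrow> q \<noteq> 0 \<Longrightarrow> z = 0"
proof (rule ccontr)
  assume q: "c z * q = 0" "q \<noteq> 0" and "z \<noteq> 0"
  have "c (1 / z) * c z = c (1 / z * z)" by (simp only: ring_hom_onD(3)[OF homc])
  also have "\<dots> = 1" using \<open>z \<noteq> 0\<close> by (simp add: ring_hom_onD(1)[OF homc])
  finally have "c (1 / z) * c z = 1" .
  hence "c (1 / z) * (c z * q) = q" by (simp add: mult.assoc[symmetric])
  thus False using q by simp
qed

text \<open>The multiples of \<open>q\<close> form a nonzero \<open>\<Phi>\<close>-stable ideal, so
  \<open>q\<close> is a unit by simplicity, and the quotient \<open>q' / q\<close> is fixed by
  \<open>\<Phi>\<close>.\<close>

lemma semi_invariant_ratio: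
  assumes q: "\<Phi> q = \<gamma> * q" "q \<noteq> 0" and q': "\<Phi> q' = \<gamma> * q'"
  shows "\<exists>z. q' = c z * q"
proof -
  note h\<Phi> = ring_hom_onD[OF hom\<Phi>]
  define I where "I = {r * q | r. True}"
  have "ring_ideal I"
    unfolding ring_ideal_def
  proof (intro conjI ballI allI)
    show "0 \<in> I" unfolding I_def by (auto intro: exI[of _ 0])
    show "x + y \<in> I" if "x \<in> I" "y \<in> I" for x y
      using that unfolding I_def by (auto simp: distrib_right[symmetric])
    show "r * x \<in> I" if "x \<in> I" for r x
      using that unfolding I_def by (auto simp: mult.assoc[symmetric])
  qed
  moreover have "\<Phi> ` I \<subseteq> I"
    unfolding I_def by (auto simp: h\<Phi> q mult.assoc[symmetric])
  moreover have "q \<in> I" unfolding I_def by (auto intro: exI[of _ 1])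
  ultimately have "1 \<in> I" using \<Phi>_simple[of I] q(2) by blast
  then obtain p where p: "p * q = 1" unfolding I_def by auto
  have "\<Phi> (p * q) = 1" by (simp add: p h\<Phi>(1))
  hence "\<Phi> p * (\<gamma> * q) = 1" by (simp add: h\<Phi>(3) q(1))
  have "\<Phi> (q' * p) = (\<gamma> * q' * \<Phi> p) * (p * q)" by (simp add: h\<Phi> q' p)
  also have "\<dots> = (\<Phi> p * (\<gamma> * q)) * (q' * p)" by (simp only: mult_ac)
  finally have "\<Phi> (q' * p) = q' * p" using \<open>\<Phi> p * (\<gamma> * q) = 1\<close> by simp
  then obtain z where "q' * p = c z" using fixed_complex by blast
  moreover have "q' = q' * p * q" by (simp add: mult.assoc p)
  ultimately have "q' = c z * q" by simp
  thus ?thesis by blast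
qed

lemma galois_groupE:
  assumes "C \<in> G"
  obtains \<sigma> where "ring_hom_on UNIV \<sigma>" "\<And>f. f \<in> K \<Longrightarrow> \<sigma> (\<iota> f) = \<iota> f" "\<And>x. \<sigma> (\<Phi> x) = \<Phi> (\<sigma> x)"
    "inj \<sigma>" "map_matrix \<sigma> U = U ** map_matrix c C" "det C \<noteq> 0"
    "\<And>i j. \<sigma> (U $ i $ j) = U $ i $ 1 * c (C $ 1 $ j) + U $ i $ 2 * c (C $ 2 $ j)"
proof -
  obtain \<sigma> where \<sigma>: "\<sigma> \<in> difference_automorphisms K \<iota> \<Phi>" "map_matrix \<sigma> U = U ** map_matrix (\<iota> \<circ> const_mero) C"
    using assms unfolding difference_galois_group_def mem_Collect_eq by (elim bexE)
  have hom: "ring_hom_on UNIV \<sigma>" "inj \<sigma>" "\<And>f. f \<in> K \<Longrightarrow> \<sigma> (\<iota> f) = \<iota> f" "\<sigma> \<circ> \<Phi> = \<Phi> \<circ> \<sigma>"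
    using \<sigma>(1) by (auto simp: difference_automorphisms_def ring_automorphism_def bij_def)
  have \<sigma>U: "map_matrix \<sigma> U = U ** map_matrix c C" using \<sigma>(2) by (simp add: o_def)
  have "det C \<noteq> 0"
  proof
    assume "det C = 0"
    hence "\<sigma> (det U) = 0"
      using det_map_matrix[OF hom(1), of U] det_map_matrix[OF homc, of C] ring_hom_onD(4)[OF homc]
      by (simp add: \<sigma>U det_mul)
    hence "\<sigma> (det (matrix_inv U) * det U) = 0" by (simp add: ring_hom_onD[OF hom(1)])
    thus False using d_det ring_hom_onD(1)[OF hom(1)] by simp
  qed
  moreover have "\<sigma> (U $ i $ j) = U $ i $ 1 * c (C $ 1 $ j) + U $ i $ 2 * c (C $ 2 $ j)" for i j
  proof -
    have "map_matrix \<sigma> U $ i $ j = (U ** map_matrix c C) $ i $ j" by (simp add: \<sigma>U)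
    thus ?thesis by (simp add: map_matrix_def matrix_matrix_mult_def sum_2)
  qed
  moreover have "\<sigma> (\<Phi> x) = \<Phi> (\<sigma> x)" for x using fun_cong[OF hom(4), of x] by simp
  ultimately show ?thesis using hom \<sigma>U by (intro that[of \<sigma>]) auto
qed

text \<open>The operator \<open>L = \<Phi> - w\<close> takes solutions of the equation to solutions
  of \<open>\<Phi> x = \<gamma> x\<close>, which are unique up to a complex factor. The values
  \<open>z 1, z 2\<close> of \<open>L\<close> on the columns of \<open>U\<close> thus form a common
  left eigenvector of \<open>G\<close>.\<close>

lemma linear_factor_reducible:
  assumes w: "w \<in> K" "w \<noteq> 0" "\<phi> w = - a - b / w"
  shows "\<not> irreducible_GL2 G"
proof -
  note h\<Phi> = ring_hom_onD[OF hom\<Phi>]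
  define \<gamma> where "\<gamma> = \<iota> (b / w)"
  define L where "L j = U $ 2 $ j - \<iota> w * U $ 1 $ j" for j
  have bw: "b / w \<in> K" by (rule K_elliptic_closed(6)[OF bK w(1)])
  have \<gamma>w: "\<gamma> * \<iota> w = \<iota> b" unfolding \<gamma>_def by (rule \<iota>_divide[OF bK w(1,2)])
  have \<Phi>w: "\<Phi> (\<iota> w) = - \<iota> a - \<gamma>"
    unfolding \<Phi>_\<iota>[OF w(1)] w(3) \<gamma>_def using aK bw K_elliptic_closed(3)[OF aK aK] by (simp add: \<iota>_diff \<iota>_uminus)
  have \<Phi>L: "\<Phi> (L j) = \<gamma> * L j" for j
  proof -
    have "\<Phi> (L j) = - \<iota> b * U $ 1 $ j + \<gamma> * U $ 2 $ j"
      by (simp add: L_def h\<Phi> \<Phi>U1 \<Phi>U2 \<Phi>w algebra_simps)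
    also have "\<dots> = \<gamma> * L j" by (simp add: L_def \<gamma>w[symmetric] algebra_simps)
    finally show ?thesis .
  qed
  have "\<exists>k. L k \<noteq> 0"
  proof (rule ccontr)
    assume "\<nexists>k. L k \<noteq> 0"
    hence "U $ 2 $ j = \<iota> w * U $ 1 $ j" for j by (simp add: L_def)
    hence "det U = 0" by (simp add: det_2 mult_ac)
    thus False using d_det by simp
  qed
  then obtain k where k: "L k \<noteq> 0" by blast
  have "\<forall>j. \<exists>z. L j = c z * L k" using semi_invariant_ratio[OF \<Phi>L k \<Phi>L] by blast
  then obtain z where z: "\<And>j. L j = c (z j) * L k" by metis
  have "z k \<noteq> 0" using z[of k] k ring_hom_onD(4)[OF homc] by auto
  hence "z 1 \<noteq> 0 \<or> z 2 \<noteq> 0" using exhaust_2[of k] by auto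
  thus ?thesis
  proof (rule conjugate_into_upperI)
    fix C assume "C \<in> G"
    then obtain \<sigma> where \<sigma>: "ring_hom_on UNIV \<sigma>" "\<And>f. f \<in> K \<Longrightarrow> \<sigma> (\<iota> f) = \<iota> f" "\<And>x. \<sigma> (\<Phi> x) = \<Phi> (\<sigma> x)"
      "inj \<sigma>" "map_matrix \<sigma> U = U ** map_matrix c C" "det C \<noteq> 0"
      "\<And>i j. \<sigma> (U $ i $ j) = U $ i $ 1 * c (C $ 1 $ j) + U $ i $ 2 * c (C $ 2 $ j)"
      by (rule galois_groupE) (rule that; (assumption | simp))
    note h\<sigma> = ring_hom_onD[OF \<sigma>(1)]
    show "det C \<noteq> 0" by fact
    have \<sigma>L: "\<sigma> (L j) = L 1 * c (C $ 1 $ j) + L 2 * c (C $ 2 $ j)" for j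
      by (simp add: L_def h\<sigma> \<sigma>(7) \<sigma>(2)[OF w(1)] algebra_simps)
    have "\<Phi> (\<sigma> (L k)) = \<gamma> * \<sigma> (L k)"
      using \<sigma>(2)[OF bw] by (simp add: \<sigma>(3)[symmetric] \<Phi>L h\<sigma> \<gamma>_def)
    then obtain \<mu> where \<mu>: "\<sigma> (L k) = c \<mu> * L k" using semi_invariant_ratio[OF \<Phi>L k] by blast
    have "z 1 * C $ 1 $ j + z 2 * C $ 2 $ j = \<mu> * z j" for j
    proof -
      have "\<sigma> (L j) = c (z j) * (c \<mu> * L k)"
        by (simp add: z[of j] h\<sigma>(3) \<mu> \<sigma>(2)[OF K_elliptic_const])
      hence "(c (z 1) * c (C $ 1 $ j) + c (z 2) * c (C $ 2 $ j) - c \<mu> * c (z j)) * L k = 0"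
        using \<sigma>L[of j] z[of 1] z[of 2] by (simp add: algebra_simps)
      hence "c (z 1 * C $ 1 $ j + z 2 * C $ 2 $ j - \<mu> * z j) * L k = 0"
        by (simp add: ring_hom_onD[OF homc])
      thus ?thesis using c_mult_eq_0 k by fastforce
    qed
    thus "\<exists>\<mu>. z 1 * C $ 1 $ 1 + z 2 * C $ 2 $ 1 = \<mu> * z 1 \<and> z 1 * C $ 1 $ 2 + z 2 * C $ 2 $ 2 = \<mu> * z 2"
      by blast
  qed
qed

text \<open>The equation for \<open>u\<close> says exactly that \<open>\<Phi> M = g L\<close> for
  \<open>M = \<Phi> L\<close>; the conditions are \<open>b * s = - (w * g)\<close> and
  \<open>a * s - \<phi> b = g\<close>. Arguing with \<open>L\<close> and \<open>M\<close> instead of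
  an orbit avoids dividing by \<open>w\<close> or \<open>a + \<phi> w\<close>, either of which may
  vanish.\<close>

lemma second_order_factor_imprimitive:
  assumes irr: "irreducible_GL2 G" and a0: "a \<noteq> 0" and u: "u \<in> K"
    and eq: "(\<phi> (\<phi> u) + (\<phi> (\<phi> (b / a)) - \<phi> a + \<phi> b / a)) * u = - (\<phi> b * b) / a ^ 2"
  shows "imprimitive_GL2 G"
proof -
  note h\<Phi> = ring_hom_onD[OF hom\<Phi>] and hc = ring_hom_onD[OF homc]
  have \<phi>b0: "\<phi> b \<noteq> 0" using b(2) shift_mero_eq_iff[of h b 0] by (simp add: shift_mero_simps)
  have u0: "u \<noteq> 0" using eq a0 b(2) \<phi>b0 by auto
  define w where "w = - u - b / a"
  define s where "s = \<phi> a + \<phi> (\<phi> w)"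
  define g where "g = \<phi> b * b / (a * u)"
  have wK: "w \<in> K" unfolding w_def by (intro K_elliptic_closed(5,6) K_elliptic_closed(3)[OF u u] aK bK)
  have \<phi>K: "\<phi> w \<in> K" "\<phi> (\<phi> w) \<in> K" "\<phi> a \<in> K" "\<phi> b \<in> K"
    by (intro K_elliptic_shift wK aK bK)+
  have sK: "s \<in> K" unfolding s_def by (rule K_elliptic_closed(1)[OF \<phi>K(3,2)])
  have gK: "g \<in> K" unfolding g_def by (intro K_elliptic_closed(2,6) \<phi>K aK bK u)
  \<comment> \<open>Divide the equation by \<open>u\<close> and use
    \<open>a * u + b = - (a * w)\<close>.\<close>
  have s: "s = - (\<phi> b * w) / (a * u)"
  proof -
    have "\<phi> (\<phi> u) + (\<phi> (\<phi> (b / a)) - \<phi> a + \<phi> b / a) = - (\<phi> b * b) / a ^ 2 / u"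
      unfolding eq[symmetric] by (rule nonzero_mult_div_cancel_right[OF u0, symmetric])
    moreover have "s = \<phi> a - (\<phi> (\<phi> u) + \<phi> (\<phi> (b / a)))"
      by (simp add: s_def w_def shift_mero_simps)
    moreover have "s = B - P" if "x + (y - A + B) = P" "s = A - (x + y)" for x y A B P s :: mero
      using that(2) by (simp add: that(1)[symmetric])
    ultimately have "s = \<phi> b / a - (- (\<phi> b * b) / a ^ 2 / u)" by blast
    thus ?thesis using a0 u0 by (simp add: w_def power2_eq_square field_simps)
  qed
  have bs: "b * s = - (w * g)" unfolding s g_def by simp
  have as: "a * s - \<phi> b = g"
    unfolding s g_def w_def using a0 u0 by (simp add: field_simps)
  have nonzero: "w * (a + \<phi> w) + b \<noteq> 0"
  proof
    assume 0: "w * (a + \<phi> w) + b = 0"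
    hence w0: "w \<noteq> 0" using b(2) by auto
    have "a + \<phi> w = (w * (a + \<phi> w) + b) / w - b / w" using w0 by (simp add: add_divide_distrib)
    hence "a + \<phi> w = - (b / w)" unfolding 0 by simp
    hence "\<phi> w = - a - b / w" by (metis add_diff_cancel_left' diff_conv_add_uminus add.commute)
    thus False using linear_factor_reducible[OF wK w0] irr by blast
  qed
  define L where "L j = U $ 2 $ j - \<iota> w * U $ 1 $ j" for j
  define M where "M j = - \<iota> b * U $ 1 $ j - \<iota> (a + \<phi> w) * U $ 2 $ j" for j
  have \<Phi>L: "\<Phi> (L j) = M j" for j
    by (simp add: L_def M_def h\<Phi> \<Phi>U1 \<Phi>U2 \<Phi>_\<iota> wK \<iota>_add aK \<phi>K algebra_simps)
  have \<Phi>M: "\<Phi> (M j) = \<iota> g * L j" for j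
  proof -
    have "\<Phi> (\<iota> (a + \<phi> w)) = \<iota> s"
      using K_elliptic_closed(1)[OF aK \<phi>K(1)] by (simp add: \<Phi>_\<iota> s_def shift_mero_simps)
    hence "\<Phi> (M j) = \<iota> b * \<iota> s * U $ 1 $ j + (\<iota> a * \<iota> s - \<iota> (\<phi> b)) * U $ 2 $ j"
      by (simp add: M_def h\<Phi> \<Phi>U1 \<Phi>U2 \<Phi>_\<iota> bK algebra_simps)
    also have "\<iota> a * \<iota> s - \<iota> (\<phi> b) = \<iota> g"
      by (simp add: as[symmetric] \<iota>_diff \<iota>_mult aK sK \<phi>K K_elliptic_closed(2)[OF aK sK])
    also have "\<iota> b * \<iota> s = - (\<iota> w * \<iota> g)"
      using bs by (simp add: \<iota>_mult[symmetric] \<iota>_uminus[symmetric] bK sK wK gK K_elliptic_closed(2)[OF wK gK])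
    finally show ?thesis by (simp add: L_def algebra_simps)
  qed
  \<comment> \<open>The Casoratian of \<open>L 1, L 2\<close>. It differs from \<open>det U\<close>
    by a factor whose vanishing would make \<open>w\<close> a Riccati solution, which irreducibility
    excludes.\<close>
  define E where "E = L 1 * M 2 - L 2 * M 1"
  have "\<iota> (w * (a + \<phi> w) + b) = \<iota> w * \<iota> (a + \<phi> w) + \<iota> b"
    using K_elliptic_closed(1)[OF aK \<phi>K(1)] K_elliptic_closed(2)[OF wK K_elliptic_closed(1)[OF aK \<phi>K(1)]]
    by (simp only: \<iota>_add[of "w * (a + \<phi> w)"] \<iota>_mult wK bK)
  hence E: "E = \<iota> (w * (a + \<phi> w) + b) * det U"
    by (simp only:) (simp add: E_def L_def M_def det_2 algebra_simps)
  have "w * (a + \<phi> w) + b \<in> K" by (intro K_elliptic_closed(1,2) wK aK \<phi>K bK)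
  hence \<iota>0: "\<iota> (w * (a + \<phi> w) + b) \<noteq> 0" using nonzero by (simp add: \<iota>_eq_0_iff)
  have "E \<noteq> 0"
  proof
    assume "E = 0"
    hence "\<iota> (w * (a + \<phi> w) + b) * (det (matrix_inv U) * det U) = 0"
      using E by (simp only: mult.left_commute[of _ "det (matrix_inv U)"] mult_zero_right)
    thus False using \<iota>0 d_det by simp
  qed
  hence EE: "E * E \<noteq> 0" using reduced by blast
  \<comment> \<open>Coefficients of the quadratic form
    \<open>(L 1 x + L 2 y) (M 1 x + M 2 y)\<close>, whose discriminant is \<open>E * E\<close>. All
    three are multiplied by \<open>\<iota> g\<close> under \<open>\<Phi>\<close>, so they are
    complex multiples \<open>f n\<close> of a single one.\<close>
  define q where "q = (\<lambda>n::nat. if n = 0 then L 1 * M 1 else if n = 1 then L 1 * M 2 + L 2 * M 1 else L 2 * M 2)"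
  have disc: "q 1 * q 1 - 4 * q 0 * q 2 = E * E" by (simp add: q_def E_def algebra_simps)
  have \<Phi>q: "\<Phi> (q n) = \<iota> g * q n" for n
    by (simp add: q_def h\<Phi> \<Phi>L \<Phi>M algebra_simps)
  have "\<exists>k. q k \<noteq> 0" proof (rule ccontr)
    assume "\<not> (\<exists>k. q k \<noteq> 0)"
    hence "q 0 = 0" "q 1 = 0" by auto
    thus False using disc EE by simp
  qed
  then obtain k where k: "q k \<noteq> 0" by blast
  have "\<forall>n. \<exists>z. q n = c z * q k" using semi_invariant_ratio[OF \<Phi>q k \<Phi>q] by blast
  then obtain f where f: "\<And>n. q n = c (f n) * q k" by metis
  define F where "F x y = f 0 * x * x + f 1 * x * y + f 2 * y * y" for x y
  define Q where "Q x y = (L 1 * c x + L 2 * c y) * (M 1 * c x + M 2 * c y)" for x y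
  have Q: "Q x y = c (F x y) * q k" for x y
  proof -
    have "Q x y = q 0 * (c x * c x) + q 1 * (c x * c y) + q 2 * (c y * c y)"
      by (simp add: Q_def q_def algebra_simps)
    also have "\<dots> = c (F x y) * q k"
      unfolding f[of 0] f[of 1] f[of 2] by (simp add: F_def hc algebra_simps)
    finally show ?thesis .
  qed
  show ?thesis
  proof (rule conjugate_into_monomialI)
    show "f 1 * f 1 - 4 * f 0 * f 2 \<noteq> 0"
    proof
      assume d0: "f 1 * f 1 - 4 * f 0 * f 2 = 0"
      have c4: "c 4 = 4" using hc(1,2) by (metis numeral_Bit0 numeral_One)
      have "c (f 1 * f 1 - 4 * f 0 * f 2) = c (f 1) * c (f 1) - 4 * c (f 0) * c (f 2)" by (simp only: hc c4)
      hence "c (f 1) * c (f 1) - 4 * c (f 0) * c (f 2) = 0" unfolding d0 hc(4) by (rule sym)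
      hence "(c (f 1) * c (f 1) - 4 * c (f 0) * c (f 2)) * (q k * q k) = 0" by (simp only: mult_zero_left)
      also have "(c (f 1) * c (f 1) - 4 * c (f 0) * c (f 2)) * (q k * q k) = q 1 * q 1 - 4 * q 0 * q 2"
        unfolding f[of 0] f[of 1] f[of 2] by (simp add: algebra_simps)
      finally show False using disc EE by simp
    qed
  next
    fix C assume "C \<in> G"
    then obtain \<sigma> where \<sigma>: "ring_hom_on UNIV \<sigma>" "\<And>f. f \<in> K \<Longrightarrow> \<sigma> (\<iota> f) = \<iota> f" "\<And>x. \<sigma> (\<Phi> x) = \<Phi> (\<sigma> x)"
      "inj \<sigma>" "map_matrix \<sigma> U = U ** map_matrix c C" "det C \<noteq> 0"
      "\<And>i j. \<sigma> (U $ i $ j) = U $ i $ 1 * c (C $ 1 $ j) + U $ i $ 2 * c (C $ 2 $ j)"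
      by (rule galois_groupE) (rule that; (assumption | simp))
    note h\<sigma> = ring_hom_onD[OF \<sigma>(1)]
    show "det C \<noteq> 0" by fact
    have \<sigma>L: "\<sigma> (L j) = L 1 * c (C $ 1 $ j) + L 2 * c (C $ 2 $ j)" for j
      by (simp add: L_def h\<sigma> \<sigma>(7) \<sigma>(2)[OF wK] algebra_simps)
    have \<sigma>M: "\<sigma> (M j) = M 1 * c (C $ 1 $ j) + M 2 * c (C $ 2 $ j)" for j
      unfolding \<Phi>L[symmetric] \<sigma>(3) \<sigma>L by (simp add: h\<Phi> c_fixed)
    have "\<Phi> (\<sigma> (q k)) = \<iota> g * \<sigma> (q k)"
      using \<sigma>(2)[OF gK] by (simp add: \<sigma>(3)[symmetric] \<Phi>q h\<sigma>)
    then obtain \<mu> where \<mu>: "\<sigma> (q k) = c \<mu> * q k" using semi_invariant_ratio[OF \<Phi>q k] by blast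
    have "F (C $ 1 $ 1 * x + C $ 1 $ 2 * y) (C $ 2 $ 1 * x + C $ 2 $ 2 * y) = \<mu> * F x y" for x y
    proof -
      have "\<sigma> (Q x y) = Q (C $ 1 $ 1 * x + C $ 1 $ 2 * y) (C $ 2 $ 1 * x + C $ 2 $ 2 * y)"
        by (simp add: Q_def h\<sigma> \<sigma>L \<sigma>M \<sigma>(2)[OF K_elliptic_const] hc algebra_simps)
      hence "c (F (C $ 1 $ 1 * x + C $ 1 $ 2 * y) (C $ 2 $ 1 * x + C $ 2 $ 2 * y)) * q k = c (F x y) * (c \<mu> * q k)"
        by (simp add: Q h\<sigma> \<mu> \<sigma>(2)[OF K_elliptic_const])
      hence "c (F (C $ 1 $ 1 * x + C $ 1 $ 2 * y) (C $ 2 $ 1 * x + C $ 2 $ 2 * y) - \<mu> * F x y) * q k = 0"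
        by (simp only: hc(3,6)) (simp add: algebra_simps)
      thus ?thesis using c_mult_eq_0 k by fastforce
    qed
    thus "\<exists>\<mu>. \<forall>x y. (let x' = C $ 1 $ 1 * x + C $ 1 $ 2 * y; y' = C $ 2 $ 1 * x + C $ 2 $ 2 * y in
        f 0 * x' * x' + f 1 * x' * y' + f 2 * y' * y') = \<mu> * (f 0 * x * x + f 1 * x * y + f 2 * y * y)"
      unfolding Let_def F_def by blast
  qed
qed

text \<open>
  In a basis of solutions \<open>y\<^sub>1, y\<^sub>2\<close> permuted by \<open>G\<close> up to constants, the products of two coefficients of
  \<open>y\<^sub>1 y\<^sub>2, y\<^sub>1 \<Phi> y\<^sub>2 + y\<^sub>2 \<Phi> y\<^sub>1, \<Phi> y\<^sub>1 \<Phi> y\<^sub>2\<close>, divided by the square of the Casoratian, are invariant under \<open>G\<close>.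
\<close>

lemma imprimitive_invariants:
  assumes imp: "imprimitive_GL2 G" and a0: "a \<noteq> 0"
  obtains e e1 e2 where "e \<in> K" "e1 \<in> K" "e2 \<in> K" "e \<noteq> 0"
    "e1 * e1 = e * (1 + 2 * 2 * e2)" "e2 * e2 = e * \<phi> e * (b * b)"
    "b * e * (\<phi> e1 + 2 * a * \<phi> e) = - e1 * e2"
proof -
  note h\<Phi> = ring_hom_onD[OF hom\<Phi>] and hc = ring_hom_onD[OF homc]
  obtain P :: "complex^2^2" where P: "invertible P" "\<forall>C\<in>G. P ** C ** matrix_inv P \<in>
       {vector [vector [\<alpha>, 0], vector [0, \<beta>]] | \<alpha> \<beta>. \<alpha> \<noteq> 0 \<and> \<beta> \<noteq> 0} \<union>
        {vector [vector [0, \<gamma>], vector [\<delta>, 0]] | \<gamma> \<delta>. \<gamma> \<noteq> 0 \<and> \<delta> \<noteq> 0}"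
    using imp unfolding imprimitive_GL2_def conjugate_into_def by blast
  define Q where "Q = matrix_inv P"
  note inv = matrix_inv_right[OF P(1), folded Q_def] matrix_inv_left[OF P(1), folded Q_def]
  \<comment> \<open>The columns of \<open>Y\<close> are the basis of solutions in which the group is
    monomial.\<close>
  define Y where "Y = U ** map_matrix c Q"
  have Y: "Y $ i $ j = U $ i $ 1 * c (Q $ 1 $ j) + U $ i $ 2 * c (Q $ 2 $ j)" for i j
    by (simp add: Y_def map_matrix_def matrix_matrix_mult_def sum_2)
  have \<Phi>Y1: "\<Phi> (Y $ 1 $ j) = Y $ 2 $ j" and \<Phi>Y2: "\<Phi> (Y $ 2 $ j) = - \<iota> b * Y $ 1 $ j - \<iota> a * Y $ 2 $ j" for j
    by (simp_all add: Y h\<Phi> c_fixed \<Phi>U1 \<Phi>U2 algebra_simps)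
  define F0 F1 F2 \<Delta> where "F0 = Y $ 1 $ 1 * Y $ 1 $ 2" and "F1 = Y $ 1 $ 1 * Y $ 2 $ 2 + Y $ 1 $ 2 * Y $ 2 $ 1"
    and "F2 = Y $ 2 $ 1 * Y $ 2 $ 2" and "\<Delta> = Y $ 1 $ 1 * Y $ 2 $ 2 - Y $ 1 $ 2 * Y $ 2 $ 1"
  \<comment> \<open>\<open>D\<close> is the inverse of the Casoratian
    \<open>\<Delta>\<close>.\<close>
  define D where "D = det (matrix_inv U) * c (det P)"
  have D: "D * \<Delta> = 1"
  proof -
    have "\<Delta> = det Y" by (simp add: \<Delta>_def det_2)
    also have "\<dots> = det U * c (det Q)" by (simp add: Y_def det_mul det_map_matrix[OF homc])
    finally have "D * \<Delta> = (det (matrix_inv U) * det U) * (c (det P) * c (det Q))"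
      by (simp add: D_def mult_ac)
    also have "c (det P) * c (det Q) = c (det (P ** Q))" by (simp add: det_mul hc)
    finally show ?thesis by (simp add: d_det inv hc)
  qed
  have \<Phi>F: "\<Phi> F0 = F2" "\<Phi> F1 = - (\<iota> a * F2 + \<iota> a * F2) - \<iota> b * F1"
    "\<Phi> F2 = \<iota> b * \<iota> b * F0 + \<iota> a * \<iota> b * F1 + \<iota> a * \<iota> a * F2" "\<Phi> \<Delta> = \<iota> b * \<Delta>"
    by (simp_all add: F0_def F1_def F2_def \<Delta>_def h\<Phi> \<Phi>Y1 \<Phi>Y2 algebra_simps)
  have \<Phi>D: "\<Phi> D * \<iota> b = D"
  proof -
    have "\<Phi> (D * \<Delta>) = 1" by (simp add: D h\<Phi>)
    hence "\<Phi> D * (\<iota> b * \<Delta>) = 1" by (simp add: h\<Phi> \<Phi>F)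
    hence "D = D * (\<Phi> D * (\<iota> b * \<Delta>))" by simp
    also have "\<dots> = \<Phi> D * \<iota> b * (D * \<Delta>)" by (simp only: mult_ac)
    finally show ?thesis by (simp add: D)
  qed
  have discr: "F1 * F1 = \<Delta> * \<Delta> + 4 * (F0 * F2)"
    by (simp add: F0_def F1_def F2_def \<Delta>_def algebra_simps)
  have inv_mem: "A * B * (D * D) \<in> \<iota> ` K" if AB: "A \<in> {F0, F1, F2}" "B \<in> {F0, F1, F2}" for A B
  proof (rule fixed_mem_base)
    fix \<sigma> C
    assume \<sigma>: "ring_automorphism \<sigma>" "\<And>k. k \<in> \<iota> ` K \<Longrightarrow> \<sigma> k = k" "\<And>y. \<sigma> (\<Phi> y) = \<Phi> (\<sigma> y)"
      "map_matrix \<sigma> U = U ** map_matrix c C"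
    have hom\<sigma>: "ring_hom_on UNIV \<sigma>" using \<sigma>(1) by (simp add: ring_automorphism_def)
    note h\<sigma> = ring_hom_onD[OF hom\<sigma>]
    have \<sigma>c: "\<sigma> (c z) = c z" for z using \<sigma>(2) K_elliptic_const by blast
    have "\<sigma> \<in> difference_automorphisms K \<iota> \<Phi>"
      using \<sigma> by (auto simp: difference_automorphisms_def fun_eq_iff)
    hence "C \<in> G" using \<sigma>(4) by (auto simp: difference_galois_group_def o_def)
    define X where "X = P ** C ** Q"
    have "C ** Q = Q ** X" by (simp add: X_def matrix_mul_assoc inv)
    hence "map_matrix c C ** map_matrix c Q = map_matrix c Q ** map_matrix c X"
      by (simp add: map_matrix_mult[OF homc, symmetric])
    moreover have "map_matrix \<sigma> (map_matrix c Q) = map_matrix c Q"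
      by (simp add: map_matrix_def \<sigma>c)
    ultimately have "map_matrix \<sigma> Y = Y ** map_matrix c X"
      unfolding Y_def map_matrix_mult[OF hom\<sigma>] by (simp add: \<sigma>(4) matrix_mul_assoc[symmetric])
    hence "map_matrix \<sigma> Y $ i $ j = (Y ** map_matrix c X) $ i $ j" for i j by simp
    hence \<sigma>Y: "\<sigma> (Y $ i $ j) = Y $ i $ 1 * c (X $ 1 $ j) + Y $ i $ 2 * c (X $ 2 $ j)" for i j
      by (simp add: map_matrix_def matrix_matrix_mult_def sum_2)
    have "X \<in> {vector [vector [\<alpha>, 0], vector [0, \<beta>]] | \<alpha> \<beta>. \<alpha> \<noteq> 0 \<and> \<beta> \<noteq> 0} \<union>
        {vector [vector [0, \<gamma>], vector [\<delta>, 0]] | \<gamma> \<delta>. \<gamma> \<noteq> 0 \<and> \<delta> \<noteq> 0}"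
      using P(2) \<open>C \<in> G\<close> by (simp add: X_def Q_def)
    hence cases: "X $ 1 $ 2 = 0 \<and> X $ 2 $ 1 = 0 \<or> X $ 1 $ 1 = 0 \<and> X $ 2 $ 2 = 0" by auto
    \<comment> \<open>An antidiagonal matrix changes the sign of the Casoratian but not of the
      \<open>F\<close>s. Hence only \<open>D * D\<close> can serve as a denominator, and two of the
      \<open>F\<close>s have to be multiplied together.\<close>
    have "\<exists>s. \<sigma> F0 = s * F0 \<and> \<sigma> F1 = s * F1 \<and> \<sigma> F2 = s * F2 \<and> \<sigma> \<Delta> * \<sigma> \<Delta> = s * s * (\<Delta> * \<Delta>)"
      using cases
    proof
      assume "X $ 1 $ 2 = 0 \<and> X $ 2 $ 1 = 0"
      thus ?thesis
        by (intro exI[of _ "c (X $ 1 $ 1) * c (X $ 2 $ 2)"])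
           (simp add: F0_def F1_def F2_def \<Delta>_def h\<sigma> \<sigma>Y hc algebra_simps)
    next
      assume "X $ 1 $ 1 = 0 \<and> X $ 2 $ 2 = 0"
      thus ?thesis
        by (intro exI[of _ "c (X $ 1 $ 2) * c (X $ 2 $ 1)"])
           (simp add: F0_def F1_def F2_def \<Delta>_def h\<sigma> \<sigma>Y hc algebra_simps)
    qed
    then obtain s where s: "\<sigma> F0 = s * F0" "\<sigma> F1 = s * F1" "\<sigma> F2 = s * F2" "\<sigma> \<Delta> * \<sigma> \<Delta> = s * s * (\<Delta> * \<Delta>)"
      by blast
    have "\<sigma> D * \<sigma> \<Delta> = 1" using D h\<sigma>(1,3) by metis
    hence "(\<sigma> D * \<sigma> \<Delta>) * (\<sigma> D * \<sigma> \<Delta>) = 1" by simp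
    hence "\<sigma> D * \<sigma> D * (\<sigma> \<Delta> * \<sigma> \<Delta>) = 1" by (simp only: mult_ac)
    hence 1: "\<sigma> D * \<sigma> D * (s * s * (\<Delta> * \<Delta>)) = 1" by (simp only: s(4))
    have "D * D = D * D * (\<sigma> D * \<sigma> D * (s * s * (\<Delta> * \<Delta>)))" by (simp only: 1 mult_1_right)
    also have "\<dots> = (D * \<Delta>) * (D * \<Delta>) * (\<sigma> D * \<sigma> D * (s * s))" by (simp only: mult_ac)
    finally have DD: "D * D = \<sigma> D * \<sigma> D * (s * s)" by (simp add: D)
    have "\<sigma> A = s * A" "\<sigma> B = s * B" using AB s by auto
    hence "\<sigma> (A * B * (D * D)) = A * B * (\<sigma> D * \<sigma> D * (s * s))" by (simp add: h\<sigma> mult_ac)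
    thus "\<sigma> (A * B * (D * D)) = A * B * (D * D)" by (simp only: DD)
  qed
  obtain e where e: "e \<in> K" "\<iota> e = F0 * F0 * (D * D)" using inv_mem[of F0 F0] by auto
  obtain e1 where e1: "e1 \<in> K" "\<iota> e1 = F0 * F1 * (D * D)" using inv_mem[of F0 F1] by auto
  obtain e2 where e2: "e2 \<in> K" "\<iota> e2 = F0 * F2 * (D * D)" using inv_mem[of F0 F2] by auto
  note mem = e(1) e1(1) e2(1) aK bK
  have two: "\<iota> 2 = 2" "2 \<in> K" "1 \<in> K"
    using \<iota>_add[of 1 1] K_elliptic_closed(1)[of 1 \<tau> 1] K_elliptic_0_1 by (simp_all add: \<iota>_1)
  have DD\<Delta>: "D * D * (\<Delta> * \<Delta>) = 1"
  proof -
    have "D * D * (\<Delta> * \<Delta>) = (D * \<Delta>) * (D * \<Delta>)" by (simp only: mult_ac)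
    thus ?thesis by (simp add: D)
  qed
  have \<phi>e: "\<iota> (\<phi> e) = F2 * F2 * (\<Phi> D * \<Phi> D)"
    using \<Phi>_\<iota>[OF e(1)] by (simp add: e(2) h\<Phi> \<Phi>F)
  have \<phi>e1: "\<iota> (\<phi> e1) = F2 * (- (\<iota> a * F2 + \<iota> a * F2) - \<iota> b * F1) * (\<Phi> D * \<Phi> D)"
    using \<Phi>_\<iota>[OF e1(1)] by (simp add: e1(2) h\<Phi> \<Phi>F)
  note mem2 = K_elliptic_shift[OF e(1), of h] K_elliptic_shift[OF e1(1), of h]
  note cl = K_elliptic_closed(1)[of _ \<tau>] K_elliptic_closed(2)[of _ \<tau>]
  \<comment> \<open>If \<open>F0\<close> vanished, so would \<open>F2 = \<Phi> F0\<close>; then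
    \<open>\<Phi> F2\<close> leaves \<open>\<iota> a * \<iota> b * F1 = 0\<close>, hence
    \<open>F1 = 0\<close> because \<open>a * b \<noteq> 0\<close>, and the discriminant would be
    zero.\<close>
  have "e \<noteq> 0"
  proof
    assume "e = 0"
    hence "F0 * F0 * (D * D) = 0" using e(2) \<iota>_0 by simp
    hence "(F0 * D) * (F0 * D) = 0" by (simp add: mult_ac)
    hence "F0 * D = 0" by (rule reduced)
    hence "F0 * (D * \<Delta>) = 0" by (simp add: mult.assoc[symmetric])
    hence F0: "F0 = 0" by (simp add: D)
    hence F2: "F2 = 0" using \<Phi>F(1) h\<Phi>(4) by simp
    hence "\<iota> a * \<iota> b * F1 = 0" using \<Phi>F(3) F0 h\<Phi>(4) by simp
    hence "\<iota> (inverse (a * b)) * (\<iota> (a * b) * F1) = 0" by (simp add: \<iota>_mult mem)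
    moreover have "\<iota> (inverse (a * b)) * \<iota> (a * b) = 1"
    proof -
      have abK: "a * b \<in> K" by (rule K_elliptic_closed(2)[OF aK bK])
      have "\<iota> (inverse (a * b)) * \<iota> (a * b) = \<iota> (inverse (a * b) * (a * b))"
        using K_elliptic_closed(4)[OF abK abK] abK by (simp only: \<iota>_mult)
      also have "inverse (a * b) * (a * b) = 1" using a0 b(2) by (intro left_inverse) simp
      finally show ?thesis by (simp add: \<iota>_1)
    qed
    ultimately have "F1 = 0" by (simp add: mult.assoc[symmetric])
    hence "\<Delta> * \<Delta> = 0" using discr F0 by simp
    thus False using DD\<Delta> by simp
  qed
  moreover have "e1 * e1 = e * (1 + 2 * 2 * e2)"
  proof -
    have "\<iota> (e * (1 + 2 * 2 * e2)) = \<iota> e * (1 + 2 * 2 * \<iota> e2)"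
      by (simp only: \<iota>_mult \<iota>_add \<iota>_1 two cl mem)
    also have "\<dots> = F0 * F0 * (D * D) * (D * D * (\<Delta> * \<Delta>) + 4 * (F0 * F2 * (D * D)))"
      by (simp add: e(2) e2(2) DD\<Delta>)
    also have "\<dots> = F0 * F0 * (D * D) * (D * D) * (\<Delta> * \<Delta> + 4 * (F0 * F2))" by (simp add: algebra_simps)
    also have "\<dots> = \<iota> (e1 * e1)" unfolding discr[symmetric] by (simp add: \<iota>_mult mem e1(2) mult_ac)
    finally show ?thesis using \<iota>_inj by (metis cl mem two)
  qed
  moreover have "e2 * e2 = e * \<phi> e * (b * b)"
  proof -
    have "\<iota> (e * \<phi> e * (b * b)) = \<iota> e * \<iota> (\<phi> e) * (\<iota> b * \<iota> b)"
      by (simp only: \<iota>_mult cl mem mem2)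
    also have "\<dots> = F0 * F0 * (D * D) * (F2 * F2) * ((\<Phi> D * \<iota> b) * (\<Phi> D * \<iota> b))"
      by (simp only: e(2) \<phi>e mult_ac)
    also have "\<dots> = \<iota> (e2 * e2)" by (simp add: \<Phi>D \<iota>_mult mem e2(2) mult_ac)
    finally show ?thesis using \<iota>_inj by (metis cl mem mem2)
  qed
  moreover have "b * e * (\<phi> e1 + 2 * a * \<phi> e) = - e1 * e2"
  proof -
    have "\<iota> (b * e * (\<phi> e1 + 2 * a * \<phi> e)) = \<iota> b * \<iota> e * (\<iota> (\<phi> e1) + 2 * \<iota> a * \<iota> (\<phi> e))"
      by (simp only: \<iota>_mult \<iota>_add two cl mem mem2)
    also have "\<dots> = - (\<iota> e * (F1 * F2) * ((\<Phi> D * \<iota> b) * (\<Phi> D * \<iota> b)))"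
      by (simp add: \<phi>e \<phi>e1 algebra_simps)
    also have "\<dots> = \<iota> (- (e1 * e2))"
      by (simp add: \<Phi>D e(2) \<iota>_uminus \<iota>_mult mem e1(2) e2(2) cl mult_ac)
    finally have "b * e * (\<phi> e1 + 2 * a * \<phi> e) = - (e1 * e2)"
      using \<iota>_inj K_elliptic_closed(3)[of "e1 * e2" \<tau> "e1 * e2"] by (metis cl mem mem2 two(2))
    thus ?thesis by simp
  qed
  ultimately show ?thesis by (rule that[OF mem(1-3)])
qed

lemma imprimitive_periodic_solution:
  assumes irr: "irreducible_GL2 G" and imp: "imprimitive_GL2 G" and a0: "a \<noteq> 0"
  shows "\<exists>u\<in>M_periodic (scaled_lattice 2 \<tau>).
    (\<phi> (\<phi> u) + (\<phi> (\<phi> (b / a)) - \<phi> a + \<phi> b / a)) * u = - (\<phi> b * b) / a ^ 2"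
proof -
  have none: "\<not> (\<exists>w\<in>K. w \<noteq> 0 \<and> \<phi> w = - a - b / w)" using linear_factor_reducible irr by blast
  obtain e e1 e2 where e: "e \<in> K" "e1 \<in> K" "e2 \<in> K" "e \<noteq> 0"
    "e1 * e1 = e * (1 + 2 * 2 * e2)" "e2 * e2 = e * \<phi> e * (b * b)"
    "b * e * (\<phi> e1 + 2 * a * \<phi> e) = - e1 * e2"
    by (rule imprimitive_invariants[OF imp a0])
  \<comment> \<open>The multiplier of \<open>e\<close> under \<open>\<phi>\<close> is a square, as
    \<open>K_elliptic_sqrt\<close> demands.\<close>
  have "\<phi> e = (e2 / (e * b)) * (e2 / (e * b)) * e"
  proof -
    have "\<phi> e = e2 * e2 / (e * (b * b))" using e(4,6) b(2) by (simp add: field_simps)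
    thus ?thesis using e(4) b(2) by simp
  qed
  then obtain s where s: "s \<in> K" "s * s = e" using K_elliptic_sqrt[OF \<tau> h e(1,4)] by blast
  define w1 w2 where "w1 = (e1 + s) / (2 * e)" and "w2 = (e1 - s) / (2 * e)"
  have \<phi>2: "\<phi> 2 = 2" using shift_mero_simps(1,2) by (metis one_add_one)
  note w = riccati_of_invariants[OF mero_two_nonzero \<phi>2 e(4) b(2) s(2) e(5-7), folded w1_def w2_def]
  have "2 \<in> K" using K_elliptic_closed(1)[OF K_elliptic_0_1(2) K_elliptic_0_1(2)] by simp
  hence wK: "w1 \<in> K" "w2 \<in> K"
    unfolding w1_def w2_def by (intro K_elliptic_closed(1,2,5,6) e s; assumption)+
  \<comment> \<open>The alternative that \<open>w1\<close> is a fixed point is ruled out by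
    irreducibility.\<close>
  have \<phi>w: "\<phi> w1 = - a - b / w2" "\<phi> w2 = - a - b / w1" using w none wK by auto
  have per: "w1 \<in> M_periodic (scaled_lattice 2 \<tau>)"
    by (rule riccati_orbit_periodic[OF \<tau> h b(2) a b(1) wK w(1,2) \<phi>w none])
  have "scaled_lattice 2 \<tau> \<subseteq> period_lattice \<tau>"
    using period_lattice_closed(2) by (auto simp: scaled_lattice_def simp del: of_nat_numeral)
  hence "a \<in> M_periodic (scaled_lattice 2 \<tau>)" "b \<in> M_periodic (scaled_lattice 2 \<tau>)"
    using a b(1) M_periodic_mono by auto
  hence "- w1 - b / a \<in> M_periodic (scaled_lattice 2 \<tau>)"
    by (intro M_periodic_closed(5,6) M_periodic_closed(3)[OF per per])
  thus ?thesis using riccati_orbit_solution[OF a0 w(1,2) \<phi>w] by blast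
qed

end

theorem theorem5p1:
  fixes \<tau> h :: complex and a b :: mero
    and \<iota> :: "mero \<Rightarrow> 'r::comm_ring_1" and \<Phi> :: "'r \<Rightarrow> 'r" and U :: "'r^2^2"
    and \<phi> :: "mero \<Rightarrow> mero" and G :: "(complex^2^2) set"
  assumes "Im \<tau> > 0"
    and "\<forall>n\<ge>1. of_nat n * h \<notin> period_lattice \<tau>"
    and "\<phi> = shift_mero h"
    and "a \<in> M_periodic (period_lattice \<tau>)"
    and "b \<in> M_periodic (period_lattice \<tau>)" and "b \<noteq> 0"
    and "picard_vessiot (K_elliptic \<tau>) \<phi> (companion2 a b) \<iota> \<Phi> U"
    and "G = difference_galois_group const_mero (K_elliptic \<tau>) \<iota> \<Phi> U"
    and "irreducible_GL2 G"
    and "a \<noteq> 0"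
  shows "imprimitive_GL2 G \<longleftrightarrow>
    (\<exists>u \<in> M_periodic (scaled_lattice 2 \<tau>).
       (\<phi> (\<phi> u) + (\<phi> (\<phi> (b / a)) - \<phi> a + \<phi> b / a)) * u = - (\<phi> b * b) / a ^ 2)"
proof -
  interpret elliptic_pv \<tau> h a b \<iota> \<Phi> U
    by standard (use assms in simp_all)
  have "M_periodic (scaled_lattice 2 \<tau>) \<subseteq> K_elliptic \<tau>" by (rule M_periodic_scaled) simp
  thus ?thesis
    using imprimitive_periodic_solution second_order_factor_imprimitive assms(3,8-10) by blast
qed

end
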